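(* Let $Y_f(t)=\sum_{i=1}^{N_f(t)}X_i$, $t\ge 0$, be the generalized fractional compound Poisson process associated with a Bernstein function $f$, a rate $\lambda>0$ and a jump distribution $F_X$. Then its probability mass function $P_f(n,t)=\mathbb{P}[Y_f(t)=n]$ satisfies the fractional differential equation $$\mathcal{D}^{f}_{t}P_f(n,t)=-\lambda P_f(n,t)+\lambda\int_{-\infty}^{\infty}P_f(n-x,t)\,F_X(dx).$$
   Context: Let $f(s)=bs+\int_0^\infty(1-e^{-sx})\,\nu(dx)$, $s>0$, with $b\ge 0$ and $\nu$ a non-negative L\'evy measure on $(0,\infty)$ with $\int_0^\infty (x\wedge 1)\,\nu(dx)<\infty$ and $\nu((0,\infty))=\infty$. Let $\{D_f(t)\}_{t\ge0}$ be the L\'evy subordinator with $\mathbb{E}[e^{-sD_f(t)}]=e^{-tf(s)}$ and $E_f(t)=\inf\{r\ge0: D_f(r)>t\}$ its inverse. Let $\{N(t)\}_{t\ge0}$ be a Poisson process with rate $\lambda>0$ independent of $\{E_f(t)\}$, and $N_f(t)=N(E_f(t))$. Let $X_1,X_2,\dots$ be iid real random variables with common distribution $F_X$, independent of $N$ and $E_f$. The generalized fractional compound Poisson process (GFCPP) is $Y_f(t)=\sum_{i=1}^{N_f(t)}X_i$ (empty sum equal to $0$). The generalized Caputo–Djrbashian derivative with respect to $f$ is, for absolutely continuous $u$, $$\mathcal{D}^f_t u(t)=b\frac{d}{dt}u(t)+\int_0^t\frac{\partial}{\partial t}u(t-s)\,\bar\nu(s)\,ds,\qquad \bar\nu(s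)=\nu((s,\infty)).$$
   Formalization: The formal theorem additionally assumes that t ↦ P_f(n,t) is absolutely continuous on every [0,T], the domain of D^f_t; without this the equation can fail (e.g. b=0, X=1, ν=Σδ_{2^{-2^k}}, where P_f(0,t) is singular). The equation is stated for all t>0. *)

theory Defs
  imports "HOL-Probability.Probability"
begin

section \<open>Bernstein functions\<close>

definition levy_measure :: "real measure \<Rightarrow> bool" where
  "levy_measure \<nu> \<longleftrightarrow>
     sets \<nu> = sets borel \<and> emeasure \<nu> {..0} = 0 \<and>
     (\<integral>\<^sup>+ x\<in>{0<..}. ennreal (min x 1) \<partial>\<nu>) < \<infinity> \<and>
     emeasure \<nu> {0<..} = \<infinity>"

definition bernstein :: "real \<Rightarrow> real measure \<Rightarrow> real \<Rightarrow> real" where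
  "bernstein b \<nu> s = b * s + (LINT x:{0<..}|\<nu>. 1 - exp (- s * x))"

text \<open>The tail is finite for positive arguments, the only ones at which it matters below.\<close>
definition levy_tail :: "real measure \<Rightarrow> real \<Rightarrow> real" where
  "levy_tail \<nu> s = measure \<nu> {s<..}"


section \<open>Processes indexed by the nonnegative half-line\<close>

definition cadlag_path :: "(real \<Rightarrow> real) \<Rightarrow> bool" where
  "cadlag_path g \<longleftrightarrow>
     (\<forall>t\<ge>0. (g \<longlongrightarrow> g t) (at_right t)) \<and> (\<forall>t>0. \<exists>l. (g \<longlongrightarrow> l) (at_left t))"

definition levy_process :: "'a measure \<Rightarrow> (real \<Rightarrow> 'a \<Rightarrow> real) \<Rightarrow> bool" where
  "levy_process M Z \<longleftrightarrow>
     prob_space M \<and>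
     (\<forall>t\<ge>0. Z t \<in> borel_measurable M) \<and>
     (AE \<omega> in M. Z 0 \<omega> = 0) \<and>
     (\<forall>\<tau> :: nat \<Rightarrow> real. \<forall>n. 0 \<le> \<tau> 0 \<and> mono \<tau> \<longrightarrow>
        prob_space.indep_vars M (\<lambda>_. borel) (\<lambda>k \<omega>. Z (\<tau> (Suc k)) \<omega> - Z (\<tau> k) \<omega>) {..<n}) \<and>
     (\<forall>s\<ge>0. \<forall>h\<ge>0. distr M borel (\<lambda>\<omega>. Z (s + h) \<omega> - Z s \<omega>) = distr M borel (Z h)) \<and>
     (AE \<omega> in M. cadlag_path (\<lambda>t. Z t \<omega>))"

definition levy_subordinator ::
    "'a measure \<Rightarrow> (real \<Rightarrow> real) \<Rightarrow> (real \<Rightarrow> 'a \<Rightarrow> real) \<Rightarrow> bool" where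
  "levy_subordinator M f D \<longleftrightarrow>
     levy_process M D \<and>
     (AE \<omega> in M. mono_on {0..} (\<lambda>t. D t \<omega>)) \<and>
     (\<forall>t\<ge>0. \<forall>s>0. (LINT \<omega>|M. exp (- s * D t \<omega>)) = exp (- t * f s))"

definition inverse_process :: "(real \<Rightarrow> 'a \<Rightarrow> real) \<Rightarrow> real \<Rightarrow> 'a \<Rightarrow> real" where
  "inverse_process D t \<omega> = Inf {r. 0 \<le> r \<and> t < D r \<omega>}"

definition poisson_process :: "'a measure \<Rightarrow> real \<Rightarrow> (real \<Rightarrow> 'a \<Rightarrow> nat) \<Rightarrow> bool" where
  "poisson_process M lam N \<longleftrightarrow>
     levy_process M (\<lambda>t \<omega>. real (N t \<omega>)) \<and>
     (\<forall>t>0. distr M (count_space UNIV) (N t) = measure_pmf (poisson_pmf (lam * t)))"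

definition generated_events :: "'a measure \<Rightarrow> ('i \<Rightarrow> 'a \<Rightarrow> real) \<Rightarrow> 'i set \<Rightarrow> 'a set set" where
  "generated_events M Z I =
     sigma_sets (space M) {Z i -` A \<inter> space M | i A. i \<in> I \<and> A \<in> sets borel}"


section \<open>The generalized fractional compound Poisson process\<close>

definition gfcpp ::
    "(real \<Rightarrow> 'a \<Rightarrow> nat) \<Rightarrow> (real \<Rightarrow> 'a \<Rightarrow> real) \<Rightarrow> (nat \<Rightarrow> 'a \<Rightarrow> real) \<Rightarrow> real \<Rightarrow> 'a \<Rightarrow> real" where
  "gfcpp N E X t \<omega> = (\<Sum>i = 1..N (E t \<omega>) \<omega>. X i \<omega>)"

text \<open>Path properties hold only almost surely, so a time-changed process is measurable only up
  to null sets; its probabilities are therefore read in the completion of \<open>M\<close>, which agrees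
  with \<open>M\<close> on the measurable sets of \<open>M\<close>.\<close>
definition mass_function :: "'a measure \<Rightarrow> (real \<Rightarrow> 'a \<Rightarrow> real) \<Rightarrow> real \<Rightarrow> real \<Rightarrow> real" where
  "mass_function M Y n t = measure (completion M) {\<omega> \<in> space M. Y t \<omega> = n}"


section \<open>The generalized Caputo--Djrbashian derivative\<close>

text \<open>Absolute continuity on every compact interval \<open>[0, T]\<close>; the \<open>i\<close>-th interval of the finite
  disjoint family is \<open>(l i, r i)\<close>.\<close>
definition abs_continuous_on_halfline :: "(real \<Rightarrow> real) \<Rightarrow> bool" where
  "abs_continuous_on_halfline u \<longleftrightarrow>
     (\<forall>T>0. \<forall>\<epsilon>>0. \<exists>\<delta>>0. \<forall>(m :: nat) l r.
        (\<forall>i<m. 0 \<le> l i \<and> l i \<le> r i \<and> r i \<le> T) \<and>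
        disjoint_family_on (\<lambda>i. {l i<..<r i}) {..<m} \<and>
        (\<Sum>i<m. r i - l i) < \<delta> \<longrightarrow>
        (\<Sum>i<m. \<bar>u (r i) - u (l i)\<bar>) < \<epsilon>)"

definition caputo_djrbashian :: "real \<Rightarrow> real measure \<Rightarrow> (real \<Rightarrow> real) \<Rightarrow> real \<Rightarrow> real" where
  "caputo_djrbashian b \<nu> u t =
     b * deriv u t +
     (LINT s:{0<..<t}|lebesgue. deriv (\<lambda>\<tau>. u (\<tau> - s)) t * levy_tail \<nu> s)"

text \<open>Excludes the default values of \<^const>\<open>deriv\<close> and of the integral. For absolutely continuous
  \<open>u\<close> the derivative under the integral exists for almost every \<open>s\<close>; the local term is absent
  when \<open>b = 0\<close>.\<close>
definition caputo_djrbashian_exists :: "real \<Rightarrow> real measure \<Rightarrow> (real \<Rightarrow> real) \<Rightarrow> real \<Rightarrow> bool" where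
  "caputo_djrbashian_exists b \<nu> u t \<longleftrightarrow>
     (b \<noteq> 0 \<longrightarrow> u differentiable at t) \<and>
     (AE s in lebesgue. s \<in> {0<..<t} \<longrightarrow> (\<lambda>\<tau>. u (\<tau> - s)) differentiable at t) \<and>
     set_integrable lebesgue {0<..<t} (\<lambda>s. deriv (\<lambda>\<tau>. u (\<tau> - s)) t * levy_tail \<nu> s)"

end

theory Submission
  imports Defs "HOL-Real_Asymp.Real_Asymp"
begin

text \<open>Write \<open>a k = P(X\<^sub>1 + \<dots> + X\<^sub>k = n)\<close> and let \<open>\<psi> x\<close> be the mean of \<open>a\<close> under the Poisson law with
  parameter \<open>\<lambda> x\<close>. Conditioning on \<open>E\<close> gives \<open>P(n, t) = E[\<psi> (E t)]\<close>, while the right-hand side of the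
  equation is \<open>E[\<psi>' (E t)]\<close>. Since \<open>{E t > r} = {D r \<le> t}\<close> up to null sets,
  \<open>P(n, t) = \<psi> 0 + \<integral> \<psi>' (r) P(D r \<le> t) dr\<close>, so that \<open>dP(n, \<cdot>)\<close> is the potential measure of \<open>D\<close> weighted
  by \<open>\<psi>'\<close>. Its convolution with the tail of \<open>\<nu>\<close> is governed by the renewal identity
  \<open>b U + (U * tail) dt = dt\<close> for the potential measure \<open>U\<close>, which follows from uniqueness of Laplace
  transforms.

  The equation is claimed at every \<open>t\<close>. If \<open>b > 0\<close>, the identity shows that \<open>U\<close> has a continuous density and
  \<open>P(n, \<cdot>)\<close> is differentiable everywhere. If \<open>b = 0\<close>, the identity only says that \<open>U * tail = 1\<close> almost
  everywhere, and absolute continuity of \<open>P(n, \<cdot>)\<close> is what lifts it to all \<open>t\<close>: an absolutely continuous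
  measure does not see the exceptional null set.\<close>

section \<open>The Lebesgue differentiation theorem on the line\<close>

text \<open>The weight \<open>\<psi>'\<close> depends on the level \<open>r\<close>, not on the
  position \<open>Y\<close>, so the renewal identity for the potential measure alone does not settle
  the equation. The link is the semigroup property: convolving a weighted potential with the
  potential measure replaces the weight by its primitive. Without drift this yields only an
  integrated form of the wanted formula, and one derivative must be won back. Differentiating in
  \<open>t\<close> would again give an almost everywhere statement. Adding an independent copy of
  \<open>Z \<epsilon>\<close> differentiates in the level instead and keeps \<open>t\<close> fixed;
  the layer of levels near 0 then contributes the boundary term \<open>\<psi>' 0\<close>. The tail
  is unbounded near 0, so integrals of it at a prescribed \<open>t\<close> are controlled by the
  bound 1 on its convolution with the potential measure at every point. Since \<open>\<psi>'\<close>
  changes sign, absolute continuity is exploited for a difference of two measures, each of which may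
  be singular. The differentiation theorem enters because the integrand of the Caputo derivative
  contains derivatives that must exist for almost every \<open>s\<close>.\<close>

lemma zero_density_negligible:
  fixes L :: "real measure"
  assumes "finite_measure L" and L: "sets L = sets borel" and A: "A \<in> sets borel" "emeasure L A = 0"
    and c: "c > 0"
  shows "negligible {x \<in> A. \<forall>d>0. \<exists>h. 0 < h \<and> h < d \<and> c * h < measure L (ball x h)}" (is "negligible ?S")
  unfolding negligible_outer_le
proof (intro allI impI)
  interpret finite_measure L by fact
  fix e :: real assume e: "e > 0"
  have "(INF U \<in> {U. A \<subseteq> U \<and> open U}. emeasure L U) = 0"
    using outer_regular[OF L _ A(1)] A(2) emeasure_finite by (metis infinity_ennreal_def)
  \<comment> \<open>A ball of radius \<open>5 * h\<close> has length \<open>10 * h\<close>, at most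
    \<open>10 / c\<close> times the mass of the ball of radius \<open>h\<close>. With total mass at
    most \<open>e * c / 10\<close> the lengths add up to at most \<open>e\<close>.\<close>
  also have "0 < ennreal (e * c / 10)" using e c by simp
  finally obtain U where U: "A \<subseteq> U" "open U" "emeasure L U < ennreal (e * c / 10)"
    by (auto simp: INF_less_iff)
  then have mU: "measure L U \<le> e * c / 10"
    using e c by (auto simp: emeasure_eq_measure ennreal_less_iff)
  define K where "K = {(x, h). 0 < h \<and> h \<le> 1 \<and> ball x h \<subseteq> U \<and> c * h < measure L (ball x h)}"
  have S: "?S \<subseteq> (\<Union>i\<in>K. ball (fst i) (snd i))"
  proof
    fix x assume x: "x \<in> ?S"
    then obtain d where d: "d > 0" "ball x d \<subseteq> U" using U openE by blast
    obtain h where h: "0 < h" "h < min d 1" "c * h < measure L (ball x h)"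
      using x d(1) by (auto dest!: spec[of _ "min d 1"])
    then have "(x, h) \<in> K" using d by (auto simp: K_def subset_iff)
    then show "x \<in> (\<Union>i\<in>K. ball (fst i) (snd i))" using h(1) by (auto intro!: bexI[of _ "(x, h)"])
  qed
  have r: "0 < snd i \<and> snd i \<le> 1" if "i \<in> K" for i using that by (auto simp: K_def)
  \<comment> \<open>Vitali's covering lemma: a countable disjoint subfamily remains whose fivefold
    enlargements still cover. Disjointness is what bounds the sum of the masses by the mass of
    \<open>U\<close>.\<close>
  obtain C where C: "countable C" "C \<subseteq> K"
     "pairwise (\<lambda>i j. disjnt (ball (fst i) (snd i)) (ball (fst j) (snd j))) C"
     "?S \<subseteq> (\<Union>i\<in>C. ball (fst i) (5 * snd i))"
    by (rule Vitali_covering_lemma_balls[OF S r])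
  have bound: "measure lebesgue (\<Union>i\<in>I. ball (fst i) (5 * snd i)) \<le> e" if I: "I \<subseteq> C" "finite I" for I
  proof -
    have pos: "0 < snd i" "c * snd i < measure L (ball (fst i) (snd i))" "ball (fst i) (snd i) \<subseteq> U" if "i \<in> I" for i
    proof -
      have "i \<in> K" using that I C(2) by auto
      then show "0 < snd i" "c * snd i < measure L (ball (fst i) (snd i))" "ball (fst i) (snd i) \<subseteq> U"
        unfolding K_def split_beta by auto
    qed
    have "measure lebesgue (\<Union>i\<in>I. ball (fst i) (5 * snd i)) \<le> (\<Sum>i\<in>I. measure lebesgue (ball (fst i) (5 * snd i)))"
      using I(2) by (intro measure_UNION_le) auto
    also have "\<dots> = (\<Sum>i\<in>I. 10 * snd i)"
    proof (rule sum.cong)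
      fix i assume "i \<in> I"
      then have "0 < snd i" using pos by auto
      then show "measure lebesgue (ball (fst i) (5 * snd i)) = 10 * snd i"
        by (simp add: ball_eq_greaterThanLessThan)
    qed simp
    also have "\<dots> \<le> (\<Sum>i\<in>I. 10 / c * measure L (ball (fst i) (snd i)))"
      using pos c by (intro sum_mono) (force simp: field_simps)
    also have "\<dots> = 10 / c * (\<Sum>i\<in>I. measure L (ball (fst i) (snd i)))"
      by (simp add: sum_distrib_left)
    also have "(\<Sum>i\<in>I. measure L (ball (fst i) (snd i))) = measure L (\<Union>i\<in>I. ball (fst i) (snd i))"
    proof (intro finite_measure_finite_Union[symmetric])
      show "disjoint_family_on (\<lambda>i. ball (fst i) (snd i)) I"
        using I C(3) unfolding disjoint_family_on_def pairwise_def disjnt_def by blast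
    qed (use I L in auto)
    also have "\<dots> \<le> measure L U"
      using pos(3) U(2) by (intro finite_measure_mono) (auto simp: L)
    also have "\<dots> \<le> e * c / 10" by (rule mU)
    finally show ?thesis using c by (simp add: field_simps)
  qed
  show "\<exists>T. ?S \<subseteq> T \<and> T \<in> lmeasurable \<and> measure lebesgue T \<le> e"
  proof (intro exI conjI)
    show "?S \<subseteq> (\<Union>i\<in>C. ball (fst i) (5 * snd i))" by fact
    show "(\<Union>i\<in>C. ball (fst i) (5 * snd i)) \<in> lmeasurable"
      by (rule fmeasurable_UN_bound[OF C(1) _ bound]) auto
    show "measure lebesgue (\<Union>i\<in>C. ball (fst i) (5 * snd i)) \<le> e"
      by (rule measure_UN_bound[OF C(1) _ bound]) auto
  qed
qed

text \<open>The measure with density \<open>max 0 (f - r)\<close> vanishes on \<open>{f < r}\<close> and therefore has density zero at almost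
  every point of this set.\<close>
lemma interval_average_upper:
  fixes f :: "real \<Rightarrow> real" and r :: real
  assumes f: "integrable lborel f"
  shows "negligible {x \<in> {0<..<T}. f x < r \<and>
    \<not> (\<forall>e>0. \<exists>d>0. \<forall>a b. a \<le> x \<and> x \<le> b \<and> a < b \<and> b - a < d \<longrightarrow>
        (LINT y:{a<..b}|lborel. f y) \<le> (r + e) * (b - a))}" (is "negligible ?B")
proof -
  have [measurable]: "f \<in> borel_measurable borel" using f by auto
  \<comment> \<open>The cutoff makes the constant part integrable. An interval shorter than 1 that
    contains a point of \<open>{0<..<T}\<close> stays inside \<open>{-1..T+1}\<close>, where the
    cutoff is invisible.\<close>
  define g where "g y = indicator {-1..T+1} y * max 0 (f y - r)" for y
  have g0: "0 \<le> g y" for y by (simp add: g_def)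
  have [measurable]: "g \<in> borel_measurable borel" unfolding g_def by measurable
  have gi: "integrable lborel g"
  proof (rule Bochner_Integration.integrable_bound)
    show "integrable lborel (\<lambda>y. \<bar>f y\<bar> + \<bar>r\<bar> * indicator {-1..T+1} y)"
      using f by (intro Bochner_Integration.integrable_add integrable_mult_right integrable_real_indicator)
        (auto simp: emeasure_lborel_Icc_eq)
  qed (auto simp: g_def indicator_def)
  define L where "L = density lborel (\<lambda>y. ennreal (g y))"
  have sL: "sets L = sets borel" by (simp add: L_def)
  have fL: "finite_measure L"
    unfolding L_def using gi g0
    by (intro finite_measureI) (auto simp: emeasure_density nn_integral_eq_integral)
  interpret L: finite_measure L by fact
  have L0: "emeasure L {x. f x < r} = 0"
  proof -
    have "emeasure L {x. f x < r} = (\<integral>\<^sup>+y. ennreal (g y) * indicator {x. f x < r} y \<partial>lborel)"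
      unfolding L_def by (subst emeasure_density) auto
    also have "\<dots> = (\<integral>\<^sup>+(y::real). 0 \<partial>lborel)"
      by (intro nn_integral_cong) (auto simp: g_def split: split_indicator)
    finally show ?thesis by simp
  qed
  define S where "S c = {x \<in> {x. f x < r}. \<forall>d>0. \<exists>h. 0 < h \<and> h < d \<and> c * h < measure L (ball x h)}" for c
  have "?B \<subseteq> (\<Union>n. S (1 / Suc n))"
  proof
    fix x assume x: "x \<in> ?B"
    then obtain e where e: "e > 0" and bad: "\<And>d. d > 0 \<Longrightarrow> \<exists>a b. a \<le> x \<and> x \<le> b \<and> a < b \<and> b - a < d \<and>
        (r + e) * (b - a) < (LINT y:{a<..b}|lborel. f y)" by (auto simp: not_le)
    \<comment> \<open>The half compensates for a doubled radius: an interval of length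
      \<open>b - a\<close> with excess mass above \<open>e * (b - a)\<close> is placed in the ball
      of radius \<open>2 * (b - a)\<close> around \<open>x\<close>.\<close>
    obtain n where n: "1 / Suc n < e / 2" using e by (metis half_gt_zero inverse_eq_divide reals_Archimedean)
    have "\<exists>h. 0 < h \<and> h < d \<and> 1 / Suc n * h < measure L (ball x h)" if d: "d > 0" for d
    proof -
      obtain a b where ab: "a \<le> x" "x \<le> b" "a < b" "b - a < min (d / 2) 1"
        "(r + e) * (b - a) < (LINT y:{a<..b}|lborel. f y)" using bad[of "min (d / 2) 1"] d by auto
      have sub: "{a<..b} \<subseteq> ball x (2 * (b - a))" using ab by (auto simp: ball_eq_greaterThanLessThan)
      have sub2: "{a<..b} \<subseteq> {-1..T+1}" using ab x by auto
      have fi: "set_integrable lborel {a<..b} f"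
        unfolding set_integrable_def using f by (intro integrable_mult_indicator) auto
      have i1: "set_integrable lborel {a<..b} (\<lambda>y. f y - r)"
        using ab fi by (intro set_integral_diff) (auto simp: set_integrable_def)
      have i2: "set_integrable lborel {a<..b} g"
        unfolding set_integrable_def using gi by (intro integrable_mult_indicator) auto
      have "(r + e) * (b - a) < (LINT y:{a<..b}|lborel. f y)" by fact
      also have "(LINT y:{a<..b}|lborel. r) = r * (b - a)"
        using ab by (simp add: set_lebesgue_integral_def)
      then have "(LINT y:{a<..b}|lborel. f y) - r * (b - a) = (LINT y:{a<..b}|lborel. f y - r)"
        using ab fi by (subst set_integral_diff) (auto simp: set_integrable_def)
      then have "(LINT y:{a<..b}|lborel. f y) = r * (b - a) + (LINT y:{a<..b}|lborel. f y - r)" by simp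
      also have "(LINT y:{a<..b}|lborel. f y - r) \<le> (LINT y:{a<..b}|lborel. g y)"
        using sub2 by (intro set_integral_mono[OF i1 i2]) (auto simp: g_def indicator_def)
      also have "(LINT y:{a<..b}|lborel. g y) = measure L {a<..b}"
      proof -
        have "emeasure L {a<..b} = (\<integral>\<^sup>+y. ennreal (indicator {a<..b} y * g y) \<partial>lborel)"
          unfolding L_def by (subst emeasure_density) (auto simp: indicator_def intro!: nn_integral_cong)
        also have "\<dots> = ennreal (LINT y:{a<..b}|lborel. g y)"
          unfolding set_lebesgue_integral_def real_scaleR_def using g0 gi
          by (intro nn_integral_eq_integral integrable_mult_indicator[where f=g, unfolded real_scaleR_def]) auto
        finally show ?thesis
          using g0 by (auto simp: measure_def set_lebesgue_integral_def intro!: integral_nonneg_AE)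
      qed
      also have "\<dots> \<le> measure L (ball x (2 * (b - a)))"
        using sub by (intro L.finite_measure_mono) (auto simp: sL)
      finally have "e * (b - a) < measure L (ball x (2 * (b - a)))" by (simp add: algebra_simps)
      moreover have "1 / Suc n * (2 * (b - a)) \<le> e / 2 * (2 * (b - a))"
        by (rule mult_right_mono[OF less_imp_le[OF n]]) (use ab in simp)
      moreover have "e / 2 * (2 * (b - a)) = e * (b - a)" by simp
      ultimately have "1 / Suc n * (2 * (b - a)) < measure L (ball x (2 * (b - a)))" by linarith
      then show ?thesis using ab by (intro exI[of _ "2 * (b - a)"]) simp
    qed
    then show "x \<in> (\<Union>n. S (1 / Suc n))" using x unfolding S_def by (intro UN_I[of n]) auto
  qed
  moreover have "negligible (\<Union>n. S (1 / Suc n))"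
    unfolding S_def by (intro negligible_Union_nat zero_density_negligible fL sL L0) auto
  ultimately show ?thesis by (rule negligible_subset[rotated])
qed

text \<open>Upper bounds for the averages of \<open>f\<close> and of \<open>- f\<close> enclose the
  averages of \<open>f\<close> around \<open>f x\<close>. Rational bounds \<open>r\<close> keep the
  exceptional set a countable union of null sets, and intervals with
  \<open>a \<le> x \<le> b\<close> serve difference quotients from both sides.\<close>

theorem AE_has_derivative_integral:
  fixes f :: "real \<Rightarrow> real"
  assumes f: "integrable lborel f"
  shows "AE x in lborel. x \<in> {0<..<T} \<longrightarrow>
    ((\<lambda>t. LINT y:{0..t}|lborel. f y) has_real_derivative f x) (at x)"
proof -
  define B where "B f r = {x \<in> {0<..<T}. f x < r \<and>
    \<not> (\<forall>e>0. \<exists>d>0. \<forall>a b. a \<le> x \<and> x \<le> b \<and> a < b \<and> b - a < d \<longrightarrow>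
        (LINT y:{a<..b}|lborel. f y) \<le> (r + e) * (b - a))}" for f :: "real \<Rightarrow> real" and r
  have B: "negligible (B f r)" "negligible (B (\<lambda>x. - f x) r)" for r
    unfolding B_def using f by (intro interval_average_upper; simp)+
  define S where "S = (\<Union>r\<in>\<rat>. B f r \<union> B (\<lambda>x. - f x) r)"
  have "S \<in> null_sets lebesgue"
    unfolding S_def using B by (intro null_sets_UN' countable_rat) (auto simp: negligible_iff_null_sets)
  then have "AE x in lebesgue. x \<notin> S" by (rule AE_not_in)
  then have "AE x in lborel. x \<notin> S" by (simp add: AE_completion_iff)
  then show ?thesis
  proof (rule AE_mp, intro AE_I2 impI)
    fix x assume x: "x \<notin> S" "x \<in> {0<..<T}"
    have si: "set_integrable lborel A f" if "A \<in> sets borel" for A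
      unfolding set_integrable_def using f that by (intro integrable_mult_indicator) auto
    have key: "\<exists>d>0. \<forall>a b. a \<le> x \<and> x \<le> b \<and> a < b \<and> b - a < d \<longrightarrow>
        (LINT y:{a<..b}|lborel. g y) \<le> (g x + e) * (b - a)"
      if e0: "e > 0" and g: "\<And>r. r \<in> \<rat> \<Longrightarrow> x \<notin> B g r" for g and e :: real
    proof -
      have "g x < g x + e / 2" using e0 by simp
      from Rats_dense_in_real[OF this] obtain r where r: "r \<in> \<rat>" "g x < r" "r < g x + e / 2" by blast
      have "\<forall>e>0. \<exists>d>0. \<forall>a b. a \<le> x \<and> x \<le> b \<and> a < b \<and> b - a < d \<longrightarrow>
          (LINT y:{a<..b}|lborel. g y) \<le> (r + e) * (b - a)"
        using g[OF r(1)] r(2) x(2) unfolding B_def by blast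
      from this[rule_format, of "e / 2"] e0 obtain d where d: "d > 0"
        "\<forall>a b. a \<le> x \<and> x \<le> b \<and> a < b \<and> b - a < d \<longrightarrow>
          (LINT y:{a<..b}|lborel. g y) \<le> (r + e / 2) * (b - a)"
        by fastforce
      show ?thesis
      proof (intro exI conjI allI impI)
        fix a b assume ab: "a \<le> x \<and> x \<le> b \<and> a < b \<and> b - a < d"
        then have "(LINT y:{a<..b}|lborel. g y) \<le> (r + e / 2) * (b - a)" using d(2) by auto
        also have "\<dots> \<le> (g x + e) * (b - a)" using r ab by (intro mult_right_mono) auto
        finally show "(LINT y:{a<..b}|lborel. g y) \<le> (g x + e) * (b - a)" .
      qed fact
    qed
    show "((\<lambda>t. LINT y:{0..t}|lborel. f y) has_real_derivative f x) (at x)"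
      unfolding DERIV_def
    proof (rule LIM_I)
      fix e :: real assume "e > 0"
      then have e: "e / 2 > 0" by simp
      have "\<And>r. r \<in> \<rat> \<Longrightarrow> x \<notin> B f r" "\<And>r. r \<in> \<rat> \<Longrightarrow> x \<notin> B (\<lambda>x. - f x) r"
        using x by (auto simp: S_def)
      from key[OF e this(1)] key[OF e this(2)] obtain d1 d2 where d: "d1 > 0" "d2 > 0"
        and d1: "\<And>a b. a \<le> x \<Longrightarrow> x \<le> b \<Longrightarrow> a < b \<Longrightarrow> b - a < d1 \<Longrightarrow>
          (LINT y:{a<..b}|lborel. f y) \<le> (f x + e / 2) * (b - a)"
        and d2: "\<And>a b. a \<le> x \<Longrightarrow> x \<le> b \<Longrightarrow> a < b \<Longrightarrow> b - a < d2 \<Longrightarrow>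
          (LINT y:{a<..b}|lborel. - f y) \<le> (- f x + e / 2) * (b - a)" by blast
      have avg: "\<bar>(LINT y:{a<..b}|lborel. f y) / (b - a) - f x\<bar> < e"
        if ab: "a \<le> x" "x \<le> b" "a < b" "b - a < min d1 d2" for a b
      proof -
        have "(LINT y:{a<..b}|lborel. - f y) = - (LINT y:{a<..b}|lborel. f y)"
          by (simp add: set_lebesgue_integral_def)
        then have "\<bar>(LINT y:{a<..b}|lborel. f y) - f x * (b - a)\<bar> \<le> e / 2 * (b - a)"
          using d1[of a b] d2[of a b] ab unfolding distrib_right[of _ "e / 2"] by linarith
        also have "\<dots> < e * (b - a)" using ab \<open>e > 0\<close> by simp
        finally have "\<bar>(LINT y:{a<..b}|lborel. f y) - f x * (b - a)\<bar> < e * (b - a)" .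
        moreover have "(LINT y:{a<..b}|lborel. f y) / (b - a) - f x =
            ((LINT y:{a<..b}|lborel. f y) - f x * (b - a)) / (b - a)"
          using ab by (simp add: field_simps)
        ultimately show ?thesis using ab by (simp add: divide_less_eq)
      qed
      have diff: "(LINT y:{0..b}|lborel. f y) - (LINT y:{0..a}|lborel. f y) = (LINT y:{a<..b}|lborel. f y)"
        if "0 \<le> a" "a < b" for a b
      proof -
        have "{0..b} = {0..a} \<union> {a<..b}" "{0..a} \<inter> {a<..b} = {}" using that by auto
        then show ?thesis using set_integral_Un[of "{0..a}" "{a<..b}" lborel f] by (simp add: si)
      qed
      show "\<exists>s>0. \<forall>h::real. h \<noteq> 0 \<and> norm (h - 0) < s \<longrightarrow>
          norm (((LINT y:{0..x + h}|lborel. f y) - (LINT y:{0..x}|lborel. f y)) / h - f x) < e"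
      \<comment> \<open>The entry \<open>x\<close> keeps \<open>x + h\<close> nonnegative, as
        \<open>diff\<close> demands.\<close>
      proof (intro exI[of _ "min x (min d1 d2)"] conjI allI impI)
        fix h :: real assume h: "h \<noteq> 0 \<and> norm (h - 0) < min x (min d1 d2)"
        show "norm (((LINT y:{0..x + h}|lborel. f y) - (LINT y:{0..x}|lborel. f y)) / h - f x) < e"
        proof (cases "h > 0")
          case True
          then show ?thesis using avg[of x "x + h"] diff[of x "x + h"] x h by auto
        next
          case False
          then have "h < 0" using h by auto
          moreover define I where "I = (LINT y:{x + h<..x}|lborel. f y)"
          ultimately have "(LINT y:{0..x + h}|lborel. f y) - (LINT y:{0..x}|lborel. f y) = - I"
            "\<bar>I / (- h) - f x\<bar> < e"
            using avg[of "x + h" x] diff[of "x + h" x] x h by auto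
          then show ?thesis by simp
        qed
      qed (use x d in auto)
    qed
  qed
qed

section \<open>Uniqueness of Laplace transforms\<close>

text \<open>On the unit interval all absolute moments are at most 1, so the Taylor polynomials of
  the characteristic function converge to it at every point. Their coefficients are the
  moments.\<close>

lemma unit_interval_moments_unique:
  fixes M1 M2 :: "real measure"
  assumes M1: "real_distribution M1" "AE x in M1. x \<in> {0..1}"
    and M2: "real_distribution M2" "AE x in M2. x \<in> {0..1}"
    and eq: "\<And>k. (LINT x|M1. x ^ k) = (LINT x|M2. x ^ k)"
  shows "M1 = M2"
proof (rule Levy_uniqueness[OF M1(1) M2(1)], rule ext)
  fix t
  have lim: "(\<lambda>n. \<Sum>k\<le>n. ((\<i> * t) ^ k / fact k) * complex_of_real (LINT x|M. x ^ k)) \<longlonglongrightarrow> char M t"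
    if M: "real_distribution M" "AE x in M. x \<in> {0..1}" for M
  proof -
    interpret real_distribution M by fact
    have [simp]: "integrable M (\<lambda>x. x ^ k)" for k
    proof (rule integrable_const_bound[where B=1])
      show "AE x in M. norm (x ^ k) \<le> 1"
        using M(2) by eventually_elim (auto simp: power_le_one)
    qed simp
    have "(LINT x|M. \<bar>x\<bar> ^ n) \<le> (LINT x|M. 1)" for n
    proof (rule integral_mono_AE)
      show "integrable M (\<lambda>x. \<bar>x\<bar> ^ n)" by (simp add: integrable_abs power_abs[symmetric])
      show "AE x in M. \<bar>x\<bar> ^ n \<le> 1"
        using M(2) by eventually_elim (auto simp: power_le_one)
    qed simp
    then have le1: "(LINT x|M. \<bar>x\<bar> ^ n) \<le> 1" for n by (simp add: prob_space[simplified])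
    have "(\<lambda>n. 2 * (inverse (fact n) * \<bar>t\<bar> ^ n)) \<longlonglongrightarrow> 2 * 0"
      by (intro tendsto_mult summable_LIMSEQ_zero[OF summable_exp]) auto
    then have 0: "(\<lambda>n. 2 * \<bar>t\<bar> ^ n / fact n) \<longlonglongrightarrow> 0" by (simp add: field_simps)
    have "(\<lambda>n. char M t - (\<Sum>k\<le>n. ((\<i> * t) ^ k / fact k) * complex_of_real (LINT x|M. x ^ k))) \<longlonglongrightarrow> 0"
    proof (rule Lim_null_comparison[OF _ 0], rule always_eventually, rule allI)
      fix n
      have "cmod (char M t - (\<Sum>k\<le>n. ((\<i> * t) ^ k / fact k) * complex_of_real (LINT x|M. x ^ k)))
          \<le> (2 * \<bar>t\<bar> ^ n / fact n) * (LINT x|M. \<bar>x\<bar> ^ n)"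
        using char_approx1[of n t] by simp
      also have "\<dots> \<le> (2 * \<bar>t\<bar> ^ n / fact n) * 1" using le1[of n] by (intro mult_left_mono) auto
      finally show "cmod (char M t - (\<Sum>k\<le>n. ((\<i> * t) ^ k / fact k) * complex_of_real (LINT x|M. x ^ k)))
          \<le> 2 * \<bar>t\<bar> ^ n / fact n" by simp
    qed
    from tendsto_diff[OF tendsto_const[of "char M t"] this] show ?thesis by simp
  qed
  show "char M1 t = char M2 t"
    using LIMSEQ_unique[OF lim[OF M1]] lim[OF M2] eq by simp
qed

text \<open>The measures may be infinite, as Lebesgue measure on the half-line is. Tilting by
  \<open>exp (- x)\<close> makes them finite, and the substitution \<open>y = exp (- x)\<close>
  turns Laplace transforms at integers into moments on the unit interval.\<close>

theorem laplace_transform_unique: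
  fixes M1 M2 :: "real measure"
  assumes sets: "sets M1 = sets borel" "sets M2 = sets borel"
    and nonneg: "emeasure M1 {..<0} = 0" "emeasure M2 {..<0} = 0"
    and eq: "\<And>s. s > 0 \<Longrightarrow> (\<integral>\<^sup>+x. ennreal (exp (- s * x)) \<partial>M1) = (\<integral>\<^sup>+x. ennreal (exp (- s * x)) \<partial>M2)"
    and fin: "(\<integral>\<^sup>+x. ennreal (exp (- x)) \<partial>M1) < \<infinity>"
  shows "M1 = M2"
proof -
  define c where "c = (\<integral>\<^sup>+x. ennreal (exp (- x)) \<partial>M1)"
  define D where "D M = density M (\<lambda>x. ennreal (exp (- x)))" for M :: "real measure"
  have c2: "(\<integral>\<^sup>+x. ennreal (exp (- x)) \<partial>M2) = c" using eq[of 1] by (simp add: c_def)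
  have tot: "emeasure (D M) UNIV = (\<integral>\<^sup>+x. ennreal (exp (- x)) \<partial>M)" if "sets M = sets borel" for M
  proof -
    note [measurable_cong] = that
    show ?thesis using sets_eq_imp_space_eq[OF that] unfolding D_def
      by (subst emeasure_density) (auto simp: that)
  qed
  have inv: "density (D M) (\<lambda>x. ennreal (exp x)) = M" if M: "sets M = sets borel" for M
  proof -
    note [measurable_cong] = M
    have "density (D M) (\<lambda>x. ennreal (exp x)) = density M (\<lambda>x. ennreal (exp (- x)) * ennreal (exp x))"
      unfolding D_def using M by (intro density_density_eq) auto
    also have "\<dots> = density M (\<lambda>x. 1)" by (simp add: ennreal_mult[symmetric] exp_minus)
    finally show ?thesis by (simp add: density_1)
  qed
  have "D M1 = D M2"
  \<comment> \<open>The tilted measures are to be normalised by their common mass \<open>c\<close>;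
    if it is 0 both vanish.\<close>
  proof (cases "c = 0")
    case True
    have "emeasure (D M) A = 0" if "emeasure (D M) UNIV = 0" "sets M = sets borel" for M A
    proof (rule emeasure_eq_0[of UNIV])
      show "UNIV \<in> sets (D M)" using that by (simp add: D_def)
    qed (use that in simp_all)
    then have "emeasure (D M1) A = 0" "emeasure (D M2) A = 0" for A
      using True tot[OF sets(1)] tot[OF sets(2)] c2 sets by (auto simp: c_def)
    then show ?thesis by (intro measure_eqI) (simp_all add: D_def sets)
  next
    case False
    have cfin: "c \<noteq> \<infinity>" using fin by (simp add: c_def less_top)
    have cc: "c * (1 / c) = 1" "1 / c * c = 1"
      using False cfin ennreal_divide_self[of c] ennreal_times_divide[of c 1 c]
      by (simp_all add: less_top mult.commute)
    \<comment> \<open>The law of \<open>exp (- x)\<close> under the normalised tilted measure.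
      Because of the tilt its k-th moment is the transform at \<open>k + 1\<close>, a positive
      argument even for \<open>k = 0\<close>. The map is undone by \<open>- ln y\<close>.\<close>
    define N where "N M = scale_measure (1 / c) (distr (D M) borel (\<lambda>x. exp (- x)))" for M
    have prob: "real_distribution (N M)" "AE x in N M. x \<in> {0..1}"
      and moments: "\<And>k. (LINT y|N M. y ^ k) = enn2real (1 / c * (\<integral>\<^sup>+x. ennreal (exp (- real (Suc k) * x)) \<partial>M))"
      and recover: "D M = scale_measure c (distr (N M) borel (\<lambda>y. - ln y))"
      if M: "sets M = sets borel" "emeasure M {..<0} = 0" "(\<integral>\<^sup>+x. ennreal (exp (- x)) \<partial>M) = c" for M
    proof -
      have sD: "sets (D M) = sets borel" by (simp add: D_def M)
      note [measurable_cong] = sD M(1)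
      have sp: "space (D M) = UNIV" using sets_eq_imp_space_eq[OF sD] by simp
      have sN[measurable_cong]: "sets (N M) = sets borel" by (simp add: N_def)
      have "emeasure (N M) (space (N M)) = 1 / c * c"
        using tot[OF M(1)] M(3) by (simp add: N_def space_scale_measure emeasure_distr sp)
      then have "prob_space (N M)" 
        by (intro prob_spaceI) (simp only: cc)
      then show rd: "real_distribution (N M)"
        unfolding real_distribution_def real_distribution_axioms_def using sN by simp
      have "AE x in M. x \<notin> {..<0}" using M by (intro AE_not_in) (auto simp: null_sets_def)
      then have "AE x in D M. exp (- x) \<in> {0..1}"
        unfolding D_def by (subst AE_density) (auto simp: not_less elim!: eventually_mono)
      then have "AE y in distr (D M) borel (\<lambda>x. exp (- x)). y \<in> {0..1}"
        by (subst AE_distr_iff) auto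
      then show ae: "AE y in N M. y \<in> {0..1}"
        unfolding eventually_ae_filter N_def
        by (auto simp: null_sets_def space_scale_measure)
      show "(LINT y|N M. y ^ k) = enn2real (1 / c * (\<integral>\<^sup>+x. ennreal (exp (- real (Suc k) * x)) \<partial>M))" for k
      proof -
        have "(LINT y|N M. y ^ k) = enn2real (\<integral>\<^sup>+y. ennreal (y ^ k) \<partial>N M)"
          using ae by (intro integral_eq_nn_integral) (auto elim!: eventually_mono)
        also have "(\<integral>\<^sup>+y. ennreal (y ^ k) \<partial>N M) = 1 / c * (\<integral>\<^sup>+x. ennreal (exp (- x) ^ k) \<partial>D M)"
          by (simp add: N_def nn_integral_scale_measure nn_integral_distr)
        also have "(\<integral>\<^sup>+x. ennreal (exp (- x) ^ k) \<partial>D M) = (\<integral>\<^sup>+x. ennreal (exp (- x)) * ennreal (exp (- x) ^ k) \<partial>M)"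
          unfolding D_def by (subst nn_integral_density) auto
        also have "\<dots> = (\<integral>\<^sup>+x. ennreal (exp (- real (Suc k) * x)) \<partial>M)"
          by (intro nn_integral_cong)
             (simp add: ennreal_mult[symmetric] exp_of_nat_mult[symmetric] exp_add[symmetric] algebra_simps)
        finally show ?thesis .
      qed
      have "scale_measure c (distr (N M) borel (\<lambda>y. - ln y)) = distr (distr (D M) borel (\<lambda>x. exp (- x))) borel (\<lambda>y. - ln y)"
      proof (rule measure_eqI)
        fix A assume "A \<in> sets (scale_measure c (distr (N M) borel (\<lambda>y. - ln y)))"
        then have [measurable]: "A \<in> sets borel" by simp
        have "c * (1 / c * z) = z" for z :: ennreal
          by (simp only: mult.assoc[symmetric] cc mult_1)
        then show "emeasure (scale_measure c (distr (N M) borel (\<lambda>y. - ln y))) A =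
            emeasure (distr (distr (D M) borel (\<lambda>x. exp (- x))) borel (\<lambda>y. - ln y)) A"
          by (simp add: N_def emeasure_distr space_scale_measure)
      qed simp
      also have "\<dots> = distr (D M) borel (\<lambda>x. x)"
        by (subst distr_distr) (auto simp: comp_def)
      also have "\<dots> = D M" using distr_id2[OF sD[symmetric]] by (simp add: id_def)
      finally show "D M = scale_measure c (distr (N M) borel (\<lambda>y. - ln y))" by simp
    qed
    note 1 = sets(1) nonneg(1) c_def[symmetric] and 2 = sets(2) nonneg(2) c2
    have "N M1 = N M2"
      using moments[OF 1] moments[OF 2] eq
      by (intro unit_interval_moments_unique prob[OF 1] prob[OF 2]) (simp del: of_nat_Suc)
    then show ?thesis using recover[OF 1] recover[OF 2] by simp
  qed
  then show ?thesis using inv[OF sets(1)] inv[OF sets(2)] by metis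
qed

section \<open>Absolutely continuous differences of finite measures\<close>

text \<open>A point outside \<open>C\<close> has positive distance from the compact set
  \<open>C\<close>, so it leaves the union of the cells that meet \<open>C\<close> once the mesh is
  smaller than that distance. Dominated convergence does the rest. Finite unions of intervals are
  the sets about which absolute continuity makes a statement.\<close>

lemma grid_cover_measure_tendsto:
  fixes \<rho> :: "real measure" and T :: real
  assumes "finite_measure \<rho>" and [measurable_cong]: "sets \<rho> = sets borel"
    and C: "compact C" "C \<subseteq> {0<..T}" and T: "T > 0"
  defines "cell \<equiv> \<lambda>n i. {real i * (T / Suc n)<..real (Suc i) * (T / Suc n)}"
  shows "(\<lambda>n. measure \<rho> (\<Union>i\<in>{i. i < Suc n \<and> cell n i \<inter> C \<noteq> {}}. cell n i)) \<longlonglongrightarrow> measure \<rho> C"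
proof -
  interpret finite_measure \<rho> by fact
  define G where "G n = (\<Union>i\<in>{i. i < Suc n \<and> cell n i \<inter> C \<noteq> {}}. cell n i)" for n
  have [measurable]: "G n \<in> sets borel" for n by (auto simp: G_def cell_def intro!: sets.finite_UN)
  have [measurable]: "C \<in> sets borel" using C by (simp add: borel_compact)
  have CG: "C \<subseteq> G n" for n
  proof
    fix x assume x: "x \<in> C"
    define h where "h = T / Suc n"
    have h: "h > 0" using T by (simp add: h_def)
    \<comment> \<open>The cells are open on the left and closed on the right, hence a ceiling minus
      one instead of a floor.\<close>
    define j where "j = nat (\<lceil>x / h\<rceil> - 1)"
    have x0: "0 < x" "x \<le> T" using x C by auto
    then have "\<lceil>x / h\<rceil> \<ge> 1" using h by (simp add: one_le_ceiling)
    then have j: "real j = of_int \<lceil>x / h\<rceil> - 1" by (simp add: j_def)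
    have "real j < x / h" "x / h \<le> real j + 1" using j by linarith+
    then have "x \<in> cell n j" using h unfolding cell_def h_def[symmetric] by (simp add: field_simps)
    moreover have "x / h \<le> Suc n" using x0 T h by (simp add: pos_divide_le_eq) (simp add: h_def)
    then have "\<lceil>x / h\<rceil> \<le> int (Suc n)" by (simp add: ceiling_le_iff)
    then have "j < Suc n" using \<open>\<lceil>x / h\<rceil> \<ge> 1\<close> by (simp add: j_def)
    ultimately show "x \<in> G n" using x by (auto simp: G_def)
  qed
  have "(\<lambda>n. LINT x|\<rho>. indicator (G n) x :: real) \<longlonglongrightarrow> (LINT x|\<rho>. indicator C x)"
  proof (rule integral_dominated_convergence[where w="\<lambda>_. 1"])
    show "AE x in \<rho>. (\<lambda>n. indicator (G n) x :: real) \<longlonglongrightarrow> indicator C x"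
    proof (rule AE_I2)
      fix x
      show "(\<lambda>n. indicator (G n) x :: real) \<longlonglongrightarrow> indicator C x"
      proof (cases "x \<in> C")
        case True
        then have "x \<in> G n" for n using CG by auto
        then show ?thesis using True by simp
      next
        case False
        have "open (- C)" using C by (simp add: compact_imp_closed open_Compl)
        then obtain d where d: "d > 0" "ball x d \<subseteq> - C" using False by (metis ComplI openE)
        obtain N :: nat where N: "T / d < N" using reals_Archimedean2 by blast
        have "x \<notin> G n" if "n \<ge> N" for n
        proof
          assume "x \<in> G n"
          then obtain i y where iy: "x \<in> cell n i" "y \<in> cell n i" "y \<in> C" by (auto simp: G_def)
          define h where "h = T / Suc n"
          have "T / d < Suc n" using N that by linarith
          then have "h < d" using d T by (simp add: h_def field_simps)
          moreover have "real i * h < x" "real i * h < y" "x \<le> real i * h + h" "y \<le> real i * h + h"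
            using iy(1,2) unfolding cell_def h_def[symmetric] by (auto simp: distrib_right)
          then have "\<bar>x - y\<bar> < h" by linarith
          ultimately show False using d iy by (auto simp: dist_real_def subset_iff)
        qed
        then have "eventually (\<lambda>n. indicator (G n) x = (indicator C x :: real)) sequentially"
          using False by (auto simp: eventually_sequentially intro!: exI[of _ N])
        then show ?thesis by (rule tendsto_eventually)
      qed
    qed
  qed auto
  then show ?thesis unfolding G_def[symmetric] by simp
qed

text \<open>The cells that meet \<open>C\<close> have total length tending to 0, and the increment
  of \<open>u\<close> over a cell is the difference of the two masses of that cell. Absolute
  continuity makes the sum of these increments small. Each measure alone may charge
  \<open>C\<close>; only the difference disappears.\<close>

lemma abs_continuous_null_compact:
  fixes \<rho>1 \<rho>2 :: "real measure" and T :: real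
  assumes fin: "finite_measure \<rho>1" "finite_measure \<rho>2"
    and sets[measurable_cong]: "sets \<rho>1 = sets borel" "sets \<rho>2 = sets borel"
    and T: "T > 0" and ac: "abs_continuous_on_halfline u"
    and u: "\<And>x. 0 \<le> x \<Longrightarrow> x \<le> T \<Longrightarrow> u x - u 0 = measure \<rho>1 {..x} - measure \<rho>2 {..x}"
    and C: "compact C" "C \<subseteq> {0<..T}" "emeasure lborel C = 0"
  shows "measure \<rho>1 C = measure \<rho>2 C"
proof -
  interpret r1: finite_measure \<rho>1 by fact
  interpret r2: finite_measure \<rho>2 by fact
  define cell where "cell n i = {real i * (T / Suc n)<..real (Suc i) * (T / Suc n)}" for n i
  define J where "J n = {i. i < Suc n \<and> cell n i \<inter> C \<noteq> {}}" for n
  define G where "G n = (\<Union>i\<in>J n. cell n i)" for n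
  have JT: "finite (J n)" "J n \<subseteq> {..<Suc n}" for n by (auto simp: J_def)
  have disj: "disjoint_family_on (cell n) A" for n A
  proof -
    have "cell n i \<inter> cell n j = {}" if "i < j" for i j
    proof -
      have "real (Suc i) * (T / Suc n) \<le> real j * (T / Suc n)"
        using that T by (intro mult_right_mono) auto
      then show ?thesis by (auto simp: cell_def simp del: of_nat_Suc)
    qed
    then show ?thesis unfolding disjoint_family_on_def by (metis inf_commute nat_neq_iff)
  qed
  \<comment> \<open>Lebesgue measure cut down to a finite measure, so that the covering limit used
    for the two measures also shows that the total length of the cells tends to 0.\<close>
  define L where "L = density lborel (\<lambda>x. ennreal (indicator {0<..T} x))"
  have fL: "finite_measure L"
    by (rule finite_measureI) (use T in \<open>auto simp: L_def emeasure_density ennreal_indicator\<close>)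
  interpret L: finite_measure L by fact
  have sL: "sets L = sets borel" by (simp add: L_def)
  have lim: "(\<lambda>n. measure \<rho> (G n)) \<longlonglongrightarrow> measure \<rho> C"
    if "finite_measure \<rho>" "sets \<rho> = sets borel" for \<rho>
    using grid_cover_measure_tendsto[OF that C(1,2) T] unfolding G_def J_def cell_def .
  have LC: "measure L C = 0"
  proof -
    have [measurable]: "C \<in> sets borel" using C(1) by (rule borel_compact)
    have "emeasure L C = (\<integral>\<^sup>+x. indicator {0<..T} x * indicator C x \<partial>lborel)"
      by (simp add: L_def emeasure_density ennreal_indicator)
    also have "\<dots> \<le> (\<integral>\<^sup>+x. indicator C x \<partial>lborel)"
      by (intro nn_integral_mono) (auto split: split_indicator)
    also have "\<dots> = 0" using C(3) by simp
    finally have "emeasure L C = 0" by simp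
    then show ?thesis by (simp add: measure_def)
  qed
  have mG: "measure \<rho> (G n) = (\<Sum>i\<in>J n. measure \<rho> (cell n i))"
    if "finite_measure \<rho>" "sets \<rho> = sets borel" for \<rho> n
  proof -
    interpret finite_measure \<rho> by fact
    show ?thesis unfolding G_def using JT disj that(2)
      by (intro finite_measure_finite_Union) (simp_all add: image_subset_iff, simp add: cell_def)
  qed
  have cell_le: "real (Suc i) * (T / Suc n) \<le> T" if "i < Suc n" for i n
  proof -
    have "real (Suc i) * (T / Suc n) \<le> real (Suc n) * (T / Suc n)"
      using that T by (intro mult_right_mono) auto
    then show ?thesis by simp
  qed
  have cell_u: "measure \<rho>1 (cell n i) - measure \<rho>2 (cell n i) = u (real (Suc i) * (T / Suc n)) - u (real i * (T / Suc n))"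
    if "i < Suc n" for n i
  proof -
    define a b where "a = real i * (T / Suc n)" and "b = real (Suc i) * (T / Suc n)"
    have ab: "0 \<le> a" "a \<le> b" "b \<le> T" using T cell_le[OF that] unfolding a_def b_def
      by (auto intro!: divide_right_mono mult_right_mono)
    have "cell n i = {..b} - {..a}" by (auto simp: cell_def a_def b_def)
    moreover have "measure \<rho>1 ({..b} - {..a}) = measure \<rho>1 {..b} - measure \<rho>1 {..a}"
      using ab by (intro r1.finite_measure_Diff) auto
    moreover have "measure \<rho>2 ({..b} - {..a}) = measure \<rho>2 {..b} - measure \<rho>2 {..a}"
      using ab by (intro r2.finite_measure_Diff) auto
    moreover have "u a - u 0 = measure \<rho>1 {..a} - measure \<rho>2 {..a}" "u b - u 0 = measure \<rho>1 {..b} - measure \<rho>2 {..b}"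
      using ab by (auto intro!: u)
    ultimately show ?thesis unfolding a_def[symmetric] b_def[symmetric] by simp
  qed
  have "(\<lambda>n. measure \<rho>1 (G n) - measure \<rho>2 (G n)) \<longlonglongrightarrow> 0"
  proof (rule LIMSEQ_I)
    fix e :: real assume e: "e > 0"
    have "\<exists>\<delta>>0. \<forall>(m :: nat) l r. (\<forall>i<m. 0 \<le> l i \<and> l i \<le> r i \<and> r i \<le> T) \<and>
        disjoint_family_on (\<lambda>i. {l i<..<r i}) {..<m} \<and> (\<Sum>i<m. r i - l i) < \<delta> \<longrightarrow>
        (\<Sum>i<m. \<bar>u (r i) - u (l i)\<bar>) < e"
      using ac T e unfolding abs_continuous_on_halfline_def by blast
    then obtain d where d: "d > 0" and ac': "\<forall>(m :: nat) l r. (\<forall>i<m. 0 \<le> l i \<and> l i \<le> r i \<and> r i \<le> T) \<and>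
        disjoint_family_on (\<lambda>i. {l i<..<r i}) {..<m} \<and> (\<Sum>i<m. r i - l i) < d \<longrightarrow>
        (\<Sum>i<m. \<bar>u (r i) - u (l i)\<bar>) < e"
      by (elim exE conjE)
    obtain n0 where n0: "\<And>n. n \<ge> n0 \<Longrightarrow> \<bar>measure L (G n)\<bar> < d"
      using LIMSEQ_D[OF lim[OF fL sL] d] LC by auto
    have "\<bar>measure \<rho>1 (G n) - measure \<rho>2 (G n)\<bar> < e" if n: "n \<ge> n0" for n
    proof -
      \<comment> \<open>Cells that miss \<open>C\<close> become degenerate intervals at 0. The
        family is then indexed by an initial segment of the naturals, as the definition of absolute
        continuity requires.\<close>
      define l where "l i = (if i \<in> J n then real i * (T / Suc n) else 0)" for i
      define r where "r i = (if i \<in> J n then real (Suc i) * (T / Suc n) else 0)" for i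
      have inJ: "(\<Sum>i\<in>J n. f i) = (\<Sum>i<Suc n. f i)" if "\<And>i. i \<notin> J n \<Longrightarrow> f i = 0" for f :: "nat \<Rightarrow> real"
        using JT that by (intro sum.mono_neutral_left) auto
      have "measure L (cell n i) = r i - l i" if "i \<in> J n" for i
      proof -
        have "cell n i \<inter> {0<..T} = cell n i"
          using T cell_le[of i n] that JT(2)[of n] by (auto simp: cell_def intro: le_less_trans[rotated] order_trans)
        moreover have "emeasure L (cell n i) = emeasure lborel (cell n i \<inter> {0<..T})"
          unfolding L_def by (subst emeasure_density)
            (auto simp: cell_def ennreal_indicator indicator_inter_arith[symmetric] Int_commute)
        moreover have "real i * (T / Suc n) \<le> real (Suc i) * (T / Suc n)"
          using T by (intro mult_right_mono) auto
        ultimately show ?thesis using that by (simp add: cell_def l_def r_def measure_def del: of_nat_Suc)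
      qed
      then have "(\<Sum>i<Suc n. r i - l i) = measure L (G n)"
        unfolding mG[OF fL sL] by (subst inJ[symmetric]) (auto simp: l_def r_def)
      then have small: "(\<Sum>i<Suc n. r i - l i) < d" using n0[OF n] by simp
      have "\<bar>measure \<rho>1 (G n) - measure \<rho>2 (G n)\<bar> = \<bar>\<Sum>i\<in>J n. u (r i) - u (l i)\<bar>"
        unfolding mG[OF fin(1) sets(1)] mG[OF fin(2) sets(2)] sum_subtractf[symmetric]
        using JT(2)[of n] by (intro arg_cong[where f=abs] sum.cong) (auto simp: cell_u l_def r_def simp del: of_nat_Suc)
      also have "\<dots> \<le> (\<Sum>i\<in>J n. \<bar>u (r i) - u (l i)\<bar>)" by (rule sum_abs)
      also have "\<dots> = (\<Sum>i<Suc n. \<bar>u (r i) - u (l i)\<bar>)" by (rule inJ) (simp add: l_def r_def)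
      also have "\<dots> < e"
      proof (rule ac'[THEN spec, THEN spec, THEN spec, THEN mp], intro conjI small)
        show "\<forall>i<Suc n. 0 \<le> l i \<and> l i \<le> r i \<and> r i \<le> T"
          using T cell_le by (auto simp: l_def r_def intro!: divide_right_mono mult_right_mono)
        have "{l i<..<r i} \<subseteq> cell n i" for i by (auto simp: l_def r_def cell_def)
        then show "disjoint_family_on (\<lambda>i. {l i<..<r i}) {..<Suc n}"
          using disj[of n "{..<Suc n}"] unfolding disjoint_family_on_def by blast
      qed
      finally show ?thesis .
    qed
    then show "\<exists>n0. \<forall>n\<ge>n0. norm (measure \<rho>1 (G n) - measure \<rho>2 (G n) - 0) < e" by auto
  qed
  moreover have "(\<lambda>n. measure \<rho>1 (G n) - measure \<rho>2 (G n)) \<longlonglongrightarrow> measure \<rho>1 C - measure \<rho>2 C"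
    by (intro tendsto_diff lim fin sets)
  ultimately show ?thesis using LIMSEQ_unique by force
qed

lemma finite_measure_inner_approx:
  fixes \<rho> :: "real measure"
  assumes "finite_measure \<rho>" and sets: "sets \<rho> = sets borel" and B: "B \<in> sets borel" and e: "e > 0"
  obtains K where "compact K" "K \<subseteq> B" "measure \<rho> (B - K) < e"
proof -
  interpret finite_measure \<rho> by fact
  have "\<exists>K\<in>{K. K \<subseteq> B \<and> compact K}. ennreal (measure \<rho> B - e) < emeasure \<rho> K" if "measure \<rho> B \<ge> e"
  proof -
    have "ennreal (measure \<rho> B - e) < emeasure \<rho> B"
      using e that by (auto simp: emeasure_eq_measure ennreal_less_iff)
    also have "emeasure \<rho> B = (SUP K\<in>{K. K \<subseteq> B \<and> compact K}. emeasure \<rho> K)"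
      using inner_regular[OF sets _ B] emeasure_finite by simp
    finally show ?thesis by (simp add: less_SUP_iff)
  qed
  then obtain K where K: "K \<subseteq> B" "compact K" "measure \<rho> B - e < measure \<rho> K"
  proof (cases "measure \<rho> B \<ge> e")
    case True
    with \<open>e \<le> measure \<rho> B \<Longrightarrow> _\<close> show ?thesis
      by (auto simp: emeasure_eq_measure ennreal_less_iff intro: that)
  qed (auto intro: that[of "{}"])
  then have "measure \<rho> (B - K) < e"
    using finite_measure_Diff[of B K] B borel_compact[of K] sets by auto
  then show ?thesis using that K by blast
qed

text \<open>Inner regularity supplies a compact set for each measure; their union leaves out less
  than half of the supposed discrepancy for both measures at once, and the two agree on that union.
  The two remainders cannot differ by the full discrepancy.\<close>

lemma abs_continuous_null_borel:
  fixes \<rho>1 \<rho>2 :: "real measure" and T :: real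
  assumes fin: "finite_measure \<rho>1" "finite_measure \<rho>2"
    and sets: "sets \<rho>1 = sets borel" "sets \<rho>2 = sets borel"
    and T: "T > 0" and ac: "abs_continuous_on_halfline u"
    and u: "\<And>x. 0 \<le> x \<Longrightarrow> x \<le> T \<Longrightarrow> u x - u 0 = measure \<rho>1 {..x} - measure \<rho>2 {..x}"
    and B: "B \<in> sets borel" "B \<subseteq> {0<..T}" "emeasure lborel B = 0"
  shows "measure \<rho>1 B = measure \<rho>2 B"
proof (rule ccontr)
  interpret r1: finite_measure \<rho>1 by fact
  interpret r2: finite_measure \<rho>2 by fact
  assume "measure \<rho>1 B \<noteq> measure \<rho>2 B"
  then have e: "\<bar>measure \<rho>1 B - measure \<rho>2 B\<bar> / 2 > 0" (is "?e > 0") by simp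
  obtain K1 where K1: "compact K1" "K1 \<subseteq> B" "measure \<rho>1 (B - K1) < ?e"
    using finite_measure_inner_approx[OF fin(1) sets(1) B(1) e] .
  obtain K2 where K2: "compact K2" "K2 \<subseteq> B" "measure \<rho>2 (B - K2) < ?e"
    using finite_measure_inner_approx[OF fin(2) sets(2) B(1) e] .
  define K where "K = K1 \<union> K2"
  have K: "compact K" "K \<subseteq> B" using K1 K2 by (auto simp: K_def)
  have Kb: "K \<in> sets borel" "K1 \<in> sets borel" "K2 \<in> sets borel"
    using K K1 K2 borel_compact by auto
  have "emeasure lborel K \<le> emeasure lborel B" using K B by (intro emeasure_mono) auto
  then have "measure \<rho>1 K = measure \<rho>2 K"
    using B K by (intro abs_continuous_null_compact[OF fin sets T ac u]) auto
  moreover have "measure \<rho>1 (B - K) \<le> measure \<rho>1 (B - K1)" "measure \<rho>2 (B - K) \<le> measure \<rho>2 (B - K2)"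
    using B Kb sets by (auto intro!: r1.finite_measure_mono r2.finite_measure_mono simp: K_def)
  moreover have "measure \<rho>1 (B - K) = measure \<rho>1 B - measure \<rho>1 K" "measure \<rho>2 (B - K) = measure \<rho>2 B - measure \<rho>2 K"
    using B K Kb sets by (auto intro!: r1.finite_measure_Diff r2.finite_measure_Diff)
  moreover have "0 \<le> measure \<rho>1 (B - K)" "0 \<le> measure \<rho>2 (B - K)" by auto
  ultimately have "\<bar>measure \<rho>1 B - measure \<rho>2 B\<bar> = \<bar>measure \<rho>1 (B - K) - measure \<rho>2 (B - K)\<bar>"
    "0 \<le> measure \<rho>1 (B - K)" "0 \<le> measure \<rho>2 (B - K)" "measure \<rho>1 (B - K) < ?e" "measure \<rho>2 (B - K) < ?e"
    using K1(3) K2(3) by linarith+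
  moreover have False if "D = \<bar>x - y\<bar>" "0 \<le> x" "0 \<le> y" "x < D / 2" "y < D / 2" for D x y :: real
    using that by (auto simp: abs_if split: if_splits)
  ultimately show False by blast
qed

text \<open>Serves as a common dominating measure for densities, and later as the left-hand side of
  the renewal identity seen as a single measure.\<close>

lemma sum_measure_exists:
  assumes sets: "sets \<rho>1 = sets M" "sets \<rho>2 = sets M"
  shows "\<exists>m. sets m = sets M \<and> (\<forall>A\<in>sets M. emeasure m A = emeasure \<rho>1 A + emeasure \<rho>2 A)"
proof -
  define \<mu> where "\<mu> A = emeasure \<rho>1 A + emeasure \<rho>2 A" for A
  define m where "m = measure_of (space M) (sets M) \<mu>"
  have "countably_additive (sets M) \<mu>"
  proof (rule countably_additiveI)
    fix A :: "nat \<Rightarrow> _" assume A: "range A \<subseteq> sets M" "disjoint_family A"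
    have "(\<Sum>i. emeasure \<rho> (A i)) = emeasure \<rho> (\<Union>i. A i)" if "sets \<rho> = sets M" for \<rho>
      using A that by (intro suminf_emeasure) auto
    then show "(\<Sum>i. \<mu> (A i)) = \<mu> (\<Union>i. A i)"
      unfolding \<mu>_def by (subst suminf_add[symmetric], simp, simp)+ (simp add: sets)
  qed
  moreover have "positive (sets M) \<mu>" by (simp add: positive_def \<mu>_def)
  ultimately have "emeasure m A = \<mu> A" if "A \<in> sets M" for A
    using that unfolding m_def by (intro emeasure_measure_of_sigma) (auto simp: sets.sigma_algebra_axioms)
  then show ?thesis by (intro exI[of _ m]) (auto simp: m_def \<mu>_def)
qed

text \<open>Take densities with respect to the sum of \<open>\<rho>1\<close>, \<open>\<rho>2\<close> and Lebesgue measure: where the density of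
  Lebesgue measure vanishes, \<open>\<rho>1\<close> and \<open>\<rho>2\<close> agree and cancel.\<close>
theorem abs_continuous_signed_density:
  fixes \<rho>1 \<rho>2 :: "real measure" and T :: real
  assumes fin: "finite_measure \<rho>1" "finite_measure \<rho>2"
    and sets: "sets \<rho>1 = sets borel" "sets \<rho>2 = sets borel"
    and conc: "emeasure \<rho>1 (- {0<..T}) = 0" "emeasure \<rho>2 (- {0<..T}) = 0"
    and T: "T > 0" and ac: "abs_continuous_on_halfline u"
    and u: "\<And>x. 0 \<le> x \<Longrightarrow> x \<le> T \<Longrightarrow> u x - u 0 = measure \<rho>1 {..x} - measure \<rho>2 {..x}"
  shows "\<exists>w. integrable lborel w \<and> (\<forall>x. x \<notin> {0<..T} \<longrightarrow> w x = 0) \<and>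
    (\<forall>k :: real \<Rightarrow> real. integrable \<rho>1 k \<longrightarrow> integrable \<rho>2 k \<longrightarrow>
       integrable lborel (\<lambda>x. w x * k x) \<and> (LINT x|\<rho>1. k x) - (LINT x|\<rho>2. k x) = (LINT x|lborel. w x * k x))"
proof -
  define L where "L = density lborel (\<lambda>x. ennreal (indicator {0<..T} x))"
  have fL: "finite_measure L"
    by (rule finite_measureI) (use T in \<open>auto simp: L_def emeasure_density ennreal_indicator\<close>)
  have sL: "sets L = sets borel" by (simp add: L_def)
  obtain m' where m': "sets m' = sets (borel :: real measure)"
    "\<And>A. A \<in> sets borel \<Longrightarrow> emeasure m' A = emeasure \<rho>1 A + emeasure \<rho>2 A"
    using sum_measure_exists[OF sets] by blast
  obtain m where m0: "sets m = sets (borel :: real measure)"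
    "\<And>A. A \<in> sets borel \<Longrightarrow> emeasure m A = emeasure m' A + emeasure L A"
    using sum_measure_exists[OF m'(1) sL] by blast
  have m: "finite_measure m" "sets m = sets (borel :: real measure)"
    "\<And>A. A \<in> sets borel \<Longrightarrow> emeasure m A = emeasure \<rho>1 A + emeasure \<rho>2 A + emeasure L A"
    using m0 m' sets_eq_imp_space_eq[OF m0(1)] finite_measure.emeasure_finite[OF fin(1)]
      finite_measure.emeasure_finite[OF fin(2)] finite_measure.emeasure_finite[OF fL]
    by (auto intro!: finite_measureI)
  interpret m: finite_measure m by fact
  note [measurable_cong] = sets sL m(2)
  have dens: "\<exists>d. d \<in> borel_measurable borel \<and> (\<forall>x. 0 \<le> d x) \<and> density m (\<lambda>x. ennreal (d x)) = \<rho>"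
    if \<rho>: "finite_measure \<rho>" "sets \<rho> = sets borel" "\<And>A. A \<in> sets borel \<Longrightarrow> emeasure \<rho> A \<le> emeasure m A" for \<rho>
  proof -
    have "emeasure \<rho> A = 0" if "A \<in> sets borel" "emeasure m A = 0" for A
      using \<rho>(3)[OF that(1)] that(2) by simp
    then have acm: "absolutely_continuous m \<rho>"
      unfolding absolutely_continuous_def null_sets_def using \<rho>(2) m(2) by auto
    obtain d where d: "d \<in> borel_measurable m" "AE x in m. RN_deriv m \<rho> x = ennreal (d x)" "\<And>x. 0 \<le> d x"
      using m.real_RN_deriv[OF \<rho>(1) acm] \<rho>(2) m(2) by metis
    have "density m (\<lambda>x. ennreal (d x)) = density m (RN_deriv m \<rho>)"
      using d(1,2) by (intro density_cong) (auto elim!: eventually_mono)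
    also have "\<dots> = \<rho>" using acm \<rho>(2) m(2) by (intro m.density_RN_deriv) auto
    finally show ?thesis using d by (intro exI[of _ d]) auto
  qed
  obtain d1 where d1[measurable]: "d1 \<in> borel_measurable borel" and d1': "\<And>x. 0 \<le> d1 x" "density m (\<lambda>x. ennreal (d1 x)) = \<rho>1"
    using dens[OF fin(1) sets(1)] m(3) by (metis add.assoc le_iff_add)
  obtain d2 where d2[measurable]: "d2 \<in> borel_measurable borel" and d2': "\<And>x. 0 \<le> d2 x" "density m (\<lambda>x. ennreal (d2 x)) = \<rho>2"
    using dens[OF fin(2) sets(2)] m(3) by (metis add.assoc add.commute le_iff_add)
  obtain l where l[measurable]: "l \<in> borel_measurable borel" and l': "\<And>x. 0 \<le> l x" "density m (\<lambda>x. ennreal (l x)) = L"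
    using dens[OF fL sL] m(3) by (metis add.commute le_iff_add)
  define N where "N = {x. l x = 0}"
  have [measurable]: "N \<in> sets borel" by (simp add: N_def)
  have LN: "emeasure L N = 0"
  proof -
    have "emeasure L N = (\<integral>\<^sup>+x. ennreal (l x) * indicator N x \<partial>m)"
      unfolding l'(2)[symmetric] by (subst emeasure_density) auto
    also have "\<dots> = (\<integral>\<^sup>+x. 0 \<partial>m)" by (intro nn_integral_cong) (auto simp: N_def split: split_indicator)
    finally show ?thesis by simp
  qed
  \<comment> \<open>Both measures live on \<open>{0<..T}\<close>. There \<open>N\<close> is Lebesgue
    null, because the density \<open>l\<close> of Lebesgue measure vanishes on it, so absolute
    continuity of \<open>u\<close> applies to every Borel part.\<close>
  have same: "density \<rho>1 (indicator N) = density \<rho>2 (indicator N)"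
  proof (rule measure_eqI)
    fix A assume "A \<in> sets (density \<rho>1 (indicator N))"
    then have [measurable]: "A \<in> sets borel" by (simp add: sets)
    define B where "B = N \<inter> A \<inter> {0<..T}"
    have [measurable]: "B \<in> sets borel" by (simp add: B_def)
    have "emeasure lborel B = emeasure L B"
      unfolding L_def by (subst emeasure_density) (auto simp: B_def ennreal_indicator simp flip: nn_integral_indicator intro!: nn_integral_cong split: split_indicator)
    also have "\<dots> \<le> emeasure L N" by (intro emeasure_mono) (auto simp: B_def)
    finally have "emeasure lborel B = 0" using LN by simp
    then have eqB: "measure \<rho>1 B = measure \<rho>2 B"
      by (intro abs_continuous_null_borel[OF fin sets T ac u]) (auto simp: B_def)
    have "emeasure \<rho> (N \<inter> A) = emeasure \<rho> B" if "emeasure \<rho> (- {0<..T}) = 0" "sets \<rho> = sets borel" for \<rho>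
    proof (rule emeasure_eq_AE)
      show "AE x in \<rho>. (x \<in> N \<inter> A) = (x \<in> B)"
        using that by (intro AE_I'[of "- {0<..T}"]) (auto simp: null_sets_def B_def)
    qed (auto simp: that)
    from this[OF conc(1) sets(1)] this[OF conc(2) sets(2)]
    show "emeasure (density \<rho>1 (indicator N)) A = emeasure (density \<rho>2 (indicator N)) A"
      using eqB finite_measure.emeasure_eq_measure[OF fin(1)] finite_measure.emeasure_eq_measure[OF fin(2)]
      by (simp add: emeasure_density indicator_inter_arith[symmetric])
  qed (simp add: sets)
  \<comment> \<open>The chain rule for densities. On \<open>N\<close> the quotient is a division by
    zero with value 0, which is right since the contributions of the two measures cancel
    there.\<close>
  define w where "w x = indicator {0<..T} x * ((d1 x - d2 x) / l x)" for x
  have [measurable]: "w \<in> borel_measurable borel" unfolding w_def by measurable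
  have main: "integrable lborel (\<lambda>x. w x * k x) \<and> (LINT x|\<rho>1. k x) - (LINT x|\<rho>2. k x) = (LINT x|lborel. w x * k x)"
    if k: "integrable \<rho>1 k" "integrable \<rho>2 k" for k :: "real \<Rightarrow> real"
  proof -
    have [measurable]: "k \<in> borel_measurable borel" using borel_measurable_integrable[OF k(1)] by simp
    have int_m: "integrable m (\<lambda>x. d1 x * k x)" "integrable m (\<lambda>x. d2 x * k x)"
      and eq_m: "(LINT x|\<rho>1. k x) = (LINT x|m. d1 x * k x)" "(LINT x|\<rho>2. k x) = (LINT x|m. d2 x * k x)"
    proof -
      have "integrable (density m (\<lambda>x. ennreal (d1 x))) k" "integrable (density m (\<lambda>x. ennreal (d2 x))) k"
        using k by (simp_all only: d1'(2) d2'(2))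
      then show "integrable m (\<lambda>x. d1 x * k x)" "integrable m (\<lambda>x. d2 x * k x)"
        using d1'(1) d2'(1) by (simp_all add: integrable_density)
      show "(LINT x|\<rho>1. k x) = (LINT x|m. d1 x * k x)" "(LINT x|\<rho>2. k x) = (LINT x|m. d2 x * k x)"
        using d1'(1) d2'(1) unfolding d1'(2)[symmetric] d2'(2)[symmetric] by (simp_all add: integral_density)
    qed
    have "(LINT x|density \<rho>1 (\<lambda>x. ennreal (indicator N x)). k x) = (LINT x|density \<rho>2 (\<lambda>x. ennreal (indicator N x)). k x)"
      using same by (simp add: ennreal_indicator)
    then have "(LINT x|\<rho>1. indicator N x * k x) = (LINT x|\<rho>2. indicator N x * k x)"
      by (simp add: integral_density)
    then have eqN: "(LINT x|m. d1 x * (indicator N x * k x)) = (LINT x|m. d2 x * (indicator N x * k x))"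
      using d1'(1) d2'(1) unfolding d1'(2)[symmetric] d2'(2)[symmetric] by (simp add: integral_density)
    have int_N: "integrable m (\<lambda>x. indicator N x * (d x * k x))" "integrable m (\<lambda>x. indicator (- N) x * (d x * k x))"
      if "integrable m (\<lambda>x. d x * k x)" for d
      using integrable_mult_indicator[OF _ that, of N] integrable_mult_indicator[OF _ that, of "- N"] by simp_all
    have split: "(LINT x|m. d x * k x) = (LINT x|m. indicator N x * (d x * k x)) + (LINT x|m. indicator (- N) x * (d x * k x))"
      if "integrable m (\<lambda>x. d x * k x)" for d
      by (subst Bochner_Integration.integral_add[symmetric, OF int_N[OF that]])
        (auto intro!: Bochner_Integration.integral_cong split: split_indicator)
    have lw: "l x * (((d1 x - d2 x) / l x) * k x) = indicator (- N) x * (d1 x * k x) - indicator (- N) x * (d2 x * k x)" for x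
      by (cases "l x = 0") (auto simp: N_def field_simps)
    have "integrable m (\<lambda>x. l x * (((d1 x - d2 x) / l x) * k x))"
      unfolding lw by (intro Bochner_Integration.integrable_diff int_N int_m)
    then have "integrable L (\<lambda>x. ((d1 x - d2 x) / l x) * k x)"
      using l'(1) unfolding l'(2)[symmetric] by (simp add: integrable_density)
    then have 1: "integrable lborel (\<lambda>x. w x * k x)"
      unfolding L_def w_def by (simp add: integrable_density mult.assoc)
    have "(LINT x|lborel. w x * k x) = (LINT x|L. ((d1 x - d2 x) / l x) * k x)"
      unfolding L_def w_def by (simp add: integral_density mult.assoc)
    also have "\<dots> = (LINT x|m. l x * (((d1 x - d2 x) / l x) * k x))"
      using l'(1) unfolding l'(2)[symmetric] by (simp add: integral_density)
    also have "\<dots> = (LINT x|m. indicator (- N) x * (d1 x * k x)) - (LINT x|m. indicator (- N) x * (d2 x * k x))"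
      unfolding lw by (intro Bochner_Integration.integral_diff int_N int_m)
    also have "\<dots> = (LINT x|\<rho>1. k x) - (LINT x|\<rho>2. k x)"
      using eqN unfolding eq_m split[OF int_m(1)] split[OF int_m(2)] by (simp add: ac_simps)
    finally show ?thesis using 1 by simp
  qed
  have "integrable lborel (\<lambda>x. w x * 1)"
    using main[of "\<lambda>_. 1"] fin by (auto simp: finite_measure.integrable_const)
  moreover have "w x = 0" if "x \<notin> {0<..T}" for x using that by (simp add: w_def)
  ultimately show ?thesis using main by (intro exI[of _ w]) simp
qed

section \<open>Potential measure of a subordinator\<close>

lemma nn_integral_sum_measure:
  assumes sets[measurable_cong]: "sets \<rho>1 = sets M" "sets \<rho>2 = sets M" "sets m = sets M"
    and m: "\<And>A. A \<in> sets M \<Longrightarrow> emeasure m A = emeasure \<rho>1 A + emeasure \<rho>2 A"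
    and f: "f \<in> borel_measurable M"
  shows "(\<integral>\<^sup>+x. f x \<partial>m) = (\<integral>\<^sup>+x. f x \<partial>\<rho>1) + (\<integral>\<^sup>+x. f x \<partial>\<rho>2)"
  using f
proof induction
  case (cong f g)
  have "nn_integral \<rho> f = nn_integral \<rho> g" if "sets \<rho> = sets M" for \<rho>
    using cong(3) sets_eq_imp_space_eq[OF that] by (intro nn_integral_cong) simp
  then show ?case using cong(4) by (simp add: sets)
next
  case (set A)
  then show ?case by (simp add: m sets)
next
  case (mult u c)
  then show ?case by (simp add: nn_integral_cmult distrib_left)
next
  case (add u v)
  then show ?case by (simp add: nn_integral_add ac_simps)
next
  case (seq U)
  have inc: "incseq (\<lambda>i. nn_integral \<rho> (U i))" for \<rho>
    using seq(3) by (auto intro!: incseq_SucI nn_integral_mono simp: incseq_Suc_iff le_fun_def)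
  have "(SUP i. nn_integral \<rho>1 (U i)) + (SUP i. nn_integral \<rho>2 (U i)) = (SUP i. nn_integral m (U i))"
    using seq inc by (simp add: ennreal_SUP_add)
  then show ?case using seq
    by (simp add: image_comp SUP_apply nn_integral_monotone_convergence_SUP)
qed

lemma one_minus_exp_le_min:
  fixes s x :: real
  assumes "s > 0" "x > 0"
  shows "1 - exp (- s * x) \<le> max 1 s * min x 1"
proof (cases "x \<le> 1")
  case True
  have "1 - exp (- s * x) \<le> s * x" using exp_ge_add_one_self[of "- s * x"] by simp
  also have "\<dots> \<le> max 1 s * x" using assms by (intro mult_right_mono) auto
  finally show ?thesis using True by simp
next
  case False
  have "1 - exp (- s * x) \<le> 1" by simp
  also have "\<dots> \<le> max 1 s * min x 1" using False by simp
  finally show ?thesis .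
qed

lemma ennreal_cancel_const:
  fixes x y :: ennreal
  assumes "a > 0" "ennreal a * x + z = ennreal a * y + z" "z < \<infinity>"
  shows "x = y"
proof -
  have "ennreal a * x = ennreal a * y"
    using assms(2,3) by (metis add.commute ennreal_add_left_cancel infinity_ennreal_def less_irrefl)
  then have "ennreal (1 / a) * (ennreal a * x) = ennreal (1 / a) * (ennreal a * y)" by simp
  then show ?thesis using assms(1) by (simp add: mult.assoc[symmetric] ennreal_mult'[symmetric])
qed

lemma nn_integral_lborel_shift:
  fixes h :: "real \<Rightarrow> ennreal"
  assumes [measurable]: "h \<in> borel_measurable borel"
  shows "(\<integral>\<^sup>+r\<in>{0<..}. h (r + c) \<partial>lborel) = (\<integral>\<^sup>+x\<in>{c<..}. h x \<partial>lborel)"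
proof -
  have "(\<integral>\<^sup>+x\<in>{c<..}. h x \<partial>lborel) = (\<integral>\<^sup>+r. h (c + 1 * r) * indicator {c<..} (c + 1 * r) \<partial>lborel)"
    by (subst nn_integral_real_affine[where c=1 and t=c]) auto
  then show ?thesis by (auto simp: add.commute intro!: nn_integral_cong split: split_indicator)
qed

section \<open>The Bernstein function and the tail of its Levy measure\<close>

locale bernstein_function =
  fixes b :: real and \<nu> :: "real measure"
  assumes b: "0 \<le> b" and levy: "levy_measure \<nu>"
begin

definition f :: "real \<Rightarrow> real" where "f s = bernstein b \<nu> s"

text \<open>The jump part of the Bernstein function, with values in the extended nonnegative reals
  so that Tonelli and monotone convergence apply directly.\<close>

definition Phi :: "real \<Rightarrow> ennreal" where "Phi s = (\<integral>\<^sup>+x\<in>{0<..}. ennreal (1 - exp (- s * x)) \<partial>\<nu>)"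

text \<open>The kernel of the derivative with an explicit cutoff at 0: convolutions
  \<open>k (t - y)\<close> can then be written over the whole line, without the restriction
  \<open>y < t\<close>.\<close>

definition k :: "real \<Rightarrow> real" where "k z = indicator {0<..} z * levy_tail \<nu> z"

lemma sets_nu[simp, measurable_cong]: "sets \<nu> = sets borel"
  using levy by (simp add: levy_measure_def)

lemma space_nu[simp]: "space \<nu> = UNIV"
  using sets_eq_imp_space_eq[OF sets_nu] by simp

lemma Phi_finite: "s > 0 \<Longrightarrow> Phi s < \<infinity>"
proof -
  assume s: "s > 0"
  have "Phi s \<le> (\<integral>\<^sup>+x. ennreal (max 1 s) * (ennreal (min x 1) * indicator {0<..} x) \<partial>\<nu>)"
    unfolding Phi_def using s one_minus_exp_le_min[OF s]
    by (intro nn_integral_mono) (auto split: split_indicator simp: ennreal_mult'[symmetric] intro!: ennreal_leI)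
  also have "\<dots> = ennreal (max 1 s) * (\<integral>\<^sup>+x\<in>{0<..}. ennreal (min x 1) \<partial>\<nu>)"
    by (intro nn_integral_cmult) auto
  also have "\<dots> < \<infinity>" using levy by (simp add: levy_measure_def ennreal_mult_less_top)
  finally show ?thesis .
qed

lemma f_eq: "s > 0 \<Longrightarrow> ennreal (f s) = ennreal (b * s) + Phi s" "s > 0 \<Longrightarrow> 0 \<le> f s"
proof -
  assume s: "s > 0"
  have "(LINT x:{0<..}|\<nu>. 1 - exp (- s * x)) = enn2real (\<integral>\<^sup>+x. ennreal (indicator {0<..} x * (1 - exp (- s * x))) \<partial>\<nu>)"
    unfolding set_lebesgue_integral_def real_scaleR_def
    using s by (intro integral_eq_nn_integral) (auto split: split_indicator)
  also have "(\<integral>\<^sup>+x. ennreal (indicator {0<..} x * (1 - exp (- s * x))) \<partial>\<nu>) = Phi s"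
    unfolding Phi_def by (intro nn_integral_cong) (auto split: split_indicator)
  finally have "f s = b * s + enn2real (Phi s)" by (simp add: f_def bernstein_def)
  then show "ennreal (f s) = ennreal (b * s) + Phi s" "0 \<le> f s"
    using Phi_finite[OF s] b s by (auto simp: ennreal_plus)
qed

text \<open>As \<open>s\<close> grows, \<open>1 - exp (- s * x)\<close> increases to 1, so
  \<open>Phi s\<close> increases to the total mass of the Levy measure, which is infinite. This
  later excludes an atom of \<open>Z r\<close> at 0.\<close>

lemma f_unbounded: "\<exists>s>0. f s > C"
proof -
  have "(SUP n. Phi (Suc n)) = (\<integral>\<^sup>+x. (SUP n. ennreal (1 - exp (- real (Suc n) * x)) * indicator {0<..} x) \<partial>\<nu>)"
    unfolding Phi_def
    by (intro nn_integral_monotone_convergence_SUP[symmetric])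
       (auto simp: incseq_def le_fun_def split: split_indicator intro!: ennreal_leI mult_right_mono)
  also have "\<dots> = (\<integral>\<^sup>+x. indicator {0<..} x \<partial>\<nu>)"
  proof (intro nn_integral_cong)
    fix x :: real
    show "(SUP n. ennreal (1 - exp (- real (Suc n) * x)) * indicator {0<..} x) = indicator {0<..} x"
    proof (cases "x > 0")
      case True
      have "((\<lambda>n. 1 - exp (- real (Suc n) * x)) \<longlonglongrightarrow> 1 - 0)"
        using True by real_asymp
      then have "(\<lambda>n. ennreal (1 - exp (- real (Suc n) * x))) \<longlonglongrightarrow> ennreal (1 - 0)"
        by (rule tendsto_ennrealI)
      moreover have "incseq (\<lambda>n. ennreal (1 - exp (- real (Suc n) * x)))"
        using True by (auto simp: incseq_def intro!: ennreal_leI mult_right_mono)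
      ultimately have "(SUP n. ennreal (1 - exp (- real (Suc n) * x))) = 1"
        using LIMSEQ_SUP LIMSEQ_unique by (metis diff_zero ennreal_1)
      then show ?thesis using True by simp
    qed simp
  qed
  also have "\<dots> = \<infinity>" using levy by (simp add: levy_measure_def)
  finally have "(SUP n. Phi (Suc n)) = \<infinity>" .
  then have "\<exists>n. ennreal C < Phi (Suc n)"
    by (metis ennreal_less_top infinity_ennreal_def less_SUP_iff)
  then obtain n where n: "ennreal C < Phi (Suc n)" ..
  also have "\<dots> \<le> ennreal (f (Suc n))" using f_eq(1)[of "Suc n"] by simp
  finally have "C < f (Suc n)" using f_eq(2)[of "Suc n"] by (cases "C \<ge> 0") (auto simp: ennreal_less_iff)
  then show ?thesis by (intro exI[of _ "real (Suc n)"]) auto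
qed

lemma f_pos: "s > 0 \<Longrightarrow> 0 < f s"
proof (rule ccontr)
  assume s: "s > 0" and "\<not> 0 < f s"
  then have "f s = 0" using f_eq(2)[OF s] by simp
  then have "Phi s = 0" using f_eq(1)[OF s] by (simp add: zero_eq_add_iff_both_eq_0) 
  then have "AE x in \<nu>. ennreal (1 - exp (- s * x)) * indicator {0<..} x = 0"
    unfolding Phi_def by (subst (asm) nn_integral_0_iff_AE) auto
  then have "AE x in \<nu>. x \<notin> {0<..}"
    using s by (auto elim!: eventually_mono split: split_indicator_asm simp: ennreal_eq_0_iff mult_le_0_iff)
  then have "emeasure \<nu> {0<..} = 0"
    by (subst (asm) AE_iff_null_sets[symmetric]) auto
  then show False using levy by (simp add: levy_measure_def)
qed

lemma tail_finite: "z > 0 \<Longrightarrow> emeasure \<nu> {z<..} < \<infinity>"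
proof -
  assume z: "z > 0"
  have "emeasure \<nu> {z<..} = (\<integral>\<^sup>+x. indicator {z<..} x \<partial>\<nu>)" by simp
  also have "\<dots> \<le> (\<integral>\<^sup>+x. ennreal (1 / min z 1) * (ennreal (min x 1) * indicator {0<..} x) \<partial>\<nu>)"
    using z by (intro nn_integral_mono)
      (auto split: split_indicator simp: ennreal_mult'[symmetric] divide_simps min_def simp flip: ennreal_1 intro!: ennreal_leI)
  also have "\<dots> = ennreal (1 / min z 1) * (\<integral>\<^sup>+x\<in>{0<..}. ennreal (min x 1) \<partial>\<nu>)"
    by (intro nn_integral_cmult) auto
  also have "\<dots> < \<infinity>" using levy by (simp add: levy_measure_def ennreal_mult_less_top)
  finally show ?thesis .
qed

lemma levy_tail_eq: "z > 0 \<Longrightarrow> ennreal (levy_tail \<nu> z) = emeasure \<nu> {z<..}"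
  using tail_finite[of z] by (simp add: levy_tail_def emeasure_eq_ennreal_measure)

lemma levy_tail_antimono: "0 < y \<Longrightarrow> y \<le> z \<Longrightarrow> levy_tail \<nu> z \<le> levy_tail \<nu> y"
proof -
  assume yz: "0 < y" "y \<le> z"
  have "emeasure \<nu> {z<..} \<le> emeasure \<nu> {y<..}" using yz by (intro emeasure_mono) auto
  then show ?thesis using yz by (simp add: levy_tail_eq[symmetric] ennreal_le_iff levy_tail_def)
qed

lemma k_nonneg: "0 \<le> k z" by (simp add: k_def levy_tail_def)

lemma k_nonpos: "z \<le> 0 \<Longrightarrow> k z = 0" by (simp add: k_def)

lemma k_eq: "ennreal (k z) = indicator {0<..} z * emeasure \<nu> {z<..}"
  by (auto simp: k_def levy_tail_eq split: split_indicator)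

text \<open>Infinite mass can accumulate only at 0, and sets bounded away from 0 on the right have
  finite mass. Needed for Tonelli with the Levy measure as a factor.\<close>

lemma sigma_finite_nu: "sigma_finite_measure \<nu>"
proof
  define A where "A n = {..0} \<union> {1 / Suc n<..}" for n :: nat
  have "(\<Union>n. A n) = UNIV"
  proof (intro set_eqI iffI UNIV_I)
    fix x :: real
    show "x \<in> (\<Union>n. A n)"
    proof (cases "x > 0")
      case True
      then obtain n where "1 / Suc n < x" by (metis inverse_eq_divide reals_Archimedean)
      then show ?thesis by (auto simp: A_def)
    qed (auto simp: A_def)
  qed
  moreover have "emeasure \<nu> (A n) \<noteq> \<infinity>" for n
  proof -
    have "emeasure \<nu> (A n) \<le> emeasure \<nu> {..0} + emeasure \<nu> {1 / Suc n<..}"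
      unfolding A_def by (intro emeasure_subadditive) auto
    also have "\<dots> < \<infinity>" using levy tail_finite[of "1 / Suc n"] by (simp add: levy_measure_def)
    finally show ?thesis by simp
  qed
  moreover have "A n \<in> sets \<nu>" for n by (simp add: A_def)
  ultimately show "\<exists>A. countable A \<and> A \<subseteq> sets \<nu> \<and> \<Union>A = space \<nu> \<and> (\<forall>a\<in>A. emeasure \<nu> a \<noteq> \<infinity>)"
    by (intro exI[of _ "range A"]) auto
qed

lemma k_measurable[measurable]: "k \<in> borel_measurable borel"
proof -
  define K where "K z = (if z \<le> 0 then 0 else - levy_tail \<nu> z)" for z
  have "mono_on {0<..} K"
    using levy_tail_antimono by (auto simp: mono_on_def K_def)
  then have "K \<in> borel_measurable (restrict_space borel {0<..})"
    by (rule borel_measurable_mono_on_fnc)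
  then have "(\<lambda>z. indicator {0<..} z *\<^sub>R K z) \<in> borel_measurable borel"
    by (subst (asm) borel_measurable_restrict_space_iff) auto
  moreover have "k = (\<lambda>z. - (indicator {0<..} z *\<^sub>R K z))" by (auto simp: k_def K_def fun_eq_iff split: split_indicator)
  ultimately show ?thesis by simp
qed

text \<open>Writing the tail at \<open>z\<close> as the mass of the points \<open>x > z\<close>,
  Tonelli leaves the integral of \<open>exp (- s * z)\<close> over \<open>0 < z < x\<close>, which
  is \<open>(1 - exp (- s * x)) / s\<close>.\<close>

lemma laplace_k:
  assumes s: "s > 0"
  shows "(\<integral>\<^sup>+z. ennreal (exp (- s * z)) * ennreal (k z) \<partial>lborel) = ennreal (1 / s) * Phi s"
proof -
  interpret sigma_finite_measure \<nu> by (rule sigma_finite_nu)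
  interpret P: pair_sigma_finite lborel \<nu> ..
  have "(\<integral>\<^sup>+z. ennreal (exp (- s * z)) * ennreal (k z) \<partial>lborel) =
      (\<integral>\<^sup>+z. (\<integral>\<^sup>+x. ennreal (exp (- s * z)) * (indicator {0<..} z * (if z < x then 1 else 0)) \<partial>\<nu>) \<partial>lborel)"
  proof (intro nn_integral_cong)
    fix z :: real
    have "(\<integral>\<^sup>+x. ennreal (exp (- s * z)) * (indicator {0<..} z * (if z < x then 1 else 0)) \<partial>\<nu>) =
        (\<integral>\<^sup>+x. (ennreal (exp (- s * z)) * indicator {0<..} z) * indicator {z<..} x \<partial>\<nu>)"
      by (intro nn_integral_cong) (auto split: split_indicator)
    then show "ennreal (exp (- s * z)) * ennreal (k z) =
        (\<integral>\<^sup>+x. ennreal (exp (- s * z)) * (indicator {0<..} z * (if z < x then 1 else 0)) \<partial>\<nu>)"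
      by (simp add: k_eq nn_integral_cmult mult.assoc)
  qed
  also have "\<dots> = (\<integral>\<^sup>+x. (\<integral>\<^sup>+z. ennreal (exp (- s * z)) * (indicator {0<..} z * (if z < x then 1 else 0)) \<partial>lborel) \<partial>\<nu>)"
    by (rule P.Fubini'[symmetric]) measurable
  also have "\<dots> = (\<integral>\<^sup>+x. ennreal (1 / s) * (ennreal (1 - exp (- s * x)) * indicator {0<..} x) \<partial>\<nu>)"
  proof (intro nn_integral_cong)
    fix x
    show "(\<integral>\<^sup>+z. ennreal (exp (- s * z)) * (indicator {0<..} z * (if z < x then 1 else 0)) \<partial>lborel)
       = ennreal (1 / s) * (ennreal (1 - exp (- s * x)) * indicator {0<..} x)"
    proof (cases "x > 0")
      case True
      have "(\<integral>\<^sup>+z. ennreal (exp (- s * z)) * (indicator {0<..} z * (if z < x then 1 else 0)) \<partial>lborel) =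
          (\<integral>\<^sup>+z. ennreal (exp (- s * z)) * indicator {0..x} z \<partial>lborel)"
      proof (rule nn_integral_cong_AE)
        show "AE z in lborel. ennreal (exp (- s * z)) * (indicator {0<..} z * (if z < x then 1 else 0)) =
            ennreal (exp (- s * z)) * indicator {0..x} z"
          using AE_lborel_singleton[of 0] AE_lborel_singleton[of x]
          by eventually_elim (auto split: split_indicator)
      qed
      also have "\<dots> = ennreal (- exp (- s * x) / s - (- exp (- s * 0) / s))"
      proof (rule nn_integral_FTC_Icc)
        show "((\<lambda>z. - exp (- s * z) / s) has_real_derivative exp (- s * z)) (at z)" for z
          using s by (auto intro!: derivative_eq_intros)
      qed (use True in auto)
      also have "- exp (- s * x) / s - (- exp (- s * 0) / s) = 1 / s * (1 - exp (- s * x))"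
        by (simp add: diff_divide_distrib)
      also have "ennreal \<dots> = ennreal (1 / s) * ennreal (1 - exp (- s * x))"
        using s True by (intro ennreal_mult) auto
      finally show ?thesis using True by simp
    qed (auto intro!: nn_integral_zero' split: split_indicator)
  qed
  also have "\<dots> = ennreal (1 / s) * Phi s" unfolding Phi_def by (intro nn_integral_cmult) auto
  finally show ?thesis .
qed

end


section \<open>Potential integrals and the convolution semigroup\<close>

locale subordinator_marginals = bernstein_function + prob_space M for M :: "'a measure" +
  fixes Z :: "real \<Rightarrow> 'a \<Rightarrow> real"
  assumes Z_joint[measurable]: "(\<lambda>p. Z (fst p) (snd p)) \<in> borel_measurable (borel \<Otimes>\<^sub>M M)"
    and Z_nonneg: "\<And>r \<omega>. 0 \<le> Z r \<omega>"
    and Z_laplace: "\<And>r s. r > 0 \<Longrightarrow> s > 0 \<Longrightarrow> (LINT \<omega>|M. exp (- s * Z r \<omega>)) = exp (- r * f s)"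
begin

text \<open>The image of \<open>Q\<close> under \<open>Y\<close> is the potential measure \<open>U(dy) = \<integral> P(Z r \<in> dy) dr\<close>, and \<open>Uk\<close> below is
  the convolution of \<open>U\<close> with the tail \<open>k\<close> of \<open>\<nu>\<close>. Keeping the pair \<open>(r, Y)\<close> allows weights that depend on \<open>r\<close>.\<close>
definition pos :: "real measure" where "pos = density lborel (indicator {0<..})"

definition Q :: "(real \<times> 'a) measure" where "Q = pos \<Otimes>\<^sub>M M"

definition Y :: "real \<times> 'a \<Rightarrow> real" where "Y p = Z (fst p) (snd p)"

lemma sets_pos[simp, measurable_cong]: "sets pos = sets borel" by (simp add: pos_def)

lemma sets_Q[simp, measurable_cong]: "sets Q = sets (borel \<Otimes>\<^sub>M M)"
  unfolding Q_def by (intro sets_pair_measure_cong) auto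

lemma space_Q[simp]: "space Q = UNIV \<times> space M"
  using sets_eq_imp_space_eq[OF sets_Q] by (simp add: space_pair_measure)

lemma Z_measurable[measurable]: "Z r \<in> borel_measurable M"
  using measurable_compose[OF measurable_Pair1' Z_joint, of r] by simp

lemma Y_measurable[measurable]: "Y \<in> borel_measurable (borel \<Otimes>\<^sub>M M)"
  using Z_joint by (simp add: Y_def[abs_def])

lemma Y_nonneg: "0 \<le> Y p" by (simp add: Y_def Z_nonneg)

sublocale pos: sigma_finite_measure pos
  unfolding pos_def by (subst sigma_finite_measure.sigma_finite_iff_density_finite[OF sigma_finite_lborel]) (auto split: split_indicator)

sublocale posM: pair_sigma_finite pos M ..

lemma sigma_finite_Q: "sigma_finite_measure Q"
  unfolding Q_def by (rule posM.P.sigma_finite_measure_axioms)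

sublocale Q: sigma_finite_measure Q by (rule sigma_finite_Q)

lemma nn_integral_Q:
  assumes [measurable]: "G \<in> borel_measurable (borel \<Otimes>\<^sub>M M)"
  shows "(\<integral>\<^sup>+p. G p \<partial>Q) = (\<integral>\<^sup>+r\<in>{0<..}. (\<integral>\<^sup>+\<omega>. G (r, \<omega>) \<partial>M) \<partial>lborel)"
proof -
  have "(\<integral>\<^sup>+p. G p \<partial>Q) = (\<integral>\<^sup>+r. (\<integral>\<^sup>+\<omega>. G (r, \<omega>) \<partial>M) \<partial>pos)"
    unfolding Q_def by (rule nn_integral_fst[symmetric]) measurable
  also have "\<dots> = (\<integral>\<^sup>+r\<in>{0<..}. (\<integral>\<^sup>+\<omega>. G (r, \<omega>) \<partial>M) \<partial>lborel)"
    unfolding pos_def by (subst nn_integral_density) (auto simp: mult.commute)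
  finally show ?thesis .
qed

lemma AE_Q_pos: "AE p in Q. 0 < fst p"
proof -
  have "emeasure Q {p \<in> space Q. \<not> 0 < fst p} = (\<integral>\<^sup>+p. indicator {p \<in> space Q. \<not> 0 < fst p} p \<partial>Q)" by simp
  also have "\<dots> = (\<integral>\<^sup>+r\<in>{0<..}. (\<integral>\<^sup>+\<omega>. indicator {p \<in> space Q. \<not> 0 < fst p} (r, \<omega>) \<partial>M) \<partial>lborel)"
    by (rule nn_integral_Q) measurable
  also have "\<dots> = (\<integral>\<^sup>+(r::real). 0 \<partial>lborel)"
    by (intro nn_integral_cong) (auto split: split_indicator)
  finally show ?thesis by (intro AE_I[OF order_refl]) auto
qed

lemma laplace_Z:
  assumes "r > 0" "s > 0"
  shows "(\<integral>\<^sup>+\<omega>. ennreal (exp (- s * Z r \<omega>)) \<partial>M) = ennreal (exp (- r * f s))"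
proof -
  have "integrable M (\<lambda>\<omega>. exp (- s * Z r \<omega>))"
    using assms Z_nonneg by (intro integrable_const_bound[where B=1]) auto
  then show ?thesis
    using Z_laplace[OF assms] by (subst nn_integral_eq_integral) auto
qed

lemma laplace_Q:
  assumes s: "s > 0"
  shows "(\<integral>\<^sup>+p. ennreal (exp (- s * Y p)) \<partial>Q) = ennreal (1 / f s)"
proof -
  have "(\<integral>\<^sup>+p. ennreal (exp (- s * Y p)) \<partial>Q) = (\<integral>\<^sup>+r\<in>{0<..}. (\<integral>\<^sup>+\<omega>. ennreal (exp (- s * Y (r, \<omega>))) \<partial>M) \<partial>lborel)"
    by (rule nn_integral_Q) measurable
  also have "\<dots> = (\<integral>\<^sup>+r. ennreal (exp (- r * f s)) * indicator {0..} r \<partial>lborel)"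
  proof (rule nn_integral_cong_AE)
    show "AE r in lborel. (\<integral>\<^sup>+\<omega>. ennreal (exp (- s * Y (r, \<omega>))) \<partial>M) * indicator {0<..} r
        = ennreal (exp (- r * f s)) * indicator {0..} r"
      using AE_lborel_singleton[of "0::real"]
      by eventually_elim (auto simp: Y_def laplace_Z[OF _ s, simplified] split: split_indicator)
  qed
  also have "\<dots> = ennreal (0 - (- exp (- 0 * f s) / f s))"
  proof (rule nn_integral_FTC_atLeast)
    show "((\<lambda>r. - exp (- r * f s) / f s) has_real_derivative exp (- x * f s)) (at x)" for x
      using f_pos[OF s] by (auto intro!: derivative_eq_intros)
    show "((\<lambda>r. - exp (- r * f s) / f s) \<longlongrightarrow> 0) at_top"
      using f_pos[OF s] by real_asymp
  qed auto
  finally show ?thesis by simp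
qed

text \<open>The exponential \<open>exp (t - y)\<close> dominates the indicator of
  \<open>y \<le> t\<close>, and its potential is finite by \<open>laplace_Q\<close>. All
  integrability over the infinite measure \<open>Q\<close> goes back to this bound.\<close>

lemma potential_finite: "(\<integral>\<^sup>+p. indicator {..t} (Y p) \<partial>Q) < \<infinity>"
proof -
  have "(\<integral>\<^sup>+p. indicator {..t} (Y p) \<partial>Q) \<le> (\<integral>\<^sup>+p. ennreal (exp t) * ennreal (exp (- 1 * Y p)) \<partial>Q)"
    by (intro nn_integral_mono)
      (auto split: split_indicator simp: ennreal_mult[symmetric] exp_add[symmetric] simp flip: ennreal_1 intro!: ennreal_leI)
  also have "\<dots> = ennreal (exp t) * ennreal (1 / f 1)"
    by (subst nn_integral_cmult) (auto simp: laplace_Q[of 1, simplified])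
  also have "\<dots> < \<infinity>" by (simp add: ennreal_mult_less_top)
  finally show ?thesis .
qed

text \<open>An atom at 0 of mass \<open>p\<close> bounds every Laplace transform of
  \<open>Z r\<close> from below by \<open>p\<close>, whereas \<open>exp (- r * f s)\<close> falls
  below \<open>p\<close> for suitable \<open>s\<close> because \<open>f\<close> is
  unbounded.\<close>

lemma prob_Z_nonpos: "r > 0 \<Longrightarrow> prob {\<omega> \<in> space M. Z r \<omega> \<le> 0} = 0"
proof (rule ccontr)
  assume r: "r > 0" and ne: "prob {\<omega> \<in> space M. Z r \<omega> \<le> 0} \<noteq> 0"
  define p where "p = prob {\<omega> \<in> space M. Z r \<omega> \<le> 0}"
  have p: "p > 0" using ne by (simp add: p_def zero_less_measure_iff)
  obtain s where s: "s > 0" "f s > - ln p / r" using f_unbounded by blast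
  have "p = (LINT \<omega>|M. indicator {\<omega> \<in> space M. Z r \<omega> \<le> 0} \<omega>)" by (simp add: p_def)
  also have "\<dots> \<le> (LINT \<omega>|M. exp (- s * Z r \<omega>))"
    using s Z_nonneg by (intro integral_mono integrable_const_bound[where B=1])
      (auto split: split_indicator simp: mult_le_0_iff zero_le_mult_iff)
  also have "\<dots> = exp (- r * f s)" by (rule Z_laplace[OF r s(1)])
  also have "\<dots> < exp (ln p)" using s r by (simp add: field_simps)
  also have "\<dots> = p" using p by simp
  finally show False by simp
qed

lemma AE_Z_pos: "r > 0 \<Longrightarrow> AE \<omega> in M. 0 < Z r \<omega>"
  using prob_Z_nonpos[of r]
  by (intro AE_I[where N="{\<omega> \<in> space M. Z r \<omega> \<le> 0}"]) (auto simp: emeasure_eq_measure)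

lemma AE_Y_pos: "AE p in Q. 0 < Y p"
proof -
  have "emeasure Q {p \<in> space Q. \<not> 0 < Y p} = (\<integral>\<^sup>+p. indicator {p \<in> space Q. \<not> 0 < Y p} p \<partial>Q)" by simp
  also have "\<dots> = (\<integral>\<^sup>+r\<in>{0<..}. (\<integral>\<^sup>+\<omega>. indicator {p \<in> space Q. \<not> 0 < Y p} (r, \<omega>) \<partial>M) \<partial>lborel)"
    by (rule nn_integral_Q) measurable
  also have "\<dots> = (\<integral>\<^sup>+(r::real). 0 \<partial>lborel)"
  proof (intro nn_integral_cong)
    fix r :: real
    have "(\<integral>\<^sup>+\<omega>. indicator {p \<in> space Q. \<not> 0 < Y p} (r, \<omega>) \<partial>M) = 0" if "r > 0"
      using AE_Z_pos[OF that] by (subst nn_integral_0_iff_AE)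
        (auto elim!: eventually_mono simp: Y_def split: split_indicator)
    then show "(\<integral>\<^sup>+\<omega>. indicator {p \<in> space Q. \<not> 0 < Y p} (r, \<omega>) \<partial>M) * indicator {0<..} r = 0"
      by (auto split: split_indicator)
  qed
  finally show ?thesis by (intro AE_I[OF order_refl]) auto
qed

text \<open>Markov's inequality for \<open>1 - exp (- Z r)\<close>: the probability of exceeding
  \<open>t\<close>, times \<open>1 - exp (- t)\<close>, is at most
  \<open>1 - exp (- r * f 1)\<close>, which tends to 0 with \<open>r\<close>.\<close>

lemma prob_Z_le_near_0:
  assumes t: "t > 0"
  shows "((\<lambda>r. prob {\<omega> \<in> space M. Z r \<omega> \<le> t}) \<longlongrightarrow> 1) (at_right 0)"
proof (rule tendsto_sandwich)
  have "1 - (1 - exp (- r * f 1)) / (1 - exp (- t)) \<le> prob {\<omega> \<in> space M. Z r \<omega> \<le> t}" if r: "r > 0" for r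
  proof -
    have "(1 - exp (- t)) * (1 - prob {\<omega> \<in> space M. Z r \<omega> \<le> t}) = (1 - exp (- t)) * prob {\<omega> \<in> space M. \<not> Z r \<omega> \<le> t}"
      by (subst prob_neg) auto
    also have "\<dots> = (LINT \<omega>|M. (1 - exp (- t)) * indicator {\<omega> \<in> space M. \<not> Z r \<omega> \<le> t} \<omega>)"
      by simp
    also have "\<dots> \<le> (LINT \<omega>|M. 1 - exp (- 1 * Z r \<omega>))"
      using t Z_nonneg by (intro integral_mono integrable_const_bound[where B=1])
        (auto split: split_indicator)
    also have "\<dots> = 1 - exp (- r * f 1)"
      using Z_laplace[OF r, of 1] Z_nonneg
      by (subst Bochner_Integration.integral_diff) (auto simp: prob_space intro!: integrable_const_bound[where B=1])
    finally show ?thesis using t by (simp add: field_simps)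
  qed
  then show "\<forall>\<^sub>F r in at_right 0. 1 - (1 - exp (- r * f 1)) / (1 - exp (- t)) \<le> prob {\<omega> \<in> space M. Z r \<omega> \<le> t}"
    by (intro eventually_mono[OF eventually_at_right_less[of 0]])
  have "((\<lambda>r. 1 - (1 - exp (- r * f 1)) / (1 - exp (- t))) \<longlongrightarrow> 1 - (1 - exp (- 0 * f 1)) / (1 - exp (- t))) (at_right 0)"
    using t by (intro tendsto_intros) auto
  then show "((\<lambda>r. 1 - (1 - exp (- r * f 1)) / (1 - exp (- t))) \<longlongrightarrow> 1) (at_right 0)" by simp
qed auto

text \<open>Both laws have the transform \<open>exp (- (r + r') * f s)\<close>. The product space
  provides the independent copies, so the semigroup property is read off the one-dimensional
  laws.\<close>

lemma distr_Z_add: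
  assumes "r > 0" "r' > 0"
  shows "distr (M \<Otimes>\<^sub>M M) borel (\<lambda>q. Z r (fst q) + Z r' (snd q)) = distr M borel (Z (r + r'))"
proof (rule laplace_transform_unique)
  show "emeasure (distr (M \<Otimes>\<^sub>M M) borel (\<lambda>q. Z r (fst q) + Z r' (snd q))) {..<0} = 0"
  proof -
    have "(\<lambda>q. Z r (fst q) + Z r' (snd q)) -` {..<0} = {}"
      by (auto dest: order.strict_trans1[OF add_nonneg_nonneg[OF Z_nonneg Z_nonneg]])
    then show ?thesis by (subst emeasure_distr) auto
  qed
  show "emeasure (distr M borel (Z (r + r'))) {..<0} = 0"
  proof -
    have "Z (r + r') -` {..<0} = {}" by (auto dest: order.strict_trans1[OF Z_nonneg])
    then show ?thesis by (subst emeasure_distr) auto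
  qed
  interpret MM: pair_prob_space M M ..
  have lap: "(\<integral>\<^sup>+x. ennreal (exp (- s * x)) \<partial>distr (M \<Otimes>\<^sub>M M) borel (\<lambda>q. Z r (fst q) + Z r' (snd q))) =
      ennreal (exp (- (r + r') * f s))" if s: "s > 0" for s
  proof -
    have "(\<integral>\<^sup>+x. ennreal (exp (- s * x)) \<partial>distr (M \<Otimes>\<^sub>M M) borel (\<lambda>q. Z r (fst q) + Z r' (snd q))) =
        (\<integral>\<^sup>+q. ennreal (exp (- s * Z r (fst q))) * ennreal (exp (- s * Z r' (snd q))) \<partial>(M \<Otimes>\<^sub>M M))"
      by (subst nn_integral_distr) (auto simp: ennreal_mult[symmetric] exp_add[symmetric] algebra_simps)
    also have "\<dots> = (\<integral>\<^sup>+\<omega>. (\<integral>\<^sup>+\<omega>'. ennreal (exp (- s * Z r \<omega>)) * ennreal (exp (- s * Z r' \<omega>')) \<partial>M) \<partial>M)"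
      by (subst nn_integral_fst[symmetric]) auto
    also have "\<dots> = ennreal (exp (- r * f s)) * ennreal (exp (- r' * f s))"
      using laplace_Z[OF assms(1) s] laplace_Z[OF assms(2) s] by (simp add: nn_integral_cmult nn_integral_multc)
    finally show ?thesis by (simp add: ennreal_mult[symmetric] exp_add[symmetric] algebra_simps)
  qed
  show "(\<integral>\<^sup>+x. ennreal (exp (- s * x)) \<partial>distr (M \<Otimes>\<^sub>M M) borel (\<lambda>q. Z r (fst q) + Z r' (snd q))) =
      (\<integral>\<^sup>+x. ennreal (exp (- s * x)) \<partial>distr M borel (Z (r + r')))" if s: "s > 0" for s
    using assms laplace_Z[OF _ s, of "r + r'"] by (subst lap[OF s], subst nn_integral_distr) auto
  show "(\<integral>\<^sup>+x. ennreal (exp (- x)) \<partial>distr (M \<Otimes>\<^sub>M M) borel (\<lambda>q. Z r (fst q) + Z r' (snd q))) < \<infinity>"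
    using lap[of 1] by simp
qed auto

lemma nn_integral_Z_add:
  assumes "r > 0" "r' > 0" and [measurable]: "g \<in> borel_measurable borel"
  shows "(\<integral>\<^sup>+\<omega>. (\<integral>\<^sup>+\<omega>'. g (Z r \<omega> + Z r' \<omega>') \<partial>M) \<partial>M) = (\<integral>\<^sup>+\<omega>. g (Z (r + r') \<omega>) \<partial>M)"
proof -
  have "(\<integral>\<^sup>+\<omega>. (\<integral>\<^sup>+\<omega>'. g (Z r \<omega> + Z r' \<omega>') \<partial>M) \<partial>M) = (\<integral>\<^sup>+x. g x \<partial>distr (M \<Otimes>\<^sub>M M) borel (\<lambda>q. Z r (fst q) + Z r' (snd q)))"
    by (subst nn_integral_distr, measurable) (subst nn_integral_fst[symmetric], auto)
  also have "\<dots> = (\<integral>\<^sup>+\<omega>. g (Z (r + r') \<omega>) \<partial>M)"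
    unfolding distr_Z_add[OF assms(1,2)] by (rule nn_integral_distr) measurable
  finally show ?thesis .
qed

lemma Z_compose[measurable (raw)]:
  assumes [measurable]: "g \<in> borel_measurable N" "h \<in> measurable N M"
  shows "(\<lambda>x. Z (g x) (h x)) \<in> borel_measurable N"
  using measurable_compose[OF _ Z_joint, of "\<lambda>x. (g x, h x)" N] by simp

text \<open>The sum of independent positions at levels \<open>r\<close> and \<open>r'\<close> is
  distributed as the position at level \<open>x = r + r'\<close>. For fixed \<open>x\<close> the
  level \<open>r\<close> runs through \<open>(0, x)\<close>, so convolution with the potential
  measure integrates the weight.\<close>

lemma nn_integral_Q_add:
  assumes [measurable]: "\<alpha> \<in> borel_measurable borel" "g \<in> borel_measurable borel"
  shows "(\<integral>\<^sup>+p. \<alpha> (fst p) * (\<integral>\<^sup>+p'. g (Y p + Y p') \<partial>Q) \<partial>Q) =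
    (\<integral>\<^sup>+p. (\<integral>\<^sup>+r. \<alpha> r * indicator {0<..<fst p} r \<partial>lborel) * g (Y p) \<partial>Q)" (is "?L = ?R")
proof -
  interpret LM: pair_sigma_finite lborel M ..
  define h where "h x = (\<integral>\<^sup>+\<omega>. g (Z x \<omega>) \<partial>M)" for x
  have [measurable]: "h \<in> borel_measurable borel" unfolding h_def by measurable
  have "?L = (\<integral>\<^sup>+r\<in>{0<..}. (\<integral>\<^sup>+\<omega>. \<alpha> r * (\<integral>\<^sup>+p'. g (Z r \<omega> + Y p') \<partial>Q) \<partial>M) \<partial>lborel)"
    by (subst nn_integral_Q) (auto simp: Y_def)
  also have "\<dots> = (\<integral>\<^sup>+r\<in>{0<..}. \<alpha> r * (\<integral>\<^sup>+x\<in>{r<..}. h x \<partial>lborel) \<partial>lborel)"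
  proof (intro nn_integral_cong)
    fix r :: real
    have "(\<integral>\<^sup>+\<omega>. (\<integral>\<^sup>+p'. g (Z r \<omega> + Y p') \<partial>Q) \<partial>M) = (\<integral>\<^sup>+x\<in>{r<..}. h x \<partial>lborel)" if r: "r > 0"
    proof -
      have "(\<integral>\<^sup>+\<omega>. (\<integral>\<^sup>+p'. g (Z r \<omega> + Y p') \<partial>Q) \<partial>M) =
          (\<integral>\<^sup>+\<omega>. (\<integral>\<^sup>+r'. (\<integral>\<^sup>+\<omega>'. g (Z r \<omega> + Z r' \<omega>') \<partial>M) * indicator {0<..} r' \<partial>lborel) \<partial>M)"
        by (intro nn_integral_cong, subst nn_integral_Q) (auto simp: Y_def)
      also have "\<dots> = (\<integral>\<^sup>+r'. (\<integral>\<^sup>+\<omega>. (\<integral>\<^sup>+\<omega>'. g (Z r \<omega> + Z r' \<omega>') \<partial>M) * indicator {0<..} r' \<partial>M) \<partial>lborel)"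
        by (rule LM.Fubini') measurable
      also have "\<dots> = (\<integral>\<^sup>+r'\<in>{0<..}. h (r' + r) \<partial>lborel)"
      proof (intro nn_integral_cong)
        fix r' :: real
        have "(\<integral>\<^sup>+\<omega>. (\<integral>\<^sup>+\<omega>'. g (Z r \<omega> + Z r' \<omega>') \<partial>M) \<partial>M) = h (r' + r)" if "r' > 0"
          using nn_integral_Z_add[OF r that, of g] by (simp add: h_def add.commute)
        then show "(\<integral>\<^sup>+\<omega>. (\<integral>\<^sup>+\<omega>'. g (Z r \<omega> + Z r' \<omega>') \<partial>M) * indicator {0<..} r' \<partial>M) = h (r' + r) * indicator {0<..} r'"
          by (cases "r' > 0") (auto simp: nn_integral_multc)
      qed
      also have "\<dots> = (\<integral>\<^sup>+x\<in>{r<..}. h x \<partial>lborel)" by (rule nn_integral_lborel_shift) measurable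
      finally show ?thesis .
    qed
    then show "(\<integral>\<^sup>+\<omega>. \<alpha> r * (\<integral>\<^sup>+p'. g (Z r \<omega> + Y p') \<partial>Q) \<partial>M) * indicator {0<..} r =
        \<alpha> r * (\<integral>\<^sup>+x\<in>{r<..}. h x \<partial>lborel) * indicator {0<..} r"
      by (cases "r > 0") (auto simp: nn_integral_cmult)
  qed
  \<comment> \<open>With \<open>x\<close> as the new variable the domain is
    \<open>0 < r < x\<close>; the order of integration can now be exchanged and the weight collected
    for fixed \<open>x\<close>.\<close>
  also have "\<dots> = (\<integral>\<^sup>+r. (\<integral>\<^sup>+x. \<alpha> r * h x * (if 0 < r \<and> r < x then 1 else 0) \<partial>lborel) \<partial>lborel)"
    by (intro nn_integral_cong)
       (auto simp: nn_integral_cmult[symmetric] mult.assoc intro!: nn_integral_cong split: split_indicator)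
  also have "\<dots> = (\<integral>\<^sup>+x. (\<integral>\<^sup>+r. \<alpha> r * h x * (if 0 < r \<and> r < x then 1 else 0) \<partial>lborel) \<partial>lborel)"
    by (rule lborel_pair.Fubini'[symmetric]) measurable
  also have "\<dots> = (\<integral>\<^sup>+x\<in>{0<..}. (\<integral>\<^sup>+\<omega>. (\<integral>\<^sup>+r. \<alpha> r * indicator {0<..<x} r \<partial>lborel) * g (Z x \<omega>) \<partial>M) \<partial>lborel)"
  proof (intro nn_integral_cong)
    fix x :: real
    have "(\<integral>\<^sup>+r. \<alpha> r * h x * (if 0 < r \<and> r < x then 1 else 0) \<partial>lborel) = (\<integral>\<^sup>+r. (\<alpha> r * indicator {0<..<x} r) * h x \<partial>lborel)"
      by (intro nn_integral_cong) (auto simp: ac_simps split: split_indicator)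
    also have "\<dots> = (\<integral>\<^sup>+r. \<alpha> r * indicator {0<..<x} r \<partial>lborel) * h x"
      by (rule nn_integral_multc) measurable
    also have "\<dots> = (\<integral>\<^sup>+r. \<alpha> r * indicator {0<..<x} r \<partial>lborel) * h x * indicator {0<..} x"
      by (cases "x > 0") auto
    also have "\<dots> = (\<integral>\<^sup>+\<omega>. (\<integral>\<^sup>+r. \<alpha> r * indicator {0<..<x} r \<partial>lborel) * g (Z x \<omega>) \<partial>M) * indicator {0<..} x"
      unfolding h_def by (subst nn_integral_cmult) auto
    finally show "(\<integral>\<^sup>+r. \<alpha> r * h x * (if 0 < r \<and> r < x then 1 else 0) \<partial>lborel) =
      (\<integral>\<^sup>+\<omega>. (\<integral>\<^sup>+r. \<alpha> r * indicator {0<..<x} r \<partial>lborel) * g (Z x \<omega>) \<partial>M) * indicator {0<..} x" .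
  qed
  also have "\<dots> = ?R"
  proof -
    have "(\<lambda>p :: real \<times> 'a. \<integral>\<^sup>+r. \<alpha> r * indicator {0<..<fst p} r \<partial>lborel) \<in> borel_measurable (borel \<Otimes>\<^sub>M M)"
    proof -
      have "(\<lambda>p :: real \<times> 'a. \<integral>\<^sup>+r. \<alpha> r * indicator {0<..<fst p} r \<partial>lborel) =
          (\<lambda>p. \<integral>\<^sup>+r. \<alpha> r * (if 0 < r \<and> r < fst p then 1 else 0) \<partial>lborel)"
        by (intro ext nn_integral_cong) (auto split: split_indicator)
      also have "\<dots> \<in> borel_measurable (borel \<Otimes>\<^sub>M M)" by measurable
      finally show ?thesis .
    qed
    then show ?thesis by (subst nn_integral_Q) (auto simp: Y_def)
  qed
  finally show ?thesis .
qed

text \<open>Adding an independent \<open>Z \<epsilon>\<close> to the position has the effect of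
  raising the level by \<open>\<epsilon>\<close>. Expressed at the new level, the old one is
  \<open>fst p - \<epsilon>\<close>, and only levels above \<open>\<epsilon>\<close> are
  reached.\<close>

lemma nn_integral_Q_shift:
  assumes \<epsilon>: "\<epsilon> > 0" and [measurable]: "G \<in> borel_measurable (borel \<Otimes>\<^sub>M borel)"
  shows "(\<integral>\<^sup>+\<omega>. (\<integral>\<^sup>+p. G (fst p, Y p + Z \<epsilon> \<omega>) \<partial>Q) \<partial>M) =
    (\<integral>\<^sup>+p. indicator {\<epsilon><..} (fst p) * G (fst p - \<epsilon>, Y p) \<partial>Q)" (is "?L = ?R")
proof -
  interpret LM: pair_sigma_finite lborel M ..
  define h where "h r = (\<integral>\<^sup>+\<omega>. G (r - \<epsilon>, Z r \<omega>) \<partial>M)" for r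
  have [measurable]: "h \<in> borel_measurable borel" unfolding h_def by measurable
  have "?L = (\<integral>\<^sup>+\<omega>. (\<integral>\<^sup>+r. (\<integral>\<^sup>+\<omega>'. G (r, Z r \<omega>' + Z \<epsilon> \<omega>) \<partial>M) * indicator {0<..} r \<partial>lborel) \<partial>M)"
    by (intro nn_integral_cong, subst nn_integral_Q) (auto simp: Y_def)
  also have "\<dots> = (\<integral>\<^sup>+r. (\<integral>\<^sup>+\<omega>. (\<integral>\<^sup>+\<omega>'. G (r, Z r \<omega>' + Z \<epsilon> \<omega>) \<partial>M) * indicator {0<..} r \<partial>M) \<partial>lborel)"
    by (rule LM.Fubini') measurable
  also have "\<dots> = (\<integral>\<^sup>+r\<in>{0<..}. h (r + \<epsilon>) \<partial>lborel)"
  proof (intro nn_integral_cong)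
    fix r :: real
    have "(\<integral>\<^sup>+\<omega>. (\<integral>\<^sup>+\<omega>'. G (r, Z r \<omega>' + Z \<epsilon> \<omega>) \<partial>M) \<partial>M) = h (r + \<epsilon>)" if "r > 0"
      using nn_integral_Z_add[OF \<epsilon> that, of "\<lambda>x. G (r, x)"] by (simp add: h_def add.commute)
    then show "(\<integral>\<^sup>+\<omega>. (\<integral>\<^sup>+\<omega>'. G (r, Z r \<omega>' + Z \<epsilon> \<omega>) \<partial>M) * indicator {0<..} r \<partial>M) = h (r + \<epsilon>) * indicator {0<..} r"
      by (cases "r > 0") (auto simp: nn_integral_multc)
  qed
  also have "\<dots> = (\<integral>\<^sup>+r\<in>{\<epsilon><..}. h r \<partial>lborel)" by (rule nn_integral_lborel_shift) measurable
  also have "\<dots> = (\<integral>\<^sup>+r\<in>{0<..}. (\<integral>\<^sup>+\<omega>. indicator {\<epsilon><..} r * G (r - \<epsilon>, Z r \<omega>) \<partial>M) \<partial>lborel)"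
    unfolding h_def using \<epsilon> by (intro nn_integral_cong) (auto split: split_indicator)
  also have "\<dots> = ?R"
    by (subst nn_integral_Q) (auto simp: Y_def)
  finally show ?thesis .
qed

text \<open>The nonnegative version, applied to indicators, says that two image measures on the
  plane coincide. Signed integrands can then be transported through this equality without splitting
  them.\<close>

lemma integral_Q_shift:
  fixes H :: "real \<times> real \<Rightarrow> real"
  assumes \<epsilon>: "\<epsilon> > 0" and [measurable]: "H \<in> borel_measurable (borel \<Otimes>\<^sub>M borel)"
    and int: "integrable Q (\<lambda>p. indicator {\<epsilon><..} (fst p) * H (fst p - \<epsilon>, Y p))"
  shows "(LINT \<omega>|M. (LINT p|Q. H (fst p, Y p + Z \<epsilon> \<omega>))) = (LINT p|Q. indicator {\<epsilon><..} (fst p) * H (fst p - \<epsilon>, Y p))"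
proof -
  interpret MQ: pair_sigma_finite M Q ..
  define D1 where "D1 = distr (M \<Otimes>\<^sub>M Q) (borel \<Otimes>\<^sub>M borel) (\<lambda>q. (fst (snd q), Y (snd q) + Z \<epsilon> (fst q)))"
  define D2 where "D2 = distr (density Q (\<lambda>p. ennreal (indicator {\<epsilon><..} (fst p)))) (borel \<Otimes>\<^sub>M borel) (\<lambda>p. (fst p - \<epsilon>, Y p))"
  have "D1 = D2"
  proof (rule measure_eqI)
    fix A assume "A \<in> sets D1"
    then have [measurable]: "A \<in> sets (borel \<Otimes>\<^sub>M borel)" by (simp add: D1_def)
    have "emeasure D1 A = (\<integral>\<^sup>+z. indicator A z \<partial>D1)" by (simp add: D1_def)
    also have "\<dots> = (\<integral>\<^sup>+q. indicator A (fst (snd q), Y (snd q) + Z \<epsilon> (fst q)) \<partial>(M \<Otimes>\<^sub>M Q))"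
      unfolding D1_def by (rule nn_integral_distr) measurable
    also have "\<dots> = (\<integral>\<^sup>+\<omega>. (\<integral>\<^sup>+p. indicator A (fst p, Y p + Z \<epsilon> \<omega>) \<partial>Q) \<partial>M)"
      by (subst Q.nn_integral_fst[symmetric]) auto
    also have "\<dots> = (\<integral>\<^sup>+p. indicator {\<epsilon><..} (fst p) * indicator A (fst p - \<epsilon>, Y p) \<partial>Q)"
      by (rule nn_integral_Q_shift[OF \<epsilon>]) measurable
    also have "\<dots> = (\<integral>\<^sup>+z. indicator A z \<partial>D2)"
      unfolding D2_def
      by (subst nn_integral_distr, measurable) (subst nn_integral_density, auto simp: ennreal_indicator)
    also have "\<dots> = emeasure D2 A" by (simp add: D2_def)
    finally show "emeasure D1 A = emeasure D2 A" .
  qed (simp add: D1_def D2_def)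
  have "integrable D2 H"
    unfolding D2_def using int by (subst integrable_distr_eq, simp, simp) (subst integrable_density, auto)
  then have "integrable D1 H" using \<open>D1 = D2\<close> by simp
  then have i: "integrable (M \<Otimes>\<^sub>M Q) (\<lambda>q. H (fst (snd q), Y (snd q) + Z \<epsilon> (fst q)))"
    unfolding D1_def by (subst (asm) integrable_distr_eq) auto
  have "(LINT \<omega>|M. (LINT p|Q. H (fst p, Y p + Z \<epsilon> \<omega>))) = (LINT q|(M \<Otimes>\<^sub>M Q). H (fst (snd q), Y (snd q) + Z \<epsilon> (fst q)))"
    using MQ.integral_fst'[OF i] by simp
  also have "\<dots> = (LINT z|D1. H z)" unfolding D1_def by (subst integral_distr) auto
  also have "\<dots> = (LINT z|D2. H z)" using \<open>D1 = D2\<close> by simp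
  also have "\<dots> = (LINT p|Q. indicator {\<epsilon><..} (fst p) * H (fst p - \<epsilon>, Y p))"
    unfolding D2_def by (subst integral_distr, simp, simp) (subst integral_density, auto)
  finally show ?thesis .
qed

section \<open>The renewal identity and a bound at every point\<close>

definition Uk :: "real \<Rightarrow> ennreal" where "Uk t = (\<integral>\<^sup>+p. ennreal (k (t - Y p)) \<partial>Q)"

lemma Uk_measurable[measurable]: "Uk \<in> borel_measurable borel"
  unfolding Uk_def by measurable

lemma Uk_nonpos: "t \<le> 0 \<Longrightarrow> Uk t = 0"
proof -
  assume "t \<le> 0"
  then have "k (t - Y p) = 0" for p using Y_nonneg[of p] by (intro k_nonpos) linarith
  then show ?thesis by (simp add: Uk_def)
qed

text \<open>A convolution has the product of the transforms: \<open>1 / f s\<close> from the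
  potential measure and \<open>Phi s / s\<close> from the tail.\<close>

lemma laplace_Uk:
  assumes s: "s > 0"
  shows "(\<integral>\<^sup>+t. Uk t * ennreal (exp (- s * t)) \<partial>lborel) = ennreal (1 / f s) * (ennreal (1 / s) * Phi s)"
proof -
  interpret LQ: pair_sigma_finite lborel Q ..
  have "(\<integral>\<^sup>+t. Uk t * ennreal (exp (- s * t)) \<partial>lborel) =
      (\<integral>\<^sup>+t. (\<integral>\<^sup>+p. ennreal (k (t - Y p)) * ennreal (exp (- s * t)) \<partial>Q) \<partial>lborel)"
    unfolding Uk_def by (intro nn_integral_cong nn_integral_multc[symmetric]) measurable
  also have "\<dots> = (\<integral>\<^sup>+p. (\<integral>\<^sup>+t. ennreal (k (t - Y p)) * ennreal (exp (- s * t)) \<partial>lborel) \<partial>Q)"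
    by (rule LQ.Fubini'[symmetric]) measurable
  also have "\<dots> = (\<integral>\<^sup>+p. ennreal (exp (- s * Y p)) * (ennreal (1 / s) * Phi s) \<partial>Q)"
  proof (intro nn_integral_cong)
    fix p
    have "(\<integral>\<^sup>+t. ennreal (k (t - Y p)) * ennreal (exp (- s * t)) \<partial>lborel) =
        (\<integral>\<^sup>+z. ennreal (k (Y p + 1 * z - Y p)) * ennreal (exp (- s * (Y p + 1 * z))) \<partial>lborel)"
      by (subst nn_integral_real_affine[where c=1 and t="Y p"]) auto
    also have "\<dots> = (\<integral>\<^sup>+z. ennreal (exp (- s * Y p)) * (ennreal (exp (- s * z)) * ennreal (k z)) \<partial>lborel)"
      by (intro nn_integral_cong) (simp add: ennreal_mult[symmetric] k_nonneg exp_add[symmetric] algebra_simps)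
    also have "\<dots> = ennreal (exp (- s * Y p)) * (ennreal (1 / s) * Phi s)"
      by (subst nn_integral_cmult, measurable) (simp only: laplace_k[OF s])
    finally show "(\<integral>\<^sup>+t. ennreal (k (t - Y p)) * ennreal (exp (- s * t)) \<partial>lborel) = ennreal (exp (- s * Y p)) * (ennreal (1 / s) * Phi s)" .
  qed
  also have "\<dots> = ennreal (1 / f s) * (ennreal (1 / s) * Phi s)"
    by (subst nn_integral_multc, measurable) (simp only: laplace_Q[OF s])
  finally show ?thesis .
qed

lemma laplace_pos:
  assumes s: "s > 0"
  shows "(\<integral>\<^sup>+t. ennreal (exp (- s * t)) \<partial>pos) = ennreal (1 / s)"
proof -
  have "(\<integral>\<^sup>+t. ennreal (exp (- s * t)) \<partial>pos) = (\<integral>\<^sup>+t. ennreal (exp (- s * t)) * indicator {0<..} t \<partial>lborel)"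
    unfolding pos_def by (subst nn_integral_density) (auto simp: mult.commute)
  also have "\<dots> = (\<integral>\<^sup>+t. ennreal (exp (- s * t)) * indicator {0..} t \<partial>lborel)"
    by (intro nn_integral_cong_AE, use AE_lborel_singleton[of "0::real"] in eventually_elim)
       (auto split: split_indicator)
  also have "\<dots> = ennreal (0 - (- exp (- s * 0) / s))"
  proof (rule nn_integral_FTC_atLeast)
    show "((\<lambda>r. - exp (- s * r) / s) has_real_derivative exp (- s * x)) (at x)" for x
      using s by (auto intro!: derivative_eq_intros)
    show "((\<lambda>r. - exp (- s * r) / s) \<longlongrightarrow> 0) at_top"
      using s by real_asymp
  qed auto
  finally show ?thesis by simp
qed

text \<open>Both sides have the Laplace transform \<open>1 / s = b / f s + (f s - b s) / (s f s)\<close>.\<close>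
theorem renewal_identity:
  assumes [measurable]: "g \<in> borel_measurable borel"
  shows "ennreal b * (\<integral>\<^sup>+p. g (Y p) \<partial>Q) + (\<integral>\<^sup>+t. Uk t * g t \<partial>lborel) = (\<integral>\<^sup>+t. g t \<partial>pos)"
proof -
  define \<rho>1 where "\<rho>1 = distr (density Q (\<lambda>_. ennreal b)) borel Y"
  define \<rho>2 where "\<rho>2 = density lborel Uk"
  have sets: "sets \<rho>1 = sets borel" "sets \<rho>2 = sets borel" by (auto simp: \<rho>1_def \<rho>2_def)
  obtain m where m: "sets m = sets borel" "\<And>A. A \<in> sets borel \<Longrightarrow> emeasure m A = emeasure \<rho>1 A + emeasure \<rho>2 A"
    using sum_measure_exists[OF sets] by blast
  have nn1: "(\<integral>\<^sup>+t. h t \<partial>\<rho>1) = ennreal b * (\<integral>\<^sup>+p. h (Y p) \<partial>Q)"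
    if [measurable]: "h \<in> borel_measurable borel" for h
    unfolding \<rho>1_def by (subst nn_integral_distr, measurable)
      (subst nn_integral_density, auto simp: nn_integral_cmult)
  have nn2: "(\<integral>\<^sup>+t. h t \<partial>\<rho>2) = (\<integral>\<^sup>+t. Uk t * h t \<partial>lborel)"
    if [measurable]: "h \<in> borel_measurable borel" for h
    unfolding \<rho>2_def by (subst nn_integral_density) auto
  have nnm: "(\<integral>\<^sup>+t. h t \<partial>m) = ennreal b * (\<integral>\<^sup>+p. h (Y p) \<partial>Q) + (\<integral>\<^sup>+t. Uk t * h t \<partial>lborel)"
    if [measurable]: "h \<in> borel_measurable borel" for h
    using nn_integral_sum_measure[OF sets m that] nn1[OF that] nn2[OF that] by simp
  have lap: "(\<integral>\<^sup>+t. ennreal (exp (- s * t)) \<partial>m) = ennreal (1 / s)" if s: "s > 0" for s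
  proof -
    define ph where "ph = enn2real (Phi s)"
    have ph: "Phi s = ennreal ph" "ph \<ge> 0" using Phi_finite[OF s] by (auto simp: ph_def)
    have fs: "f s = b * s + ph"
      using f_eq[OF s] b s ph by (simp add: ennreal_plus[symmetric] del: ennreal_plus)
    have "(\<integral>\<^sup>+t. ennreal (exp (- s * t)) \<partial>m) = ennreal b * ennreal (1 / f s) + ennreal (1 / f s) * (ennreal (1 / s) * ennreal ph)"
      by (subst nnm, measurable) (simp only: laplace_Q[OF s] laplace_Uk[OF s] ph(1))
    also have "\<dots> = ennreal (b * (1 / f s) + 1 / f s * (1 / s * ph))"
      using b s ph(2) f_pos[OF s] ennreal_mult'[of b "1 / f s"] ennreal_mult'[of "1 / s" ph]
        ennreal_mult'[of "1 / f s" "1 / s * ph"] by (subst ennreal_plus) simp_all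
    also have "b * (1 / f s) + 1 / f s * (1 / s * ph) = (b * s + ph) / (f s * s)"
      using f_pos[OF s] s by (simp add: field_simps)
    also have "\<dots> = 1 / s" using f_pos[OF s] s unfolding fs[symmetric] by simp
    finally show ?thesis .
  qed
  have "m = pos"
  proof (rule laplace_transform_unique)
    have "emeasure m {..<0} = ennreal b * (\<integral>\<^sup>+p. indicator {..<0} (Y p) \<partial>Q) + (\<integral>\<^sup>+t. Uk t * indicator {..<0} t \<partial>lborel)"
      using nnm[of "indicator {..<0}"] m(1) by simp
    also have "(\<integral>\<^sup>+p. indicator {..<0} (Y p) \<partial>Q) = (\<integral>\<^sup>+p. 0 \<partial>Q)"
      using Y_nonneg by (intro nn_integral_cong) (auto simp: not_less split: split_indicator)
    also have "(\<integral>\<^sup>+t. Uk t * indicator {..<0} t \<partial>lborel) = (\<integral>\<^sup>+(t::real). 0 \<partial>lborel)"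
      by (intro nn_integral_cong) (auto simp: Uk_nonpos split: split_indicator)
    finally show "emeasure m {..<0} = 0" by simp
    show "emeasure pos {..<0} = 0" unfolding pos_def
      by (subst emeasure_density) (auto intro!: nn_integral_zero' split: split_indicator)
    show "(\<integral>\<^sup>+x. ennreal (exp (- s * x)) \<partial>m) = (\<integral>\<^sup>+x. ennreal (exp (- s * x)) \<partial>pos)" if "s > 0" for s
      using lap[OF that] laplace_pos[OF that] by simp
    show "(\<integral>\<^sup>+x. ennreal (exp (- x)) \<partial>m) < \<infinity>" using lap[of 1] by simp
  qed (use m in auto)
  then show ?thesis using nnm[of g] by simp
qed

lemma nn_integral_pos: "g \<in> borel_measurable borel \<Longrightarrow> (\<integral>\<^sup>+t. g t \<partial>pos) = (\<integral>\<^sup>+t\<in>{0<..}. g t \<partial>lborel)"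
  unfolding pos_def by (subst nn_integral_density) (auto simp: mult.commute)

text \<open>Dropping the drift term, the renewal identity bounds the integral of \<open>Uk\<close>
  over any Borel set by its length. This is incompatible with \<open>Uk\<close> exceeding
  \<open>1 + 1 / Suc j\<close> on a set of positive finite length.\<close>

lemma AE_Uk_le_1: "AE t in lborel. Uk t \<le> 1"
proof -
  \<comment> \<open>Restricting to \<open>{0<..<real n}\<close> makes the length of the set finite,
    so that it can be cancelled in the extended reals.\<close>
  define B where "B n j = {t \<in> {0<..<real n}. 1 + ennreal (1 / Suc j) \<le> Uk t}" for n j
  have [measurable]: "B n j \<in> sets borel" for n j unfolding B_def by measurable
  have "emeasure lborel (B n j) = 0" for n j
  proof -
    define x where "x = emeasure lborel (B n j)"
    have "x \<le> emeasure lborel {0<..<real n}" unfolding x_def by (intro emeasure_mono) (auto simp: B_def)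
    then have xfin: "x \<noteq> \<top>" by (auto simp: top_unique)
    have "(1 + ennreal (1 / Suc j)) * x = (\<integral>\<^sup>+t. (1 + ennreal (1 / Suc j)) * indicator (B n j) t \<partial>lborel)"
      by (simp add: x_def nn_integral_cmult)
    also have "\<dots> \<le> (\<integral>\<^sup>+t. Uk t * indicator (B n j) t \<partial>lborel)"
      by (intro nn_integral_mono) (auto simp: B_def split: split_indicator)
    also have "\<dots> \<le> (\<integral>\<^sup>+t. indicator (B n j) t \<partial>pos)"
      using renewal_identity[of "indicator (B n j)"] by (metis borel_measurable_indicator \<open>B n j \<in> sets borel\<close> le_add2 le_iff_add add.commute)
    also have "\<dots> \<le> x" unfolding x_def
      by (subst nn_integral_pos) (auto simp flip: nn_integral_indicator intro!: nn_integral_mono split: split_indicator)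
    finally have "x + ennreal (1 / Suc j) * x \<le> x + 0" by (simp add: distrib_right)
    then have "ennreal (1 / Suc j) * x = 0" using xfin by (subst (asm) ennreal_add_left_cancel_le) auto
    then show ?thesis by (simp add: x_def ennreal_eq_0_iff del: of_nat_Suc)
  qed
  then have "AE t in lborel. \<forall>n j. t \<notin> B n j"
    by (auto simp: AE_all_countable intro!: AE_not_in simp: null_sets_def)
  then show ?thesis
  proof eventually_elim
    case (elim t)
    show ?case
    proof (rule ccontr)
      assume "\<not> Uk t \<le> 1"
      then have gt: "1 < Uk t" by simp
      then have t: "t > 0" using Uk_nonpos[of t] by (cases "t > 0") auto
      obtain y where y: "1 < y" "y < Uk t" using dense[OF gt] by blast
      have yfin: "y \<noteq> \<top>" using y(2) by (metis not_top_less)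
      then obtain z where z: "y = ennreal z" "z \<ge> 0" by (cases y) auto
      then have "z > 1" using y(1) by (simp add: ennreal_less_iff flip: ennreal_1)
      then obtain j where "1 / Suc j < z - 1" by (metis diff_gt_0_iff_gt inverse_eq_divide reals_Archimedean)
      then have "1 + ennreal (1 / Suc j) \<le> y"
        using z by (simp add: ennreal_plus[symmetric] ennreal_le_iff flip: ennreal_1 del: ennreal_plus)
      moreover obtain n :: nat where "t < n" using reals_Archimedean2 by blast
      ultimately have "t \<in> B n j" using t y(2) by (auto simp: B_def)
      then show False using elim by blast
    qed
  qed
qed

text \<open>The tail of \<open>\<nu>\<close> is decreasing, so \<open>Uk t\<close> is at most the lower limit of \<open>Uk\<close> along
  sequences increasing to \<open>t\<close>; this turns an almost sure bound into a bound at every point.\<close>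
lemma Uk_le_1: "Uk t \<le> 1"
proof -
  \<comment> \<open>Every interval to the left of \<open>t\<close> has positive length and so meets
    the set of full measure on which the bound is known.\<close>
  have "\<exists>y. t - 1 / Suc n < y \<and> y < t \<and> Uk y \<le> 1" for n
  proof (rule ccontr)
    assume "\<not> ?thesis"
    then have *: "{t - 1 / Suc n<..<t} \<subseteq> {y. \<not> Uk y \<le> 1}" by auto
    have "AE y in lborel. y \<notin> {t - 1 / Suc n<..<t}"
      using AE_Uk_le_1 by eventually_elim (use * in blast)
    then have "emeasure lborel {t - 1 / Suc n<..<t} = 0"
      by (subst (asm) AE_iff_null_sets[symmetric]) auto
    then show False by (simp add: ennreal_eq_0_iff del: of_nat_Suc)
  qed
  then obtain y where y: "\<And>n. t - 1 / Suc n < y n" "\<And>n. y n < t" "\<And>n. Uk (y n) \<le> 1" by metis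
  have ylim: "y \<longlonglongrightarrow> t"
  proof (rule tendsto_sandwich)
    show "(\<lambda>n. t - 1 / real (Suc n)) \<longlonglongrightarrow> t" by real_asymp
  qed (use y in \<open>auto intro!: always_eventually less_imp_le\<close>)
  have "ennreal (k (t - Y p)) \<le> liminf (\<lambda>n. ennreal (k (y n - Y p)))" for p
  proof (cases "Y p < t")
    case True
    have "eventually (\<lambda>n. Y p < y n) sequentially" using order_tendstoD(1)[OF ylim True] .
    then have "eventually (\<lambda>n. ennreal (k (t - Y p)) \<le> ennreal (k (y n - Y p))) sequentially"
    proof eventually_elim
      case (elim n)
      then show ?case using y(2)[of n] levy_tail_antimono[of "y n - Y p" "t - Y p"]
        by (auto simp: k_def intro!: ennreal_leI)
    qed
    then show ?thesis by (rule Liminf_bounded)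
  qed (simp add: k_nonpos)
  then have "Uk t \<le> (\<integral>\<^sup>+p. liminf (\<lambda>n. ennreal (k (y n - Y p))) \<partial>Q)"
    unfolding Uk_def by (intro nn_integral_mono)
  also have "\<dots> \<le> liminf (\<lambda>n. Uk (y n))"
    unfolding Uk_def by (rule nn_integral_liminf) measurable
  also have "\<dots> \<le> liminf (\<lambda>n. 1)" using y(3) by (intro Liminf_mono) auto
  also have "\<dots> = 1" by (simp add: Liminf_const)
  finally show ?thesis .
qed

end

section \<open>The generalized Caputo derivative\<close>

text \<open>Intended for the integrand of the Caputo derivative: \<open>deriv\<close> is identified
  with a Borel function only almost everywhere, so its measurability is available in the
  completion.\<close>

lemma borel_measurable_completion_AE:
  assumes g: "g \<in> borel_measurable M" and ae: "AE x in M. f x = g x"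
  shows "f \<in> borel_measurable (completion M)"
proof (rule measurableI)
  fix A assume A: "A \<in> sets (borel :: 'b :: topological_space measure)"
  show "f -` A \<inter> space (completion M) \<in> sets (completion M)"
  proof (rule completion.in_sets_AE)
    show "AE x in completion M. (x \<in> g -` A \<inter> space M) = (x \<in> f -` A \<inter> space (completion M))"
      unfolding AE_completion_iff using ae by eventually_elim simp
    show "g -` A \<inter> space M \<in> sets (completion M)" using g A by (auto dest: measurable_sets)
  qed auto
qed auto

lemma deriv_quotient_bound:
  fixes g :: "real \<Rightarrow> real"
  assumes "\<And>r. (g has_real_derivative g' r) (at r)" "\<And>r. r \<ge> 0 \<Longrightarrow> \<bar>g' r\<bar> \<le> B" "0 \<le> a" "a \<le> c"
  shows "\<bar>g c - g a\<bar> \<le> B * (c - a)"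
proof (cases "a < c")
  case True
  obtain z where z: "a < z" "z < c" "g c - g a = (c - a) * g' z" using MVT2[OF True, of g g'] assms(1) by blast
  have "\<bar>g c - g a\<bar> = (c - a) * \<bar>g' z\<bar>" using z True by (simp add: abs_mult)
  also have "\<dots> \<le> (c - a) * B" using z assms(2)[of z] assms(3) True by (intro mult_left_mono) auto
  finally show ?thesis by (simp add: mult.commute)
qed (use assms in auto)

text \<open>Quotients from the left, because the shift by \<open>Z \<epsilon>\<close> produces the
  weight at level \<open>r - \<epsilon>\<close>.\<close>

lemma deriv_quotient_left_tendsto:
  fixes g :: "real \<Rightarrow> real"
  assumes "(g has_real_derivative d) (at r)"
  shows "(\<lambda>n. (g r - g (r - 1 / Suc n)) / (1 / Suc n)) \<longlonglongrightarrow> d"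
proof -
  have 0: "filterlim (\<lambda>n. - (1 / real (Suc n))) (at 0) sequentially"
    by (rule filterlim_atI) (real_asymp, auto)
  have "((\<lambda>h. (g (r + h) - g r) / h) \<longlongrightarrow> d) (at 0)" using assms by (simp add: DERIV_def)
  from filterlim_compose[OF this 0]
  have "(\<lambda>n. (g (r + - (1 / Suc n)) - g r) / - (1 / Suc n)) \<longlonglongrightarrow> d" .
  moreover have "(g (r + - e) - g r) / - e = (g r - g (r - e)) / e" for e
    using minus_divide_divide[of "g r - g (r - e)" e] by simp
  ultimately show ?thesis by (simp only:)
qed

context bernstein_function
begin

text \<open>The reflection \<open>s = t - x\<close> preserves null sets, so \<open>w (t - s)\<close>
  may replace the derivative under the integral, and the Lebesgue integral becomes a Borel one. At
  \<open>t\<close> itself the almost everywhere statement is silent; for \<open>b \<noteq> 0\<close>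
  the local term therefore has its own hypothesis.\<close>

lemma caputo_eval:
  assumes t: "t > 0" and [measurable]: "w \<in> borel_measurable borel"
    and ae: "AE x in lborel. x \<in> {0<..<t} \<longrightarrow> (u has_real_derivative w x) (at x)"
    and at: "b \<noteq> 0 \<Longrightarrow> (u has_real_derivative c) (at t)"
    and int: "integrable lborel (\<lambda>s. indicator {0<..<t} s * (w (t - s) * k s))"
  shows "caputo_djrbashian_exists b \<nu> u t"
    and "caputo_djrbashian b \<nu> u t = b * c + (LINT s|lborel. indicator {0<..<t} s * (w (t - s) * k s))"
proof -
  obtain N where N: "N \<in> null_sets lborel" "\<And>x. x \<notin> N \<Longrightarrow> x \<in> {0<..<t} \<Longrightarrow> (u has_real_derivative w x) (at x)"
    using AE_E3[OF ae] by auto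
  have "AE x in lborel. x \<notin> N" using N(1) by (rule AE_not_in)
  moreover have "N \<in> sets borel" using N(1) by auto
  ultimately have "AE s in lborel. t + (-1) * s \<notin> N" by (intro AE_borel_affine) auto
  then have D: "AE s in lborel. s \<in> {0<..<t} \<longrightarrow> ((\<lambda>\<tau>. u (\<tau> - s)) has_real_derivative w (t - s)) (at t)"
  proof eventually_elim
    case (elim s)
    show ?case
    proof
      assume "s \<in> {0<..<t}"
      then have "(u has_real_derivative w (t + - s)) (at (t + - s))" using N(2)[of "t - s"] elim by simp
      then show "((\<lambda>\<tau>. u (\<tau> - s)) has_real_derivative w (t - s)) (at t)"
        unfolding DERIV_shift by simp
    qed
  qed
  then have eq: "AE s in lborel. indicator {0<..<t} s * (deriv (\<lambda>\<tau>. u (\<tau> - s)) t * levy_tail \<nu> s) =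
      indicator {0<..<t} s * (w (t - s) * k s)"
    by eventually_elim (auto simp: k_def DERIV_imp_deriv split: split_indicator)
  have m: "(\<lambda>s. indicator {0<..<t} s * (deriv (\<lambda>\<tau>. u (\<tau> - s)) t * levy_tail \<nu> s)) \<in> borel_measurable lebesgue"
    by (rule borel_measurable_completion_AE[OF _ eq]) measurable
  have m2: "(\<lambda>s. indicator {0<..<t} s * (w (t - s) * k s)) \<in> borel_measurable lebesgue"
    by (intro measurable_completion) measurable
  have int_leb: "integrable lebesgue (\<lambda>s. indicator {0<..<t} s * (w (t - s) * k s))"
    using int by (subst integrable_completion) auto
  have eq': "AE s in lebesgue. indicator {0<..<t} s * (deriv (\<lambda>\<tau>. u (\<tau> - s)) t * levy_tail \<nu> s) =
      indicator {0<..<t} s * (w (t - s) * k s)"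
    using eq by (simp add: AE_completion_iff)
  have si: "integrable lebesgue (\<lambda>s. indicator {0<..<t} s * (deriv (\<lambda>\<tau>. u (\<tau> - s)) t * levy_tail \<nu> s))"
    using integrable_cong_AE[OF m m2 eq'] int_leb by simp
  have D': "AE s in lebesgue. s \<in> {0<..<t} \<longrightarrow> (\<lambda>\<tau>. u (\<tau> - s)) differentiable at t"
    unfolding AE_completion_iff using D by eventually_elim (auto simp: real_differentiable_def)
  show "caputo_djrbashian_exists b \<nu> u t"
    unfolding caputo_djrbashian_exists_def set_integrable_def real_scaleR_def
    using at si D' by (auto simp: real_differentiable_def)
  have "(LINT s:{0<..<t}|lebesgue. deriv (\<lambda>\<tau>. u (\<tau> - s)) t * levy_tail \<nu> s) =
      (LINT s|lebesgue. indicator {0<..<t} s * (w (t - s) * k s))"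
    unfolding set_lebesgue_integral_def real_scaleR_def by (rule integral_cong_AE[OF m m2 eq'])
  also have "\<dots> = (LINT s|lborel. indicator {0<..<t} s * (w (t - s) * k s))"
    by (rule integral_completion) measurable
  finally show "caputo_djrbashian b \<nu> u t = b * c + (LINT s|lborel. indicator {0<..<t} s * (w (t - s) * k s))"
    unfolding caputo_djrbashian_def using at DERIV_imp_deriv by (cases "b = 0") auto
qed

end

section \<open>Potentials weighted by the level and the driftless case\<close>

context subordinator_marginals
begin

lemma integrable_Q_le:
  fixes h g :: "real \<Rightarrow> real"
  assumes [measurable]: "h \<in> borel_measurable borel" and h: "\<And>r. r > 0 \<Longrightarrow> \<bar>h r\<bar> \<le> B"
    and [measurable]: "g \<in> borel_measurable borel" and g: "\<And>y. y \<ge> 0 \<Longrightarrow> \<bar>g y\<bar> \<le> C" "\<And>y. y > t \<Longrightarrow> g y = 0"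
  shows "integrable Q (\<lambda>p. h (fst p) * g (Y p))"
proof (rule Bochner_Integration.integrable_bound)
  have "integrable Q (\<lambda>p. indicator {..t} (Y p) :: real)"
    using potential_finite[of t] by (intro integrableI_bounded) (auto simp: ennreal_indicator)
  then show "integrable Q (\<lambda>p. B * C * indicator {..t} (Y p))" by simp
  show "AE p in Q. norm (h (fst p) * g (Y p)) \<le> norm (B * C * indicator {..t} (Y p))"
    using AE_Q_pos
  proof eventually_elim
    case (elim p)
    have "\<bar>h (fst p)\<bar> * \<bar>g (Y p)\<bar> \<le> B * C"
      using h[OF elim] g(1)[OF Y_nonneg, of p] by (intro mult_mono) (auto intro: order_trans[OF abs_ge_zero])
    then have "\<bar>h (fst p)\<bar> * \<bar>g (Y p)\<bar> \<le> \<bar>B * C\<bar>" by linarith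
    then show ?case using g(2)[of "Y p"] by (auto simp: abs_mult split: split_indicator)
  qed
qed measurable

lemma integrable_Q_k:
  assumes [measurable]: "h \<in> borel_measurable borel" and h: "\<And>r. r > 0 \<Longrightarrow> \<bar>h r\<bar> \<le> B"
  shows "integrable Q (\<lambda>p. h (fst p) * k (x - Y p))"
proof (rule Bochner_Integration.integrable_bound)
  have "integrable Q (\<lambda>p. k (x - Y p))"
    using Uk_le_1[of x] unfolding Uk_def
    by (intro integrableI_bounded) (auto simp: k_nonneg intro: le_less_trans)
  then show "integrable Q (\<lambda>p. B * k (x - Y p))" by simp
  show "AE p in Q. norm (h (fst p) * k (x - Y p)) \<le> norm (B * k (x - Y p))"
    using AE_Q_pos
  proof eventually_elim
    case (elim p)
    have "\<bar>h (fst p)\<bar> * k (x - Y p) \<le> \<bar>B\<bar> * k (x - Y p)"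
      using h[OF elim] by (intro mult_right_mono k_nonneg) auto
    then show ?case by (auto simp: abs_mult k_nonneg)
  qed
qed measurable

definition Ukr :: "real \<Rightarrow> real" where "Ukr x = enn2real (Uk x)"

lemma Ukr_measurable[measurable]: "Ukr \<in> borel_measurable borel" unfolding Ukr_def by measurable

lemma Ukr_bounds: "0 \<le> Ukr x" "Ukr x \<le> 1" "x \<le> 0 \<Longrightarrow> Ukr x = 0" and ennreal_Ukr: "ennreal (Ukr x) = Uk x"
proof -
  show "ennreal (Ukr x) = Uk x" unfolding Ukr_def using Uk_le_1[of x]
    by (intro ennreal_enn2real) (auto simp: less_top[symmetric] top_unique)
  show "Ukr x \<le> 1" unfolding Ukr_def using Uk_le_1[of x] by (metis enn2real_leI ennreal_1 zero_le_one)
qed (auto simp: Ukr_def Uk_nonpos)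

text \<open>Hypothesis \<open>gV\<close> presents \<open>V\<close> as a convolution of
  \<open>g\<close> with the potential measure; by \<open>nn_integral_Q_add\<close> that convolution
  is exchanged for a primitive of the weight. The pair (\<open>g\<close>, \<open>V\<close>) will be
  the reflected kernel with \<open>Ukr\<close>, and with drift an indicator with the distribution
  function of the potential.\<close>

lemma integral_Q_primitive_nonneg:
  fixes \<phi> \<psi> g V :: "real \<Rightarrow> real"
  assumes \<psi>: "\<And>r. (\<psi> has_real_derivative \<phi> r) (at r)" and [measurable]: "\<phi> \<in> borel_measurable borel"
    and \<phi>: "\<And>r. r \<ge> 0 \<Longrightarrow> 0 \<le> \<phi> r" "\<And>r. r \<ge> 0 \<Longrightarrow> \<phi> r \<le> B"
    and [measurable]: "g \<in> borel_measurable borel" "V \<in> borel_measurable borel"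
    and g: "\<And>y. 0 \<le> g y" and V: "\<And>y. 0 \<le> V y" "\<And>y. y \<ge> 0 \<Longrightarrow> V y \<le> C" "\<And>y. y > x \<Longrightarrow> V y = 0"
    and gV: "\<And>y. (\<integral>\<^sup>+p. ennreal (g (y + Y p)) \<partial>Q) = ennreal (V y)"
  shows "integrable Q (\<lambda>p. \<phi> (fst p) * V (Y p))" "integrable Q (\<lambda>p. (\<psi> (fst p) - \<psi> 0) * g (Y p))"
    "(LINT p|Q. \<phi> (fst p) * V (Y p)) = (LINT p|Q. (\<psi> (fst p) - \<psi> 0) * g (Y p))"
proof -
  have [measurable]: "\<psi> \<in> borel_measurable borel"
    using \<psi> by (auto intro!: borel_measurable_continuous_onI continuous_at_imp_continuous_on DERIV_isCont)
  show i1: "integrable Q (\<lambda>p. \<phi> (fst p) * V (Y p))"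
    using \<phi> V by (intro integrable_Q_le[where B=B and C=C and t=x]) auto
  have \<psi>_mono: "0 \<le> \<psi> r - \<psi> 0" if "r \<ge> 0" for r
    using DERIV_nonneg_imp_nondecreasing[OF that, of \<psi>] \<psi> \<phi>(1) by auto
  have "(\<integral>\<^sup>+p. ennreal (\<phi> (fst p) * V (Y p)) \<partial>Q) = (\<integral>\<^sup>+p. ennreal (\<phi> (fst p)) * (\<integral>\<^sup>+p'. ennreal (g (Y p + Y p')) \<partial>Q) \<partial>Q)"
  proof (rule nn_integral_cong_AE)
    show "AE p in Q. ennreal (\<phi> (fst p) * V (Y p)) = ennreal (\<phi> (fst p)) * (\<integral>\<^sup>+p'. ennreal (g (Y p + Y p')) \<partial>Q)"
      using AE_Q_pos by eventually_elim (simp add: ennreal_mult \<phi> V gV)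
  qed
  also have "\<dots> = (\<integral>\<^sup>+p. (\<integral>\<^sup>+r. ennreal (\<phi> r) * indicator {0<..<fst p} r \<partial>lborel) * ennreal (g (Y p)) \<partial>Q)"
    by (rule nn_integral_Q_add) measurable
  also have "\<dots> = (\<integral>\<^sup>+p. ennreal ((\<psi> (fst p) - \<psi> 0) * g (Y p)) \<partial>Q)"
  proof (rule nn_integral_cong_AE)
    show "AE p in Q. (\<integral>\<^sup>+r. ennreal (\<phi> r) * indicator {0<..<fst p} r \<partial>lborel) * ennreal (g (Y p)) =
        ennreal ((\<psi> (fst p) - \<psi> 0) * g (Y p))"
      using AE_Q_pos
    proof eventually_elim
      case (elim p)
      have "(\<integral>\<^sup>+r. ennreal (\<phi> r) * indicator {0<..<fst p} r \<partial>lborel) = (\<integral>\<^sup>+r. ennreal (\<phi> r) * indicator {0..fst p} r \<partial>lborel)"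
        by (intro nn_integral_cong_AE, use AE_lborel_singleton[of "0::real"] AE_lborel_singleton[of "fst p"] in eventually_elim)
           (auto split: split_indicator)
      also have "\<dots> = ennreal (\<psi> (fst p) - \<psi> 0)"
        using elim \<psi> \<phi> by (intro nn_integral_FTC_Icc) auto
      finally show ?case using elim \<psi>_mono by (simp add: ennreal_mult g)
    qed
  qed
  finally have eq: "(\<integral>\<^sup>+p. ennreal (\<phi> (fst p) * V (Y p)) \<partial>Q) = (\<integral>\<^sup>+p. ennreal ((\<psi> (fst p) - \<psi> 0) * g (Y p)) \<partial>Q)" .
  have nn: "AE p in Q. 0 \<le> \<phi> (fst p) * V (Y p)" "AE p in Q. 0 \<le> (\<psi> (fst p) - \<psi> 0) * g (Y p)"
    using AE_Q_pos by (eventually_elim, intro mult_nonneg_nonneg \<phi> \<psi>_mono V g, simp)+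
  show i2: "integrable Q (\<lambda>p. (\<psi> (fst p) - \<psi> 0) * g (Y p))"
  proof (rule integrableI_nonneg)
    have "(\<integral>\<^sup>+p. ennreal (\<phi> (fst p) * V (Y p)) \<partial>Q) < \<infinity>"
      using nn_integral_eq_integral[OF i1 nn(1)] by simp
    then show "(\<integral>\<^sup>+p. ennreal ((\<psi> (fst p) - \<psi> 0) * g (Y p)) \<partial>Q) < \<infinity>" using eq by simp
  qed (use nn in auto)
  show "(LINT p|Q. \<phi> (fst p) * V (Y p)) = (LINT p|Q. (\<psi> (fst p) - \<psi> 0) * g (Y p))"
    using eq by (subst (1 2) integral_eq_nn_integral) (use nn in auto)
qed

text \<open>A signed weight is made nonnegative by adding its bound \<open>B\<close>, which adds
  \<open>B * r\<close> to the primitive. Subtracting the same identity for the constant weight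
  \<open>B\<close> removes the correction.\<close>

lemma integral_Q_primitive:
  fixes \<phi> \<psi> g V :: "real \<Rightarrow> real"
  assumes \<psi>: "\<And>r. (\<psi> has_real_derivative \<phi> r) (at r)" and [measurable]: "\<phi> \<in> borel_measurable borel"
    and \<phi>: "\<And>r. r \<ge> 0 \<Longrightarrow> \<bar>\<phi> r\<bar> \<le> B"
    and g: "g \<in> borel_measurable borel" "V \<in> borel_measurable borel" "\<And>y. 0 \<le> g y"
      "\<And>y. 0 \<le> V y" "\<And>y. y \<ge> 0 \<Longrightarrow> V y \<le> C" "\<And>y. y > x \<Longrightarrow> V y = 0"
      "\<And>y. (\<integral>\<^sup>+p. ennreal (g (y + Y p)) \<partial>Q) = ennreal (V y)"
  shows "(LINT p|Q. \<phi> (fst p) * V (Y p)) = (LINT p|Q. (\<psi> (fst p) - \<psi> 0) * g (Y p))"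
proof -
  have B: "B \<ge> 0" using \<phi>[of 0] by simp
  have 1: "((\<lambda>r. \<psi> r + B * r) has_real_derivative \<phi> r + B) (at r)" for r
    using \<psi>[of r] by (auto intro!: derivative_eq_intros)
  have 2: "((\<lambda>r. B * r) has_real_derivative B) (at r)" for r
    by (auto intro!: derivative_eq_intros)
  have "\<phi> r + B \<ge> 0" "\<phi> r + B \<le> 2 * B" if "r \<ge> 0" for r using \<phi>[OF that] by auto
  note p = integral_Q_primitive_nonneg[of "\<lambda>r. \<psi> r + B * r" "\<lambda>r. \<phi> r + B", OF 1 _ this g, simplified]
    and q = integral_Q_primitive_nonneg[of "\<lambda>r. B * r" "\<lambda>r. B", OF 2 _ B order_refl g, simplified]
  have "(LINT p|Q. \<phi> (fst p) * V (Y p)) = (LINT p|Q. (\<phi> (fst p) + B) * V (Y p) - B * V (Y p))"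
    by (simp add: algebra_simps)
  also have "\<dots> = (LINT p|Q. (\<phi> (fst p) + B) * V (Y p)) - (LINT p|Q. B * V (Y p))"
    by (intro Bochner_Integration.integral_diff) (use p(1) q(1) in simp_all)
  also have "\<dots> = (LINT p|Q. (\<psi> (fst p) + B * fst p - \<psi> 0) * g (Y p)) - (LINT p|Q. B * fst p * g (Y p))"
    using p(3) q(3) by simp
  also have "\<dots> = (LINT p|Q. (\<psi> (fst p) + B * fst p - \<psi> 0) * g (Y p) - B * fst p * g (Y p))"
    by (intro Bochner_Integration.integral_diff[symmetric]) (use p(2) q(2) in simp_all)
  also have "\<dots> = (LINT p|Q. (\<psi> (fst p) - \<psi> 0) * g (Y p))"
    by (simp add: algebra_simps)
  finally show ?thesis .
qed

lemma integral_Q_Ukr: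
  assumes \<psi>: "\<And>r. (\<psi> has_real_derivative \<phi> r) (at r)" and \<phi>: "\<phi> \<in> borel_measurable borel" "\<And>r. r \<ge> 0 \<Longrightarrow> \<bar>\<phi> r\<bar> \<le> B"
  shows "(LINT p|Q. \<phi> (fst p) * Ukr (x - Y p)) = (LINT p|Q. (\<psi> (fst p) - \<psi> 0) * k (x - Y p))"
  by (rule integral_Q_primitive[OF \<psi> \<phi>, of "\<lambda>y. k (x - y)" "\<lambda>y. Ukr (x - y)" 1 x])
     (auto simp: k_nonneg Ukr_bounds ennreal_Ukr Uk_def diff_diff_eq)

text \<open>Without the drift term the renewal identity equates two densities of one measure, and
  densities are unique almost everywhere only.\<close>

lemma AE_Ukr_driftless:
  assumes "b = 0"
  shows "AE x in lborel. Ukr x = indicator {0<..} x"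
proof -
  have "density lborel Uk = density lborel (indicator {0<..})"
  proof (rule measure_eqI)
    fix A assume "A \<in> sets (density lborel Uk)"
    then have [measurable]: "A \<in> sets borel" by simp
    have "emeasure (density lborel Uk) A = (\<integral>\<^sup>+t. Uk t * indicator A t \<partial>lborel)"
      by (subst emeasure_density) auto
    also have "\<dots> = (\<integral>\<^sup>+t. indicator A t \<partial>pos)"
      using renewal_identity[of "indicator A"] assms by simp
    also have "\<dots> = emeasure (density lborel (indicator {0<..})) A"
      by (simp add: pos_def)
    finally show "emeasure (density lborel Uk) A = emeasure (density lborel (indicator {0<..})) A" .
  qed simp
  then have "AE x in lborel. Uk x = indicator {0<..} x"
    by (subst (asm) sigma_finite_measure.density_unique_iff[OF sigma_finite_lborel]) auto
  then show ?thesis by eventually_elim (auto simp: Ukr_def split: split_indicator)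
qed

text \<open>At levels near 0 the position is below \<open>t\<close> with probability close to 1, so
  the average of the weight over the levels in \<open>(0, 1 / Suc n]\<close> approaches its value at
  0. This is the origin of the boundary term \<open>\<phi> 0\<close>.\<close>

lemma integral_Q_near_0:
  assumes [measurable]: "\<phi> \<in> borel_measurable borel" and \<phi>: "isCont \<phi> 0" "\<And>r. r \<ge> 0 \<Longrightarrow> \<bar>\<phi> r\<bar> \<le> B" and t: "t > 0"
  shows "(\<lambda>n. (LINT p|Q. indicator {0<..1 / Suc n} (fst p) * \<phi> (fst p) * indicator {..t} (Y p)) / (1 / Suc n)) \<longlonglongrightarrow> \<phi> 0"
proof (rule LIMSEQ_I)
  fix e :: real assume e: "e > 0"
  have B0: "0 \<le> B" using \<phi>(2)[of 0] by simp
  define q where "q r = \<phi> r * prob {\<omega> \<in> space M. Z r \<omega> \<le> t}" for r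
  have [measurable]: "q \<in> borel_measurable borel"
  proof -
    have "(\<lambda>r. prob {\<omega> \<in> space M. Z r \<omega> \<le> t}) = (\<lambda>r. LINT \<omega>|M. indicator {..t} (Z r \<omega>))"
    proof
      fix r
      have "prob {\<omega> \<in> space M. Z r \<omega> \<le> t} = (LINT \<omega>|M. indicator {\<omega> \<in> space M. Z r \<omega> \<le> t} \<omega>)" by simp
      also have "\<dots> = (LINT \<omega>|M. indicator {..t} (Z r \<omega>))"
        by (intro Bochner_Integration.integral_cong) (auto split: split_indicator)
      finally show "prob {\<omega> \<in> space M. Z r \<omega> \<le> t} = (LINT \<omega>|M. indicator {..t} (Z r \<omega>))" .
    qed
    moreover have "(\<lambda>r. LINT \<omega>|M. indicator {..t} (Z r \<omega>) :: real) \<in> borel_measurable borel" by measurable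
    ultimately show ?thesis unfolding q_def[abs_def] by simp
  qed
  have "(\<phi> \<longlongrightarrow> \<phi> 0) (at_right 0)"
    using \<phi>(1) by (auto simp: isCont_def intro: tendsto_within_subset)
  then have "(q \<longlongrightarrow> \<phi> 0 * 1) (at_right 0)"
    unfolding q_def[abs_def] by (intro tendsto_mult prob_Z_le_near_0 t)
  then have "eventually (\<lambda>r. dist (q r) (\<phi> 0) < e / 2) (at_right 0)"
    using e by (intro tendstoD) auto
  then obtain d where d: "d > 0" "\<And>r. 0 < r \<Longrightarrow> r < d \<Longrightarrow> \<bar>q r - \<phi> 0\<bar> < e / 2"
    unfolding eventually_at_right_field by (auto simp: dist_real_def)
  obtain N :: nat where N: "1 / d < N" using reals_Archimedean2 by blast
  have "\<bar>(LINT p|Q. indicator {0<..1 / Suc n} (fst p) * \<phi> (fst p) * indicator {..t} (Y p)) / (1 / Suc n) - \<phi> 0\<bar> < e"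
    if n: "n \<ge> N" for n
  proof -
    define \<epsilon> where "\<epsilon> = 1 / real (Suc n)"
    have \<epsilon>: "\<epsilon> > 0" by (simp add: \<epsilon>_def)
    have "1 / d < real (Suc n)" using N n by linarith
    then have \<epsilon>d: "\<epsilon> < d" using d(1) by (simp add: \<epsilon>_def field_simps)
    have "integrable Q (\<lambda>p. (indicator {0<..\<epsilon>} (fst p) * \<phi> (fst p)) * indicator {..t} (Y p))"
      using \<phi>(2) B0 by (intro integrable_Q_le[where B=B and C=1 and t=t]) (auto simp: abs_mult indicator_def)
    then have i: "integrable (pos \<Otimes>\<^sub>M M) (\<lambda>p. (indicator {0<..\<epsilon>} (fst p) * \<phi> (fst p)) * indicator {..t} (Y p))"
      by (simp add: Q_def)
    have "(LINT p|Q. indicator {0<..\<epsilon>} (fst p) * \<phi> (fst p) * indicator {..t} (Y p)) =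
        (LINT r|pos. LINT \<omega>|M. indicator {0<..\<epsilon>} r * \<phi> r * indicator {..t} (Z r \<omega>))"
      unfolding Q_def using posM.integral_fst'[OF i] by (simp add: Y_def)
    also have "\<dots> = (LINT r|pos. indicator {0<..\<epsilon>} r * q r)"
    proof (intro Bochner_Integration.integral_cong refl)
      fix r
      have "(LINT \<omega>|M. indicator {..t} (Z r \<omega>)) = (LINT \<omega>|M. indicator {\<omega> \<in> space M. Z r \<omega> \<le> t} \<omega> :: real)"
        by (intro Bochner_Integration.integral_cong) (auto split: split_indicator)
      then show "(LINT \<omega>|M. indicator {0<..\<epsilon>} r * \<phi> r * indicator {..t} (Z r \<omega>)) = indicator {0<..\<epsilon>} r * q r"
        by (simp add: q_def)
    qed
    also have "\<dots> = (LINT r|lborel. indicator {0<..} r * (indicator {0<..\<epsilon>} r * q r))"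
      using integral_density[of "\<lambda>r. indicator {0<..\<epsilon>} r * q r" lborel "indicator {0<..}"]
      by (simp add: pos_def ennreal_indicator)
    also have "\<dots> = (LINT r|lborel. indicator {0<..\<epsilon>} r * q r)"
      by (intro Bochner_Integration.integral_cong) (auto split: split_indicator)
    finally have I: "(LINT p|Q. indicator {0<..\<epsilon>} (fst p) * \<phi> (fst p) * indicator {..t} (Y p)) = (LINT r|lborel. indicator {0<..\<epsilon>} r * q r)" .
    have qb: "\<bar>q r\<bar> \<le> B" if "r \<ge> 0" for r
    proof -
      have "\<bar>q r\<bar> = \<bar>\<phi> r\<bar> * prob {\<omega> \<in> space M. Z r \<omega> \<le> t}" by (simp add: q_def abs_mult)
      also have "\<dots> \<le> \<bar>\<phi> r\<bar> * 1" by (intro mult_left_mono) auto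
      finally show ?thesis using \<phi>(2)[OF that] by simp
    qed
    have ind: "integrable lborel (\<lambda>r. indicator {0<..\<epsilon>} r * c)" for c :: real
      using \<epsilon> by (intro integrable_mult_left integrable_real_indicator) auto
    have iq: "integrable lborel (\<lambda>r. indicator {0<..\<epsilon>} r * q r)"
    proof (rule Bochner_Integration.integrable_bound[OF ind[of B]])
      show "AE r in lborel. norm (indicator {0<..\<epsilon>} r * q r) \<le> norm (indicator {0<..\<epsilon>} r * B)"
      proof (rule AE_I2)
        fix r show "norm (indicator {0<..\<epsilon>} r * q r) \<le> norm (indicator {0<..\<epsilon>} r * B)"
          using qb[of r] by (cases "r \<in> {0<..\<epsilon>}") auto
      qed
    qed measurable
    have "(LINT r|lborel. indicator {0<..\<epsilon>} r * q r) - \<epsilon> * \<phi> 0 = (LINT r|lborel. indicator {0<..\<epsilon>} r * q r - indicator {0<..\<epsilon>} r * \<phi> 0)"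
      using \<epsilon> by (subst Bochner_Integration.integral_diff[OF iq ind]) simp
    also have "\<bar>\<dots>\<bar> \<le> (LINT r|lborel. indicator {0<..\<epsilon>} r * (e / 2))"
    proof (rule integral_abs_bound[THEN order_trans], rule integral_mono[OF _ ind])
      show "integrable lborel (\<lambda>r. \<bar>indicator {0<..\<epsilon>} r * q r - indicator {0<..\<epsilon>} r * \<phi> 0\<bar>)"
        by (intro integrable_abs Bochner_Integration.integrable_diff iq ind)
      fix r show "\<bar>indicator {0<..\<epsilon>} r * q r - indicator {0<..\<epsilon>} r * \<phi> 0\<bar> \<le> indicator {0<..\<epsilon>} r * (e / 2)"
        using d(2)[of r] \<epsilon>d by (cases "r \<in> {0<..\<epsilon>}") auto
    qed
    also have "\<dots> = \<epsilon> * (e / 2)" using \<epsilon> by simp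
    also have "\<dots> < \<epsilon> * e" using \<epsilon> e by simp
    finally have "\<bar>(LINT r|lborel. indicator {0<..\<epsilon>} r * q r) - \<epsilon> * \<phi> 0\<bar> < \<epsilon> * e" .
    moreover have "(LINT r|lborel. indicator {0<..\<epsilon>} r * q r) / \<epsilon> - \<phi> 0 = ((LINT r|lborel. indicator {0<..\<epsilon>} r * q r) - \<epsilon> * \<phi> 0) / \<epsilon>"
      using \<epsilon> by (simp add: field_simps)
    ultimately have "\<bar>(LINT r|lborel. indicator {0<..\<epsilon>} r * q r) / \<epsilon> - \<phi> 0\<bar> < e"
      using \<epsilon> by (simp add: pos_divide_less_eq mult.commute)
    then show ?thesis using I unfolding \<epsilon>_def[symmetric] by simp
  qed
  then show "\<exists>n0. \<forall>n\<ge>n0. norm ((LINT p|Q. indicator {0<..1 / Suc n} (fst p) * \<phi> (fst p) * indicator {..t} (Y p)) / (1 / Suc n) - \<phi> 0) < e"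
    by (intro exI[of _ N]) simp
qed

text \<open>Differentiating the identity \<open>star\<close> along the semigroup: both sides are shifted by an
  independent copy of \<open>Z \<epsilon>\<close>, subtracted, and divided by \<open>\<epsilon>\<close>.\<close>
lemma integral_Q_k_from_primitive:
  assumes \<psi>: "\<And>r. (\<psi> has_real_derivative \<phi> r) (at r)" and \<phi>: "\<And>r. (\<phi> has_real_derivative \<theta> r) (at r)"
    and [measurable]: "\<theta> \<in> borel_measurable borel"
    and B: "\<And>r. r \<ge> 0 \<Longrightarrow> \<bar>\<psi> r\<bar> \<le> B" "\<And>r. r \<ge> 0 \<Longrightarrow> \<bar>\<phi> r\<bar> \<le> B" "\<And>r. r \<ge> 0 \<Longrightarrow> \<bar>\<theta> r\<bar> \<le> B"
    and t: "t > 0"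
    and star: "\<And>x. x \<le> t \<Longrightarrow> (LINT p|Q. \<phi> (fst p) * indicator {..x} (Y p)) = (LINT p|Q. (\<psi> (fst p) - \<psi> 0) * k (x - Y p))"
  shows "(LINT p|Q. \<phi> (fst p) * k (t - Y p)) = \<phi> 0 + (LINT p|Q. \<theta> (fst p) * indicator {..t} (Y p))"
proof -
  have B0: "0 \<le> B" using B(1)[of 0] by simp
  have cont: "isCont \<psi> r" "isCont \<phi> r" for r using \<psi> \<phi> DERIV_isCont by blast+
  then have [measurable]: "\<psi> \<in> borel_measurable borel" "\<phi> \<in> borel_measurable borel"
    by (auto intro!: borel_measurable_continuous_onI continuous_at_imp_continuous_on)
  define \<Phi> where "\<Phi> r = \<psi> r - \<psi> 0" for r
  have [measurable]: "\<Phi> \<in> borel_measurable borel" unfolding \<Phi>_def by measurable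
  have \<Phi>: "\<bar>\<Phi> r\<bar> \<le> 2 * B" if "r \<ge> 0" for r using B(1)[OF that] B(1)[of 0] by (simp add: \<Phi>_def)
  \<comment> \<open>The difference quotient of a weight extended by 0 to nonpositive levels. Since
    \<open>\<Phi> 0 = 0\<close>, this extension of \<open>\<Phi>\<close> is Lipschitz and its
    quotients stay bounded by \<open>B\<close>; the extension of \<open>\<phi>\<close> may jump at
    level 0.\<close>
  define dq where "dq g \<epsilon> r = (g r - indicator {\<epsilon><..} r * g (r - \<epsilon>)) / \<epsilon>" for g :: "real \<Rightarrow> real" and \<epsilon> r
  have iq1: "integrable Q (\<lambda>p. \<phi> (fst p) * indicator {..t} (Y p))"
    using B(2) by (intro integrable_Q_le[where B=B and C=1 and t=t]) (auto simp: indicator_def)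
  have iq1': "integrable Q (\<lambda>p. indicator {\<epsilon><..} (fst p) * \<phi> (fst p - \<epsilon>) * indicator {..t} (Y p))" for \<epsilon>
    using B0 B(2) by (intro integrable_Q_le[where B=B and C=1 and t=t]) (auto simp: indicator_def)
  have iq2: "integrable Q (\<lambda>p. \<Phi> (fst p) * k (t - Y p))"
    using \<Phi> by (intro integrable_Q_k[where B="2 * B"]) auto
  have iq2': "integrable Q (\<lambda>p. indicator {\<epsilon><..} (fst p) * \<Phi> (fst p - \<epsilon>) * k (t - Y p))" for \<epsilon>
    using B0 \<Phi> by (intro integrable_Q_k[where B="2 * B"]) (auto simp: indicator_def)
  have eq: "(LINT p|Q. dq \<phi> \<epsilon> (fst p) * indicator {..t} (Y p)) = (LINT p|Q. dq \<Phi> \<epsilon> (fst p) * k (t - Y p))"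
    if \<epsilon>: "\<epsilon> > 0" for \<epsilon>
  proof -
    have "(LINT p|Q. indicator {\<epsilon><..} (fst p) * \<phi> (fst p - \<epsilon>) * indicator {..t} (Y p)) =
        (LINT \<omega>|M. (LINT p|Q. \<phi> (fst p) * indicator {..t} (Y p + Z \<epsilon> \<omega>)))"
      using integral_Q_shift[OF \<epsilon>, of "\<lambda>z. \<phi> (fst z) * indicator {..t} (snd z)"] iq1'[of \<epsilon>]
      by (simp add: mult.assoc)
    also have "\<dots> = (LINT \<omega>|M. (LINT p|Q. \<phi> (fst p) * indicator {..t - Z \<epsilon> \<omega>} (Y p)))"
      by (intro Bochner_Integration.integral_cong refl) (auto simp: indicator_def le_diff_eq)
    \<comment> \<open>Here \<open>star\<close> is used at the random point
      \<open>t - Z \<epsilon> \<omega>\<close>, which can lie anywhere below \<open>t\<close> and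
      can be negative.\<close>
    also have "\<dots> = (LINT \<omega>|M. (LINT p|Q. \<Phi> (fst p) * k (t - Z \<epsilon> \<omega> - Y p)))"
      unfolding \<Phi>_def using Z_nonneg by (intro Bochner_Integration.integral_cong refl star) (simp add: diff_le_eq)
    also have "\<dots> = (LINT \<omega>|M. (LINT p|Q. \<Phi> (fst p) * k (t - (Y p + Z \<epsilon> \<omega>))))"
      by (simp add: algebra_simps)
    also have "\<dots> = (LINT p|Q. indicator {\<epsilon><..} (fst p) * \<Phi> (fst p - \<epsilon>) * k (t - Y p))"
      using integral_Q_shift[OF \<epsilon>, of "\<lambda>z. \<Phi> (fst z) * k (t - snd z)"] iq2'[of \<epsilon>]
      by (simp add: mult.assoc)
    finally have shifted: "(LINT p|Q. indicator {\<epsilon><..} (fst p) * \<phi> (fst p - \<epsilon>) * indicator {..t} (Y p)) =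
        (LINT p|Q. indicator {\<epsilon><..} (fst p) * \<Phi> (fst p - \<epsilon>) * k (t - Y p))" .
    have "(LINT p|Q. dq \<phi> \<epsilon> (fst p) * indicator {..t} (Y p)) =
        (LINT p|Q. (\<phi> (fst p) * indicator {..t} (Y p) - indicator {\<epsilon><..} (fst p) * \<phi> (fst p - \<epsilon>) * indicator {..t} (Y p)) / \<epsilon>)"
      by (intro Bochner_Integration.integral_cong refl) (simp add: dq_def field_simps)
    also have "\<dots> = ((LINT p|Q. \<phi> (fst p) * indicator {..t} (Y p)) - (LINT p|Q. indicator {\<epsilon><..} (fst p) * \<phi> (fst p - \<epsilon>) * indicator {..t} (Y p))) / \<epsilon>"
      by (simp add: Bochner_Integration.integral_diff[OF iq1 iq1'])
    also have "\<dots> = ((LINT p|Q. \<Phi> (fst p) * k (t - Y p)) - (LINT p|Q. indicator {\<epsilon><..} (fst p) * \<Phi> (fst p - \<epsilon>) * k (t - Y p))) / \<epsilon>"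
      unfolding shifted using star[of t] by (simp add: \<Phi>_def)
    also have "\<dots> = (LINT p|Q. (\<Phi> (fst p) * k (t - Y p) - indicator {\<epsilon><..} (fst p) * \<Phi> (fst p - \<epsilon>) * k (t - Y p)) / \<epsilon>)"
      by (simp add: Bochner_Integration.integral_diff[OF iq2 iq2'])
    also have "\<dots> = (LINT p|Q. dq \<Phi> \<epsilon> (fst p) * k (t - Y p))"
      by (intro Bochner_Integration.integral_cong refl) (simp add: dq_def field_simps)
    finally show ?thesis .
  qed
  have dq_lim: "(\<lambda>n. dq g (1 / Suc n) r) \<longlonglongrightarrow> d" if "(g has_real_derivative d) (at r)" "r > 0" for g d r
  proof (rule Lim_transform_eventually[OF deriv_quotient_left_tendsto[OF that(1)]])
    obtain N :: nat where N: "1 / r < N" using reals_Archimedean2 by blast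
    have "1 / real (Suc n) < r" if "n \<ge> N" for n
    proof -
      have "1 / r < real (Suc n)" using N that by linarith
      then show ?thesis using \<open>r > 0\<close> by (simp add: field_simps)
    qed
    then show "\<forall>\<^sub>F n in sequentially. (g r - g (r - 1 / Suc n)) / (1 / Suc n) = dq g (1 / Suc n) r"
      unfolding eventually_sequentially dq_def by (intro exI[of _ N]) (simp del: of_nat_Suc)
  qed
  have dq_mult: "indicator {\<epsilon><..} r * (g r - g (r - \<epsilon>)) / \<epsilon> = indicator {\<epsilon><..} r * dq g \<epsilon> r" for g \<epsilon> r
    by (auto simp: dq_def split: split_indicator)
  have dq_bound: "\<bar>indicator {\<epsilon><..} r * dq g \<epsilon> r\<bar> \<le> B"
    if "\<epsilon> > 0" "\<And>r. (g has_real_derivative g' r) (at r)" "\<And>r. r \<ge> 0 \<Longrightarrow> \<bar>g' r\<bar> \<le> B" for g g' \<epsilon> r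
  proof (cases "r > \<epsilon>")
    case True
    have "\<bar>g r - g (r - \<epsilon>)\<bar> \<le> B * (r - (r - \<epsilon>))"
      using True that by (intro deriv_quotient_bound[of g g']) auto
    then show ?thesis using True that(1) by (simp add: dq_def abs_divide field_simps)
  next
    case False
    then show ?thesis using that(3)[of 0] by simp
  qed
  have [measurable]: "dq \<phi> \<epsilon> \<in> borel_measurable borel" "dq \<Phi> \<epsilon> \<in> borel_measurable borel" for \<epsilon>
    unfolding dq_def by measurable
  have lim_right: "(\<lambda>n. LINT p|Q. dq \<Phi> (1 / Suc n) (fst p) * k (t - Y p)) \<longlonglongrightarrow> (LINT p|Q. \<phi> (fst p) * k (t - Y p))"
  proof (rule integral_dominated_convergence[where w="\<lambda>p. B * k (t - Y p)"])
    show "integrable Q (\<lambda>p. B * k (t - Y p))" by (rule integrable_Q_k[of "\<lambda>_. B" "\<bar>B\<bar>"]) auto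
    show "AE p in Q. (\<lambda>n. dq \<Phi> (1 / Suc n) (fst p) * k (t - Y p)) \<longlonglongrightarrow> \<phi> (fst p) * k (t - Y p)"
      using AE_Q_pos
    proof eventually_elim
      case (elim p)
      have "(\<Phi> has_real_derivative \<phi> (fst p)) (at (fst p))"
        unfolding \<Phi>_def[abs_def] using \<psi>[of "fst p"] by (auto intro!: derivative_eq_intros)
      then show ?case using elim by (intro tendsto_mult_right dq_lim)
    qed
    fix n
    define \<epsilon> where "\<epsilon> = 1 / real (Suc n)"
    have \<epsilon>: "\<epsilon> > 0" by (simp add: \<epsilon>_def)
    have dqb: "\<bar>dq \<Phi> \<epsilon> r\<bar> \<le> B" if r: "r > 0" for r
    proof (cases "r > \<epsilon>")
      case True
      have "\<bar>\<psi> r - \<psi> (r - \<epsilon>)\<bar> \<le> B * (r - (r - \<epsilon>))"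
        using True \<epsilon> \<psi> B(2) by (intro deriv_quotient_bound[of \<psi> \<phi>]) auto
      then show ?thesis using True \<epsilon> by (simp add: dq_def \<Phi>_def abs_divide field_simps)
    next
      case False
      have "\<bar>\<psi> r - \<psi> 0\<bar> \<le> B * (r - 0)"
        using r \<psi> B(2) by (intro deriv_quotient_bound[of \<psi> \<phi>]) auto
      also have "\<dots> \<le> B * \<epsilon>" using False B(2)[of 0] by (intro mult_left_mono) auto
      finally show ?thesis using False \<epsilon> by (simp add: dq_def \<Phi>_def abs_divide field_simps)
    qed
    show "AE p in Q. norm (dq \<Phi> (1 / Suc n) (fst p) * k (t - Y p)) \<le> B * k (t - Y p)"
      unfolding \<epsilon>_def[symmetric] using AE_Q_pos
      by eventually_elim (auto simp: abs_mult k_nonneg intro!: mult_right_mono dqb)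
  qed measurable
  \<comment> \<open>Levels above \<open>\<epsilon>\<close> have bounded quotients and converge to
    the integral of \<open>\<theta>\<close>. On the levels up to \<open>\<epsilon>\<close> the
    quotient is \<open>\<phi> / \<epsilon>\<close>, of the order of the reciprocal step; this layer
    is the separate term \<open>I2\<close> and tends to \<open>\<phi> 0\<close>.\<close>
  define I1 where "I1 n = (LINT p|Q. indicator {1 / real (Suc n)<..} (fst p) * dq \<phi> (1 / Suc n) (fst p) * indicator {..t} (Y p))" for n
  define I2 where "I2 n = (LINT p|Q. indicator {0<..1 / real (Suc n)} (fst p) * \<phi> (fst p) * indicator {..t} (Y p)) / (1 / Suc n)" for n
  have lim1: "I1 \<longlonglongrightarrow> (LINT p|Q. \<theta> (fst p) * indicator {..t} (Y p))"
    unfolding I1_def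
  proof (rule integral_dominated_convergence[where w="\<lambda>p. B * indicator {..t} (Y p)"])
    show "integrable Q (\<lambda>p. B * indicator {..t} (Y p))"
      by (rule integrable_Q_le[of "\<lambda>_. B" "\<bar>B\<bar>" _ 1 t]) (auto simp: indicator_def)
    show "AE p in Q. (\<lambda>n. indicator {1 / real (Suc n)<..} (fst p) * dq \<phi> (1 / Suc n) (fst p) * indicator {..t} (Y p)) \<longlonglongrightarrow> \<theta> (fst p) * indicator {..t} (Y p)"
      using AE_Q_pos
    proof eventually_elim
      case (elim p)
      have "(\<lambda>n. 1 / real (Suc n)) \<longlonglongrightarrow> 0" by real_asymp
      then have "\<forall>\<^sub>F n in sequentially. 1 / real (Suc n) < fst p" using elim by (rule order_tendstoD(2))
      then have "\<forall>\<^sub>F n in sequentially. dq \<phi> (1 / Suc n) (fst p) = indicator {1 / real (Suc n)<..} (fst p) * dq \<phi> (1 / Suc n) (fst p)"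
        by eventually_elim simp
      with dq_lim[OF \<phi> elim] have "(\<lambda>n. indicator {1 / real (Suc n)<..} (fst p) * dq \<phi> (1 / Suc n) (fst p)) \<longlonglongrightarrow> \<theta> (fst p)"
        by (rule Lim_transform_eventually)
      then show ?case by (intro tendsto_mult_right)
    qed
    show "AE p in Q. norm (indicator {1 / real (Suc n)<..} (fst p) * dq \<phi> (1 / Suc n) (fst p) * indicator {..t} (Y p)) \<le> B * indicator {..t} (Y p)" for n
      using dq_bound[of "1 / Suc n" \<phi> \<theta>, OF _ \<phi> B(3)] by (intro AE_I2) (auto simp: abs_mult intro!: mult_right_mono)
  qed measurable
  have lim2: "I2 \<longlonglongrightarrow> \<phi> 0"
    unfolding I2_def[abs_def] by (rule integral_Q_near_0[OF _ cont(2) B(2) t]) auto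
  have "(LINT p|Q. dq \<phi> (1 / Suc n) (fst p) * indicator {..t} (Y p)) = I1 n + I2 n" for n
  proof -
    define \<epsilon> where "\<epsilon> = 1 / real (Suc n)"
    have \<epsilon>: "\<epsilon> > 0" by (simp add: \<epsilon>_def)
    have i1: "integrable Q (\<lambda>p. (indicator {\<epsilon><..} (fst p) * dq \<phi> \<epsilon> (fst p)) * indicator {..t} (Y p))"
      using dq_bound[OF \<epsilon> \<phi> B(3)] by (intro integrable_Q_le[where B=B and C=1 and t=t]) (auto simp: indicator_def)
    have i2: "integrable Q (\<lambda>p. (indicator {0<..\<epsilon>} (fst p) * \<phi> (fst p)) * indicator {..t} (Y p))"
      using B0 B(2) by (intro integrable_Q_le[where B=B and C=1 and t=t]) (auto simp: indicator_def)
    have "(LINT p|Q. dq \<phi> \<epsilon> (fst p) * indicator {..t} (Y p)) =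
        (LINT p|Q. indicator {\<epsilon><..} (fst p) * dq \<phi> \<epsilon> (fst p) * indicator {..t} (Y p) + indicator {0<..\<epsilon>} (fst p) * \<phi> (fst p) * indicator {..t} (Y p) / \<epsilon>)"
    proof (rule integral_cong_AE)
      show "AE p in Q. dq \<phi> \<epsilon> (fst p) * indicator {..t} (Y p) =
          indicator {\<epsilon><..} (fst p) * dq \<phi> \<epsilon> (fst p) * indicator {..t} (Y p) + indicator {0<..\<epsilon>} (fst p) * \<phi> (fst p) * indicator {..t} (Y p) / \<epsilon>"
        using AE_Q_pos by eventually_elim (auto simp: dq_def split: split_indicator)
    qed measurable
    also have "\<dots> = (LINT p|Q. indicator {\<epsilon><..} (fst p) * dq \<phi> \<epsilon> (fst p) * indicator {..t} (Y p)) + (LINT p|Q. indicator {0<..\<epsilon>} (fst p) * \<phi> (fst p) * indicator {..t} (Y p) / \<epsilon>)"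
      by (intro Bochner_Integration.integral_add i1 integrable_divide i2)
    finally show ?thesis by (simp add: I1_def I2_def \<epsilon>_def)
  qed
  then have "(\<lambda>n. LINT p|Q. dq \<phi> (1 / Suc n) (fst p) * indicator {..t} (Y p)) \<longlonglongrightarrow> (LINT p|Q. \<theta> (fst p) * indicator {..t} (Y p)) + \<phi> 0"
    using tendsto_add[OF lim1 lim2] by simp
  then have "(\<lambda>n. LINT p|Q. dq \<Phi> (1 / Suc n) (fst p) * k (t - Y p)) \<longlonglongrightarrow> (LINT p|Q. \<theta> (fst p) * indicator {..t} (Y p)) + \<phi> 0"
    by (simp add: eq)
  from LIMSEQ_unique[OF lim_right this] show ?thesis by simp
qed


text \<open>The positive and the negative part of the weight each yield such a measure: finite,
  concentrated on \<open>{0<..t}\<close>, and thus admissible in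
  \<open>abs_continuous_signed_density\<close>. Integrals against it are potential
  integrals.\<close>

lemma weighted_potential:
  fixes h :: "real \<Rightarrow> real" and B t :: real
  assumes [measurable]: "h \<in> borel_measurable borel" and h: "\<And>r. 0 \<le> h r" "\<And>r. r > 0 \<Longrightarrow> h r \<le> B"
  defines "\<rho> \<equiv> distr (density Q (\<lambda>p. ennreal (h (fst p) * indicator {..t} (Y p)))) borel Y"
  shows "finite_measure \<rho>" "emeasure \<rho> (- {0<..t}) = 0"
    and "\<And>g :: real \<Rightarrow> real. g \<in> borel_measurable borel \<Longrightarrow>
      integrable \<rho> g \<longleftrightarrow> integrable Q (\<lambda>p. h (fst p) * indicator {..t} (Y p) * g (Y p))"
    and "\<And>g :: real \<Rightarrow> real. g \<in> borel_measurable borel \<Longrightarrow>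
      (LINT y|\<rho>. g y) = (LINT p|Q. h (fst p) * indicator {..t} (Y p) * g (Y p))"
proof -
  have nn: "(\<integral>\<^sup>+y. g y \<partial>\<rho>) = (\<integral>\<^sup>+p. ennreal (h (fst p) * indicator {..t} (Y p)) * g (Y p) \<partial>Q)"
    if [measurable]: "g \<in> borel_measurable borel" for g
    unfolding \<rho>_def by (subst nn_integral_distr, measurable) (subst nn_integral_density, auto)
  have i: "integrable Q (\<lambda>p. h (fst p) * indicator {..t} (Y p))"
    using h by (intro integrable_Q_le[where B=B and C=1 and t=t]) (auto simp: indicator_def)
  have "emeasure \<rho> (space \<rho>) = (\<integral>\<^sup>+p. ennreal (h (fst p) * indicator {..t} (Y p)) \<partial>Q)"
    using nn[of "\<lambda>_. 1"] by (simp add: \<rho>_def)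
  also have "\<dots> < \<infinity>" using nn_integral_eq_integral[OF i] h by simp
  finally show "finite_measure \<rho>" by (intro finite_measureI) simp
  have "emeasure \<rho> (- {0<..t}) = (\<integral>\<^sup>+p. ennreal (h (fst p) * indicator {..t} (Y p)) * indicator (- {0<..t}) (Y p) \<partial>Q)"
    using nn[of "indicator (- {0<..t})"] by (simp add: \<rho>_def)
  also have "\<dots> = (\<integral>\<^sup>+p. 0 \<partial>Q)"
    by (intro nn_integral_cong_AE, use AE_Y_pos in eventually_elim) (auto split: split_indicator)
  finally show "emeasure \<rho> (- {0<..t}) = 0" by simp
  fix g :: "real \<Rightarrow> real" assume [measurable]: "g \<in> borel_measurable borel"
  show "integrable \<rho> g \<longleftrightarrow> integrable Q (\<lambda>p. h (fst p) * indicator {..t} (Y p) * g (Y p))"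
    unfolding \<rho>_def using h by (subst integrable_distr_eq, simp, simp) (subst integrable_density, auto)
  show "(LINT y|\<rho>. g y) = (LINT p|Q. h (fst p) * indicator {..t} (Y p) * g (Y p))"
    unfolding \<rho>_def using h by (subst integral_distr, simp, simp) (subst integral_density, auto)
qed

text \<open>Absolute continuity of \<open>u\<close> turns \<open>\<phi> dU\<close> into \<open>w(y) dy\<close>. Without drift \<open>Uk = 1\<close> holds almost
  everywhere only, but the convolution with \<open>w(y) dy\<close> does not see null sets.\<close>
theorem caputo_driftless:
  assumes b0: "b = 0"
    and \<psi>: "\<And>r. (\<psi> has_real_derivative \<phi> r) (at r)" and \<phi>: "\<And>r. (\<phi> has_real_derivative \<theta> r) (at r)"
    and [measurable]: "\<theta> \<in> borel_measurable borel"
    and B: "\<And>r. r \<ge> 0 \<Longrightarrow> \<bar>\<psi> r\<bar> \<le> B" "\<And>r. r \<ge> 0 \<Longrightarrow> \<bar>\<phi> r\<bar> \<le> B" "\<And>r. r \<ge> 0 \<Longrightarrow> \<bar>\<theta> r\<bar> \<le> B"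
    and u: "\<And>x. x \<ge> 0 \<Longrightarrow> u x = \<psi> 0 + (LINT p|Q. \<phi> (fst p) * indicator {..x} (Y p))"
    and ac: "abs_continuous_on_halfline u" and t: "t > 0"
  shows "caputo_djrbashian_exists b \<nu> u t"
    and "caputo_djrbashian b \<nu> u t = \<phi> 0 + (LINT p|Q. \<theta> (fst p) * indicator {..t} (Y p))"
proof -
  have cont: "isCont \<psi> r" "isCont \<phi> r" for r using \<psi> \<phi> DERIV_isCont by blast+
  then have [measurable]: "\<psi> \<in> borel_measurable borel" "\<phi> \<in> borel_measurable borel"
    by (auto intro!: borel_measurable_continuous_onI continuous_at_imp_continuous_on)
  define \<rho> where "\<rho> h = distr (density Q (\<lambda>p. ennreal (h (fst p) * indicator {..t} (Y p)))) borel Y" for h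
  define hp where "hp r = max 0 (\<phi> r)" for r
  define hm where "hm r = max 0 (- \<phi> r)" for r
  have [measurable]: "hp \<in> borel_measurable borel" "hm \<in> borel_measurable borel"
    unfolding hp_def hm_def by measurable
  have hp: "0 \<le> hp r" "r > 0 \<Longrightarrow> hp r \<le> B" and hm: "0 \<le> hm r" "r > 0 \<Longrightarrow> hm r \<le> B" for r
    using B(2)[of r] B(2)[of 0] by (auto simp: hp_def hm_def)
  note P = weighted_potential[where h=hp and B=B and t=t, OF _ hp, folded \<rho>_def, simplified]
    and N = weighted_potential[where h=hm and B=B and t=t, OF _ hm, folded \<rho>_def, simplified]
  have diff: "(LINT y|\<rho> hp. g y) - (LINT y|\<rho> hm. g y) = (LINT p|Q. \<phi> (fst p) * indicator {..t} (Y p) * g (Y p))"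
    if [measurable]: "g \<in> borel_measurable borel" and i: "integrable (\<rho> hp) g" "integrable (\<rho> hm) g" for g :: "real \<Rightarrow> real"
  proof -
    have "(LINT y|\<rho> hp. g y) - (LINT y|\<rho> hm. g y) =
        (LINT p|Q. hp (fst p) * indicator {..t} (Y p) * g (Y p) - hm (fst p) * indicator {..t} (Y p) * g (Y p))"
      using i by (simp add: P N Bochner_Integration.integral_diff)
    also have "\<dots> = (LINT p|Q. \<phi> (fst p) * indicator {..t} (Y p) * g (Y p))"
      by (intro Bochner_Integration.integral_cong refl) (simp add: hp_def hm_def max_def)
    finally show ?thesis .
  qed
  have ibdd: "integrable (\<rho> hp) g" "integrable (\<rho> hm) g"
    if [measurable]: "g \<in> borel_measurable borel" and "\<And>y. \<bar>g y\<bar> \<le> C" for g :: "real \<Rightarrow> real" and C :: real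
  proof -
    interpret p: finite_measure "\<rho> hp" by (rule P(1))
    interpret m: finite_measure "\<rho> hm" by (rule N(1))
    show "integrable (\<rho> hp) g" "integrable (\<rho> hm) g"
      using that(2) by (auto intro!: p.integrable_const_bound[where B=C] m.integrable_const_bound[where B=C] AE_I2)
        (simp_all add: \<rho>_def)
  qed
  have sets: "sets (\<rho> h) = sets borel" for h by (simp add: \<rho>_def)
  have u_diff: "u x - u 0 = measure (\<rho> hp) {..x} - measure (\<rho> hm) {..x}" if x: "0 \<le> x" "x \<le> t" for x
  proof -
    have i: "integrable (\<rho> hp) (indicator {..x} :: real \<Rightarrow> real)" "integrable (\<rho> hm) (indicator {..x} :: real \<Rightarrow> real)"
      by ((rule ibdd[of "indicator {..x}" 1]; simp split: split_indicator)+)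
    have "measure (\<rho> hp) {..x} - measure (\<rho> hm) {..x} = (LINT y|\<rho> hp. indicator {..x} y) - (LINT y|\<rho> hm. indicator {..x} y)"
      by (simp add: sets_eq_imp_space_eq[OF sets])
    also have "\<dots> = (LINT p|Q. \<phi> (fst p) * indicator {..t} (Y p) * indicator {..x} (Y p))"
      using i by (intro diff) auto
    also have "\<dots> = (LINT p|Q. \<phi> (fst p) * indicator {..x} (Y p))"
      using x by (intro Bochner_Integration.integral_cong refl) (auto split: split_indicator)
    also have "\<dots> = u x - \<psi> 0" using u[OF x(1)] by simp
    also have "\<psi> 0 = u 0"
    proof -
      have "(LINT p|Q. \<phi> (fst p) * indicator {..0} (Y p)) = (LINT p|Q. 0)"
        by (intro integral_cong_AE, measurable, use AE_Y_pos in eventually_elim) (auto split: split_indicator)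
      then show ?thesis using u[of 0] by simp
    qed
    finally show ?thesis by simp
  qed
  from abs_continuous_signed_density[OF P(1) N(1) sets sets P(2) N(2) t ac u_diff]
  obtain w :: "real \<Rightarrow> real" where w0: "integrable lborel w \<and> (\<forall>x. x \<notin> {0<..t} \<longrightarrow> w x = 0) \<and>
    (\<forall>k :: real \<Rightarrow> real. integrable (\<rho> hp) k \<longrightarrow> integrable (\<rho> hm) k \<longrightarrow>
       integrable lborel (\<lambda>x. w x * k x) \<and> (LINT x|\<rho> hp. k x) - (LINT x|\<rho> hm. k x) = (LINT x|lborel. w x * k x))"
    by (rule exE)
  have w: "integrable lborel w" "\<And>x. x \<notin> {0<..t} \<Longrightarrow> w x = 0"
    using w0 by simp_all
  have wk: "integrable lborel (\<lambda>x. w x * g x) \<and> (LINT x|\<rho> hp. g x) - (LINT x|\<rho> hm. g x) = (LINT x|lborel. w x * g x)"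
    if "integrable (\<rho> hp) g" "integrable (\<rho> hm) g" for g
    using w0 that by simp
  have [measurable]: "w \<in> borel_measurable borel" using w(1) by auto
  have repr: "(LINT p|Q. \<phi> (fst p) * indicator {..t} (Y p) * g (Y p)) = (LINT x|lborel. w x * g x)"
    if "g \<in> borel_measurable borel" "\<And>y. \<bar>g y\<bar> \<le> C" for g :: "real \<Rightarrow> real" and C :: real
    using diff[OF that(1) ibdd[OF that]] wk[OF ibdd[OF that]] by simp
  \<comment> \<open>For almost every \<open>y\<close> the indicator of \<open>y \<le> x\<close>
    equals \<open>Ukr (x - y)\<close>. The signed measure has the density \<open>w\<close>, so one
    may replace the other for each single \<open>x\<close>; then the convolution inside
    \<open>Ukr\<close> is traded for the primitive of the weight.\<close>
  have star: "(LINT p|Q. \<phi> (fst p) * indicator {..x} (Y p)) = (LINT p|Q. (\<psi> (fst p) - \<psi> 0) * k (x - Y p))" if x: "x \<le> t" for x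
  proof -
    have "(LINT p|Q. \<phi> (fst p) * indicator {..x} (Y p)) = (LINT p|Q. \<phi> (fst p) * indicator {..t} (Y p) * indicator {..x} (Y p))"
      using x by (intro Bochner_Integration.integral_cong refl) (auto split: split_indicator)
    also have "\<dots> = (LINT y|lborel. w y * indicator {..x} y)" by (rule repr[of _ 1]) (auto simp: indicator_def)
    also have "\<dots> = (LINT y|lborel. w y * Ukr (x - y))"
    proof (rule integral_cong_AE)
      have "AE y in lborel. Ukr (x + (-1) * y) = indicator {0<..} (x + (-1) * y)"
        by (rule AE_borel_affine[OF _ _ AE_Ukr_driftless[OF b0]]) auto
      then show "AE y in lborel. w y * indicator {..x} y = w y * Ukr (x - y)"
        using AE_lborel_singleton[of x] by eventually_elim (auto split: split_indicator)
    qed measurable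
    also have "\<dots> = (LINT p|Q. \<phi> (fst p) * indicator {..t} (Y p) * Ukr (x - Y p))"
      using Ukr_bounds by (intro repr[symmetric, of _ 1]) auto
    also have "\<dots> = (LINT p|Q. \<phi> (fst p) * Ukr (x - Y p))"
      using x by (intro Bochner_Integration.integral_cong refl) (auto simp: Ukr_bounds split: split_indicator)
    also have "\<dots> = (LINT p|Q. (\<psi> (fst p) - \<psi> 0) * k (x - Y p))"
      by (rule integral_Q_Ukr[OF \<psi> _ B(2)]) auto
    finally show ?thesis .
  qed
  have main: "(LINT p|Q. \<phi> (fst p) * k (t - Y p)) = \<phi> 0 + (LINT p|Q. \<theta> (fst p) * indicator {..t} (Y p))"
    by (rule integral_Q_k_from_primitive[OF \<psi> \<phi> _ B t star]) auto
  \<comment> \<open>The representation by \<open>w\<close> was so far used for bounded test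
    functions only; integrability of the unbounded kernel extends it to the integral that occurs in
    the Caputo derivative.\<close>
  have ik: "integrable (\<rho> hp) (\<lambda>y. k (t - y))" "integrable (\<rho> hm) (\<lambda>y. k (t - y))"
  proof -
    have *: "h (fst p) * indicator {..t} (Y p) * k (t - Y p) = h (fst p) * k (t - Y p)" for h p
      by (auto simp: k_nonpos split: split_indicator)
    have "integrable Q (\<lambda>p. hp (fst p) * k (t - Y p))" "integrable Q (\<lambda>p. hm (fst p) * k (t - Y p))"
      using hp hm by (intro integrable_Q_k[where B=B]; auto)+
    then show "integrable (\<rho> hp) (\<lambda>y. k (t - y))" "integrable (\<rho> hm) (\<lambda>y. k (t - y))"
      by (simp_all add: P N *)
  qed
  have "(LINT p|Q. \<phi> (fst p) * k (t - Y p)) = (LINT p|Q. \<phi> (fst p) * indicator {..t} (Y p) * k (t - Y p))"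
    by (intro Bochner_Integration.integral_cong refl) (auto simp: k_nonpos split: split_indicator)
  also have "\<dots> = (LINT y|lborel. w y * k (t - y))"
    using diff[OF _ ik] wk[OF ik] by simp
  also have "\<dots> = (LINT s|lborel. w (t + (-1) * s) * k (t - (t + (-1) * s)))"
    by (subst lborel_integral_real_affine[where c="-1" and t=t]) auto
  also have "\<dots> = (LINT s|lborel. indicator {0<..<t} s * (w (t - s) * k s))"
    using w(2) by (intro Bochner_Integration.integral_cong refl) (auto simp: k_nonpos split: split_indicator)
  finally have val: "(LINT p|Q. \<phi> (fst p) * k (t - Y p)) = (LINT s|lborel. indicator {0<..<t} s * (w (t - s) * k s))" .
  have "integrable lborel (\<lambda>s. w (t + (-1) * s) * k (t - (t + (-1) * s)))"
    using wk[OF ik] lborel_integrable_real_affine[of "\<lambda>y. w y * k (t - y)" "-1" t] by simp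
  also have "(\<lambda>s. w (t + (-1) * s) * k (t - (t + (-1) * s))) = (\<lambda>s. indicator {0<..<t} s * (w (t - s) * k s))"
    using w(2) by (auto simp: k_nonpos fun_eq_iff split: split_indicator)
  finally have int: "integrable lborel (\<lambda>s. indicator {0<..<t} s * (w (t - s) * k s))" .
  have u_int: "u x = \<psi> 0 + (LINT y:{0..x}|lborel. w y)" if x: "0 \<le> x" "x \<le> t" for x
  proof -
    have "u x - \<psi> 0 = (LINT p|Q. \<phi> (fst p) * indicator {..t} (Y p) * indicator {..x} (Y p))"
      using x u[OF x(1)] by (auto intro!: Bochner_Integration.integral_cong split: split_indicator)
    also have "\<dots> = (LINT y|lborel. w y * indicator {..x} y)" by (rule repr[of _ 1]) (auto simp: indicator_def)
    also have "\<dots> = (LINT y:{0..x}|lborel. w y)"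
      unfolding set_lebesgue_integral_def real_scaleR_def using w(2)
      by (intro Bochner_Integration.integral_cong refl) (auto split: split_indicator)
    finally show ?thesis by simp
  qed
  have ae: "AE x in lborel. x \<in> {0<..<t} \<longrightarrow> (u has_real_derivative w x) (at x)"
    using AE_has_derivative_integral[OF w(1), of t]
  proof eventually_elim
    case (elim x)
    show ?case
    proof
      assume x: "x \<in> {0<..<t}"
      then have "((\<lambda>x. \<psi> 0 + (LINT y:{0..x}|lborel. w y)) has_real_derivative w x) (at x)"
        using elim by (auto intro!: derivative_eq_intros)
      then show "(u has_real_derivative w x) (at x)"
        by (rule has_field_derivative_transform_within_open[of _ _ _ "{0<..<t}"]) (use x u_int in auto)
    qed
  qed
  show "caputo_djrbashian_exists b \<nu> u t"
    using b0 by (intro caputo_eval[OF t _ ae _ int]) auto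
  show "caputo_djrbashian b \<nu> u t = \<phi> 0 + (LINT p|Q. \<theta> (fst p) * indicator {..t} (Y p))"
    using b0 main val by (subst caputo_eval[OF t _ ae _ int]) auto
qed


section \<open>The potential density in the presence of drift\<close>

definition v :: "real \<Rightarrow> real" where "v t = (indicator {0<..} t - Ukr t) / b"

lemma v_measurable[measurable]: "v \<in> borel_measurable borel" unfolding v_def by measurable

lemma k_integral_finite: "(\<integral>\<^sup>+z. ennreal (indicator {..c} z * k z) \<partial>lborel) < \<infinity>"
proof -
  have "(\<integral>\<^sup>+z. ennreal (indicator {..c} z * k z) \<partial>lborel) \<le> (\<integral>\<^sup>+z. ennreal (exp c) * (ennreal (exp (- 1 * z)) * ennreal (k z)) \<partial>lborel)"
  proof (intro nn_integral_mono)
    fix z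
    have "indicator {..c} z * k z \<le> exp c * (exp (- 1 * z) * k z)"
      using k_nonneg[of z] mult_right_mono[of 1 "exp (c - z)" "k z"]
      by (auto simp: mult.assoc[symmetric] exp_add[symmetric] split: split_indicator)
    then show "ennreal (indicator {..c} z * k z) \<le> ennreal (exp c) * (ennreal (exp (- 1 * z)) * ennreal (k z))"
      by (simp add: ennreal_mult'[symmetric] ennreal_leI)
  qed
  also have "\<dots> = ennreal (exp c) * (ennreal 1 * Phi 1)"
    by (subst nn_integral_cmult, measurable) (subst laplace_k, simp_all)
  also have "\<dots> < \<infinity>" using Phi_finite[of 1] by (simp add: ennreal_mult_less_top)
  finally show ?thesis .
qed

lemma integrable_k: "integrable lborel (\<lambda>z. indicator {..c} z * k z)"
  using k_integral_finite[of c] by (intro integrableI_nonneg) (auto simp: k_nonneg)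

text \<open>The kernel is integrable near 0, which makes the modulus of continuity in
  \<open>Ukr_modulus\<close> vanish in the limit.\<close>

lemma k_integral_small:
  assumes h: "h \<longlonglongrightarrow> (0 :: real)"
  shows "(\<lambda>n. LINT z|lborel. indicator {..h n} z * k z) \<longlonglongrightarrow> 0"
proof -
  obtain c where c: "\<And>n. \<bar>h n\<bar> \<le> c"
    using convergent_imp_Bseq[OF convergentI[OF h]] by (auto simp: Bseq_def)
  have "(\<lambda>n. LINT z|lborel. indicator {..h n} z * k z) \<longlonglongrightarrow> (LINT z|lborel. (0 :: real) * k z)"
  proof (rule integral_dominated_convergence[where w="\<lambda>z. indicator {..c} z * k z"])
    show "integrable lborel (\<lambda>z. indicator {..c} z * k z)" by (rule integrable_k)
    show "AE z in lborel. (\<lambda>n. indicator {..h n} z * k z) \<longlonglongrightarrow> 0 * k z"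
    proof (rule AE_I2)
      fix z
      show "(\<lambda>n. indicator {..h n} z * k z) \<longlonglongrightarrow> 0 * k z"
      proof (cases "z > 0")
        case True
        have "eventually (\<lambda>n. h n < z) sequentially" using order_tendstoD(2)[OF h True] .
        then have "eventually (\<lambda>n. indicator {..h n} z * k z = 0 * k z) sequentially"
          by eventually_elim simp
        then show ?thesis by (rule tendsto_eventually)
      qed (simp add: k_nonpos)
    qed
    show "AE z in lborel. norm (indicator {..h n} z * k z) \<le> indicator {..c} z * k z" for n
      using c[of n] by (intro AE_I2) (auto simp: k_nonneg split: split_indicator)
  qed measurable
  then show ?thesis by simp
qed

context
  assumes b_pos: "b > 0"
begin

lemma v_bounds: "0 \<le> v t" "v t \<le> 1 / b" "t \<le> 0 \<Longrightarrow> v t = 0"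
  using b_pos Ukr_bounds[of t] by (auto simp: v_def divide_simps split: split_indicator)

lemma v_Ukr: "b * v t + Ukr t = indicator {0<..} t"
  using b_pos by (simp add: v_def)

text \<open>The function \<open>v\<close> is obtained by solving \<open>b * v + Uk = 1\<close> on
  the positive half-line. Comparison with the renewal identity gives equal Laplace transforms, once
  the common \<open>Uk\<close> term, whose transform is finite, is cancelled.\<close>

lemma potential_density: "distr Q borel Y = density lborel (\<lambda>t. ennreal (v t))"
proof (rule laplace_transform_unique)
  show "emeasure (distr Q borel Y) {..<0} = 0"
  proof -
    have "Y -` {..<0} = {}" by (auto dest: order.strict_trans1[OF Y_nonneg])
    then show ?thesis by (subst emeasure_distr) auto
  qed
  show "emeasure (density lborel (\<lambda>t. ennreal (v t))) {..<0} = 0"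
    by (subst emeasure_density) (auto intro!: nn_integral_zero' simp: v_bounds split: split_indicator)
  have L: "(\<integral>\<^sup>+x. ennreal (exp (- s * x)) \<partial>distr Q borel Y) = ennreal (1 / f s)" if s: "s > 0" for s
    by (subst nn_integral_distr) (auto simp: laplace_Q[OF s, simplified])
  show "(\<integral>\<^sup>+x. ennreal (exp (- x)) \<partial>distr Q borel Y) < \<infinity>" using L[of 1] by simp
  fix s :: real assume s: "s > 0"
  let ?g = "\<lambda>x. ennreal (exp (- s * x))"
  have "ennreal b * (\<integral>\<^sup>+x. ennreal (v x) * ?g x \<partial>lborel) + (\<integral>\<^sup>+x. Uk x * ?g x \<partial>lborel) =
      (\<integral>\<^sup>+x. (ennreal b * ennreal (v x) + Uk x) * ?g x \<partial>lborel)"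
    by (subst nn_integral_cmult[symmetric], measurable, subst nn_integral_add[symmetric], auto simp: algebra_simps)
  also have "\<dots> = (\<integral>\<^sup>+x\<in>{0<..}. ?g x \<partial>lborel)"
  proof (intro nn_integral_cong)
    fix x
    have "ennreal b * ennreal (v x) + Uk x = ennreal (b * v x + Ukr x)"
      using b_pos v_bounds[of x] Ukr_bounds[of x] by (simp add: ennreal_mult ennreal_Ukr ennreal_plus)
    then show "(ennreal b * ennreal (v x) + Uk x) * ?g x = ?g x * indicator {0<..} x"
      by (simp add: v_Ukr mult.commute ennreal_indicator)
  qed
  also have "\<dots> = (\<integral>\<^sup>+x. ?g x \<partial>pos)" by (rule nn_integral_pos[symmetric]) measurable
  also have "\<dots> = ennreal b * (\<integral>\<^sup>+p. ?g (Y p) \<partial>Q) + (\<integral>\<^sup>+x. Uk x * ?g x \<partial>lborel)"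
    by (rule renewal_identity[symmetric]) measurable
  finally have "(\<integral>\<^sup>+x. ennreal (v x) * ?g x \<partial>lborel) = (\<integral>\<^sup>+p. ?g (Y p) \<partial>Q)"
  proof (rule ennreal_cancel_const[OF b_pos])
    show "(\<integral>\<^sup>+x. Uk x * ?g x \<partial>lborel) < \<infinity>"
      unfolding laplace_Uk[OF s] using Phi_finite[OF s] by (simp add: ennreal_mult_less_top)
  qed
  then show "(\<integral>\<^sup>+x. ?g x \<partial>distr Q borel Y) = (\<integral>\<^sup>+x. ?g x \<partial>density lborel (\<lambda>t. ennreal (v t)))"
    by (subst nn_integral_distr, simp, simp, subst nn_integral_density) auto
qed simp_all

lemma integral_Y:
  fixes g :: "real \<Rightarrow> real"
  assumes [measurable]: "g \<in> borel_measurable borel"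
  shows "integrable Q (\<lambda>p. g (Y p)) \<longleftrightarrow> integrable lborel (\<lambda>y. v y * g y)"
    "(LINT p|Q. g (Y p)) = (LINT y|lborel. v y * g y)"
proof -
  have "integrable Q (\<lambda>p. g (Y p)) \<longleftrightarrow> integrable (distr Q borel Y) g"
    by (subst integrable_distr_eq) auto
  also have "\<dots> \<longleftrightarrow> integrable lborel (\<lambda>y. v y * g y)"
    unfolding potential_density by (subst integrable_density) (auto simp: v_bounds)
  finally show "integrable Q (\<lambda>p. g (Y p)) \<longleftrightarrow> integrable lborel (\<lambda>y. v y * g y)" .
  have "(LINT p|Q. g (Y p)) = (LINT y|distr Q borel Y. g y)"
    by (subst integral_distr) auto
  also have "\<dots> = (LINT y|lborel. v y * g y)"
    unfolding potential_density by (subst integral_density) (auto simp: v_bounds)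
  finally show "(LINT p|Q. g (Y p)) = (LINT y|lborel. v y * g y)" .
qed

text \<open>A measure with a density has no atoms. This disposes of the point where the derivative
  of \<open>V\<close> fails and where open and closed half-lines differ.\<close>

lemma AE_Y_neq: "AE p in Q. Y p \<noteq> x"
proof -
  have "AE y in distr Q borel Y. y \<noteq> x"
    unfolding potential_density using AE_lborel_singleton[of x]
    by (subst AE_density) (auto elim!: eventually_mono)
  then show ?thesis by (subst (asm) AE_distr_iff) auto
qed

lemma Ukr_eq: "Ukr x = (LINT y|lborel. v y * k (x - y))" "integrable lborel (\<lambda>y. v y * k (x - y))"
proof -
  have i: "integrable Q (\<lambda>p. k (x - Y p))" using integrable_Q_k[of "\<lambda>_. 1" 1 x] by simp
  then show "integrable lborel (\<lambda>y. v y * k (x - y))" using integral_Y(1)[of "\<lambda>y. k (x - y)"] by simp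
  have "(LINT p|Q. k (x - Y p)) = Ukr x"
    unfolding Ukr_def Uk_def using i by (intro integral_eq_nn_integral) (auto simp: k_nonneg)
  then show "Ukr x = (LINT y|lborel. v y * k (x - y))" using integral_Y(2)[of "\<lambda>y. k (x - y)"] by simp
qed

text \<open>Since \<open>k\<close> decreases on the half-line, \<open>k (c - y) - k (a - y)\<close> has integral at most
  \<open>2 \<integral>\<^sub>0\<^sup>c\<^sup>-\<^sup>a k\<close> in absolute value over \<open>y > 0\<close>.\<close>
lemma Ukr_modulus:
  assumes a: "0 < a" "a \<le> c"
  shows "\<bar>Ukr c - Ukr a\<bar> \<le> 2 / b * (LINT z|lborel. indicator {..c - a} z * k z)"
proof -
  define A where "A x = (LINT z|lborel. indicator {..x} z * k z)" for x
  have refl_int: "integrable lborel (\<lambda>y. indicator {..d} (x - y) * k (x - y))"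
    "(LINT y|lborel. indicator {..d} (x - y) * k (x - y)) = A d" for x d
    using lborel_integrable_real_affine[OF integrable_k[of d], of "-1" x]
      lborel_integral_real_affine[of "-1" "\<lambda>z. indicator {..d} z * k z" x] by (simp_all add: A_def)
  have i: "integrable lborel (\<lambda>y. indicator {0<..} y * k (x - y))" "(LINT y|lborel. indicator {0<..} y * k (x - y)) = A x" for x
  proof -
    have eq: "indicator {..x} (x - y) * k (x - y) = indicator {0<..} y * k (x - y)" if "y \<noteq> 0" for y
      using that by (auto split: split_indicator)
    have ae: "AE y in lborel. indicator {..x} (x - y) * k (x - y) = indicator {0<..} y * k (x - y)"
      using AE_lborel_singleton[of "0::real"] by eventually_elim (rule eq)
    show "integrable lborel (\<lambda>y. indicator {0<..} y * k (x - y))"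
      by (rule integrable_cong_AE_imp[OF refl_int(1)[of x x] _ ae]) measurable
    have "(LINT y|lborel. indicator {..x} (x - y) * k (x - y)) = (LINT y|lborel. indicator {0<..} y * k (x - y))"
      by (rule integral_cong_AE[OF _ _ ae]) measurable
    then show "(LINT y|lborel. indicator {0<..} y * k (x - y)) = A x" using refl_int(2)[of x x] by simp
  qed
  \<comment> \<open>For \<open>0 < y < a\<close> the first two terms are nonnegative, as the kernel
    decreases. For \<open>y \<ge> a\<close> the first vanishes and the second has the wrong sign;
    the last term, active exactly when \<open>y \<ge> a\<close>, reverses it. Integrating
    \<open>G\<close> gives \<open>A a - A c + 2 * A (c - a)\<close>.\<close>
  define G where "G y = indicator {0<..} y * k (a - y) - indicator {0<..} y * k (c - y) + 2 * (indicator {..c - a} (c - y) * k (c - y))" for y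
  have iG: "integrable lborel G"
    unfolding G_def[abs_def] by (intro Bochner_Integration.integrable_add Bochner_Integration.integrable_diff i integrable_mult_right refl_int)
  have "Ukr c - Ukr a = (LINT y|lborel. v y * k (c - y) - v y * k (a - y))"
    by (simp add: Ukr_eq Bochner_Integration.integral_diff)
  also have "\<bar>\<dots>\<bar> \<le> (LINT y|lborel. 1 / b * G y)"
  proof (rule integral_abs_bound[THEN order_trans], rule integral_mono)
    show "integrable lborel (\<lambda>y. \<bar>v y * k (c - y) - v y * k (a - y)\<bar>)"
      by (intro integrable_abs Bochner_Integration.integrable_diff Ukr_eq)
    show "integrable lborel (\<lambda>y. 1 / b * G y)" using iG by simp
    fix y
    have "\<bar>k (c - y) - k (a - y)\<bar> \<le> G y" if "y > 0"
    proof (cases "y < a")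
      case True
      then have "k (c - y) \<le> k (a - y)" using a levy_tail_antimono[of "a - y" "c - y"] by (simp add: k_def)
      then show ?thesis using that k_nonneg[of "c - y"] by (auto simp: G_def split: split_indicator)
    next
      case False
      then have "k (a - y) = 0" by (simp add: k_nonpos)
      then show ?thesis using that k_nonneg[of "c - y"] False by (auto simp: G_def split: split_indicator)
    qed
    then have "v y * \<bar>k (c - y) - k (a - y)\<bar> \<le> 1 / b * G y" if "y > 0"
      using that v_bounds[of y] b_pos by (intro mult_mono) auto
    moreover have "0 \<le> 1 / b * G y" if "y \<le> 0"
      using that k_nonneg[of "c - y"] b_pos by (auto simp: G_def split: split_indicator)
    ultimately show "\<bar>v y * k (c - y) - v y * k (a - y)\<bar> \<le> 1 / b * G y"
      using v_bounds(1,3)[of y] by (cases "y > 0") (auto simp: abs_mult right_diff_distrib[symmetric])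
  qed
  also have "\<dots> = 1 / b * (LINT y|lborel. G y)" by simp
  also have "(LINT y|lborel. G y) = A a - A c + 2 * A (c - a)"
    unfolding G_def[abs_def]
    by (subst Bochner_Integration.integral_add, intro Bochner_Integration.integrable_diff i, intro integrable_mult_right refl_int,
        subst Bochner_Integration.integral_diff[OF i(1) i(1)], subst integral_mult_right_zero, simp only: i(2) refl_int(2))
  also have "A a \<le> A c"
    unfolding A_def using a by (intro integral_mono integrable_k) (auto simp: k_nonneg split: split_indicator)
  finally show ?thesis using b_pos by (simp add: A_def divide_right_mono mult.commute)
qed

lemma isCont_v:
  assumes t: "t > 0"
  shows "isCont v t"
  unfolding continuous_at_sequentially comp_def
proof (intro allI impI)
  fix x assume x: "x \<longlonglongrightarrow> t"
  have d0: "(\<lambda>n. \<bar>x n - t\<bar>) \<longlonglongrightarrow> 0"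
    using tendsto_rabs[OF LIM_zero[OF x]] by simp
  have bound: "\<forall>\<^sub>F n in sequentially. norm (Ukr (x n) - Ukr t) \<le> 2 / b * (LINT z|lborel. indicator {..\<bar>x n - t\<bar>} z * k z)"
    using order_tendstoD(1)[OF x t]
  proof eventually_elim
    case (elim n)
    show ?case using Ukr_modulus[of t "x n"] Ukr_modulus[of "x n" t] t elim
      by (cases "t \<le> x n") (auto simp: abs_minus_commute)
  qed
  have lim: "(\<lambda>n. 2 / b * (LINT z|lborel. indicator {..\<bar>x n - t\<bar>} z * k z)) \<longlonglongrightarrow> 0"
    using tendsto_mult_right_zero[OF k_integral_small[OF d0], of "2 / b"] by simp
  have "(\<lambda>n. Ukr (x n) - Ukr t) \<longlonglongrightarrow> 0" by (rule Lim_null_comparison[OF bound lim])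
  then have "(\<lambda>n. Ukr (x n)) \<longlonglongrightarrow> Ukr t" by (rule LIM_zero_cancel)
  then have "(\<lambda>n. (1 - Ukr (x n)) / b) \<longlonglongrightarrow> (1 - Ukr t) / b"
    using b_pos by (intro tendsto_intros) auto
  moreover have "\<forall>\<^sub>F n in sequentially. (1 - Ukr (x n)) / b = v (x n)"
    using order_tendstoD(1)[OF x t] by eventually_elim (simp add: v_def)
  ultimately have "(\<lambda>n. v (x n)) \<longlonglongrightarrow> (1 - Ukr t) / b" by (rule Lim_transform_eventually)
  then show "(\<lambda>n. v (x n)) \<longlonglongrightarrow> v t" using t by (simp add: v_def)
qed

text \<open>The distribution function of the potential measure, known as the renewal
  function.\<close>

definition V :: "real \<Rightarrow> real" where "V x = (LINT y|lborel. v y * indicator {..x} y)"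

lemma integrable_v: "integrable lborel (\<lambda>y. v y * indicator {..x} y)"
proof -
  have "integrable Q (\<lambda>p. indicator {..x} (Y p) :: real)"
    using integrable_Q_le[of "\<lambda>_. 1" 1 "indicator {..x}" 1 x] by (simp add: indicator_def)
  then show ?thesis using integral_Y(1)[of "indicator {..x}"] by simp
qed

lemma V_diff: "x \<le> y \<Longrightarrow> V y - V x = (LINT z|lborel. v z * indicator {x<..y} z)"
proof -
  assume xy: "x \<le> y"
  have "V y - V x = (LINT z|lborel. v z * indicator {..y} z - v z * indicator {..x} z)"
    unfolding V_def by (rule Bochner_Integration.integral_diff[symmetric, OF integrable_v integrable_v])
  also have "\<dots> = (LINT z|lborel. v z * indicator {x<..y} z)"
    using xy by (intro Bochner_Integration.integral_cong refl) (auto split: split_indicator)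
  finally show ?thesis .
qed

lemma V_lipschitz: "x \<le> y \<Longrightarrow> 0 \<le> V y - V x \<and> V y - V x \<le> (y - x) / b"
proof -
  assume xy: "x \<le> y"
  have i: "integrable lborel (\<lambda>z. 1 / b * indicator {x<..y} z)"
    using xy by (intro integrable_mult_right integrable_real_indicator) auto
  have "(LINT z|lborel. v z * indicator {x<..y} z) \<le> (LINT z|lborel. 1 / b * indicator {x<..y} z)"
    by (rule integral_mono'[OF i]) (use v_bounds b_pos in \<open>auto split: split_indicator\<close>)
  also have "\<dots> = (y - x) / b" using xy by simp
  finally have "V y - V x \<le> (y - x) / b" using V_diff[OF xy] by simp
  moreover have "0 \<le> (LINT z|lborel. v z * indicator {x<..y} z)"
    by (intro integral_nonneg_AE AE_I2) (auto simp: v_bounds)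
  ultimately show ?thesis using V_diff[OF xy] by simp
qed

lemma V_abs_lipschitz: "\<bar>V y - V x\<bar> \<le> \<bar>y - x\<bar> / b"
  using V_lipschitz[of x y] V_lipschitz[of y x] by (cases "x \<le> y") (auto simp: abs_if)

lemma V_nonpos: "x \<le> 0 \<Longrightarrow> V x = 0"
  unfolding V_def by (rule integral_eq_zero_AE) (auto simp: v_bounds split: split_indicator)

lemma V_nonneg: "0 \<le> V x"
  using V_lipschitz[of "min x 0" x] V_nonpos[of "min x 0"] by simp

lemma V_mono: "x \<le> y \<Longrightarrow> V x \<le> V y" using V_lipschitz[of x y] by simp

lemma V_measurable[measurable]: "V \<in> borel_measurable borel"
  using V_mono by (intro borel_measurable_mono) (auto simp: mono_def)

text \<open>The fundamental theorem of calculus at continuity points of \<open>v\<close>. At 0 the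
  density can jump from the value 0, so that point is left out.\<close>

lemma V_deriv:
  assumes "x \<noteq> 0"
  shows "(V has_real_derivative v x) (at x)"
proof (cases "x > 0")
  case True
  define a c where "a = x / 2" and "c = 2 * x"
  have ac: "0 < a" "a < x" "x < c" using True by (auto simp: a_def c_def)
  have "continuous_on {a..c} v"
    using isCont_v ac by (intro continuous_at_imp_continuous_on) auto
  then have "((\<lambda>y. integral {a..y} v) has_real_derivative v x) (at x within {a..c})"
    using ac by (intro integral_has_real_derivative) auto
  then have "((\<lambda>y. integral {a..y} v) has_real_derivative v x) (at x)"
    using ac at_within_Icc_at[of a x c] by simp
  then have "((\<lambda>y. V a + integral {a..y} v) has_real_derivative v x) (at x)"
    by (auto intro!: derivative_eq_intros)
  then show ?thesis
  proof (rule has_field_derivative_transform_within_open[of _ _ _ "{a<..<c}"])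
    fix y assume y: "y \<in> {a<..<c}"
    have si: "set_integrable lborel {a..y} v"
      unfolding set_integrable_def real_scaleR_def
      by (rule Bochner_Integration.integrable_bound[OF integrable_v[of y]]) (auto simp: v_bounds split: split_indicator)
    have "V y - V a = (LINT z|lborel. v z * indicator {a<..y} z)" using y by (intro V_diff) auto
    also have "\<dots> = (LINT z:{a..y}|lborel. v z)"
      unfolding set_lebesgue_integral_def real_scaleR_def
      by (intro integral_cong_AE, measurable, use AE_lborel_singleton[of a] in eventually_elim) (auto split: split_indicator)
    also have "\<dots> = integral {a..y} v" by (rule set_borel_integral_eq_integral(2)[OF si])
    finally show "V a + integral {a..y} v = V y" by simp
  qed (use ac in auto)
next
  case False
  then have "x < 0" using assms by simp
  have "((\<lambda>_. 0) has_real_derivative v x) (at x)" using \<open>x < 0\<close> by (simp add: v_bounds)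
  then show ?thesis
    by (rule has_field_derivative_transform_within_open[of _ _ _ "{..<0}"]) (use \<open>x < 0\<close> V_nonpos in auto)
qed

lemma integral_v_conv: "(LINT s|lborel. v (x - s) * k s) = Ukr x" "integrable lborel (\<lambda>s. v (x - s) * k s)"
proof -
  have "(LINT y|lborel. v y * k (x - y)) = (LINT s|lborel. v (x + (-1) * s) * k (x - (x + (-1) * s)))"
    by (subst lborel_integral_real_affine[where c="-1" and t=x]) auto
  then show "(LINT s|lborel. v (x - s) * k s) = Ukr x" by (simp add: Ukr_eq)
  show "integrable lborel (\<lambda>s. v (x - s) * k s)"
    using lborel_integrable_real_affine[OF Ukr_eq(2)[of x], of "-1" x] by simp
qed

text \<open>Differentiation under the integral: \<open>V\<close> is Lipschitz with constant
  \<open>1 / b\<close>, which dominates the quotients, and it is differentiable at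
  \<open>x - Y p\<close> for almost every \<open>p\<close>.\<close>

lemma integral_Q_V_deriv:
  assumes [measurable]: "\<theta> \<in> borel_measurable borel" and \<theta>: "\<And>r. r \<ge> 0 \<Longrightarrow> \<bar>\<theta> r\<bar> \<le> B"
  shows "((\<lambda>x. LINT p|Q. \<theta> (fst p) * V (x - Y p)) has_real_derivative (LINT p|Q. \<theta> (fst p) * v (x - Y p))) (at x)"
  unfolding DERIV_def LIMSEQ_SEQ_conv[symmetric]
proof (intro allI impI, elim conjE)
  fix S :: "nat \<Rightarrow> real" assume S: "\<forall>n. S n \<noteq> 0" "S \<longlonglongrightarrow> 0"
  have S0: "\<And>n. S n \<noteq> 0" using S(1) by simp
  obtain c where c: "\<And>n. \<bar>S n\<bar> \<le> c"
    using convergent_imp_Bseq[OF convergentI[OF S(2)]] by (auto simp: Bseq_def)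
  have iV: "integrable Q (\<lambda>p. \<theta> (fst p) * V (y - Y p))" for y
    using \<theta> V_mono[of _ y] V_nonneg V_nonpos by (intro integrable_Q_le[where B=B and C="V y" and t=y]) auto
  have "(\<lambda>n. LINT p|Q. \<theta> (fst p) * ((V (x + S n - Y p) - V (x - Y p)) / S n)) \<longlonglongrightarrow> (LINT p|Q. \<theta> (fst p) * v (x - Y p))"
  proof (rule integral_dominated_convergence[where w="\<lambda>p. B * (1 / b) * indicator {..x + c} (Y p)"])
    show "integrable Q (\<lambda>p. B * (1 / b) * indicator {..x + c} (Y p))"
      by (rule integrable_Q_le[of "\<lambda>_. B * (1 / b)" "\<bar>B * (1 / b)\<bar>" _ 1 "x + c"]) (auto simp: indicator_def)
    show "AE p in Q. (\<lambda>n. \<theta> (fst p) * ((V (x + S n - Y p) - V (x - Y p)) / S n)) \<longlonglongrightarrow> \<theta> (fst p) * v (x - Y p)"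
      using AE_Y_neq[of x]
    proof eventually_elim
      case (elim p)
      then have "x - Y p \<noteq> 0" by simp
      then have "((\<lambda>h. (V (x - Y p + h) - V (x - Y p)) / h) \<longlongrightarrow> v (x - Y p)) (at 0)"
        using V_deriv unfolding DERIV_def by blast
      moreover have "filterlim S (at 0) sequentially"
        using S by (intro filterlim_atI) auto
      ultimately have "(\<lambda>n. (V (x - Y p + S n) - V (x - Y p)) / S n) \<longlonglongrightarrow> v (x - Y p)"
        by (rule filterlim_compose)
      then show ?case by (intro tendsto_mult_left) (simp add: algebra_simps)
    qed
    fix n
    show "AE p in Q. norm (\<theta> (fst p) * ((V (x + S n - Y p) - V (x - Y p)) / S n)) \<le> B * (1 / b) * indicator {..x + c} (Y p)"
      using AE_Q_pos
    proof eventually_elim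
      case (elim p)
      have q: "\<bar>(V (x + S n - Y p) - V (x - Y p)) / S n\<bar> \<le> 1 / b * indicator {..x + c} (Y p)"
      proof (cases "Y p \<le> x + c")
        case True
        have "\<bar>V (x + S n - Y p) - V (x - Y p)\<bar> \<le> \<bar>S n\<bar> / b"
          using V_abs_lipschitz[of "x + S n - Y p" "x - Y p"] by simp
        then show ?thesis using True S0[of n] b_pos by (simp add: abs_divide divide_simps)
      next
        case False
        then have "V (x + S n - Y p) = 0" "V (x - Y p) = 0"
          using c[of n] by (auto intro!: V_nonpos)
        then show ?thesis using False by simp
      qed
      have "\<bar>\<theta> (fst p)\<bar> * \<bar>(V (x + S n - Y p) - V (x - Y p)) / S n\<bar> \<le> B * (1 / b * indicator {..x + c} (Y p))"
        using \<theta>[of "fst p"] elim q by (intro mult_mono) auto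
      then show ?case by (simp only: real_norm_def abs_mult mult.assoc)
    qed
  qed measurable
  then show "(\<lambda>n. ((LINT p|Q. \<theta> (fst p) * V (x + S n - Y p)) - (LINT p|Q. \<theta> (fst p) * V (x - Y p))) / S n)
      \<longlonglongrightarrow> (LINT p|Q. \<theta> (fst p) * v (x - Y p))"
    by (simp add: Bochner_Integration.integral_diff[OF iV iV, symmetric] right_diff_distrib)
qed

text \<open>Integrating once in the level rewrites \<open>u\<close> so that \<open>x\<close> enters
  only through \<open>V\<close>, which is differentiable off 0. The kernel then meets
  \<open>v\<close> by Fubini, the convolution of the two is \<open>Ukr\<close>, and
  \<open>b * v + Ukr = 1\<close> on the positive half-line joins the local and the nonlocal
  term.\<close>

theorem caputo_drift:
  assumes \<phi>: "\<And>r. (\<phi> has_real_derivative \<theta> r) (at r)" and [measurable]: "\<theta> \<in> borel_measurable borel"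
    and B: "\<And>r. r \<ge> 0 \<Longrightarrow> \<bar>\<phi> r\<bar> \<le> B" "\<And>r. r \<ge> 0 \<Longrightarrow> \<bar>\<theta> r\<bar> \<le> B"
    and u: "\<And>x. x \<ge> 0 \<Longrightarrow> u x = a + (LINT p|Q. \<phi> (fst p) * indicator {..x} (Y p))" and t: "t > 0"
  shows "caputo_djrbashian_exists b \<nu> u t"
    and "caputo_djrbashian b \<nu> u t = \<phi> 0 + (LINT p|Q. \<theta> (fst p) * indicator {..t} (Y p))"
proof -
  have [measurable]: "\<phi> \<in> borel_measurable borel"
    using \<phi> by (auto intro!: borel_measurable_continuous_onI continuous_at_imp_continuous_on DERIV_isCont)
  have QV: "(LINT p|Q. indicator {..x} (Y p)) = V x" for x
    using integral_Y(2)[of "indicator {..x}"] by (simp add: V_def)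
  have iI: "integrable Q (\<lambda>p. indicator {..x} (Y p) :: real)" for x
    using integrable_Q_le[of "\<lambda>_. 1" 1 "indicator {..x}" 1 x] by (simp add: indicator_def)
  have u_eq: "u x = a + \<phi> 0 * V x + (LINT p|Q. \<theta> (fst p) * V (x - Y p))" if x: "x \<ge> 0" for x
  proof -
    have gV: "(\<integral>\<^sup>+p. ennreal (indicator {..x} (y + Y p)) \<partial>Q) = ennreal (V (x - y))" for y
    proof -
      have "(\<integral>\<^sup>+p. ennreal (indicator {..x} (y + Y p)) \<partial>Q) = (\<integral>\<^sup>+p. ennreal (indicator {..x - y} (Y p)) \<partial>Q)"
        by (intro nn_integral_cong) (auto split: split_indicator)
      also have "\<dots> = ennreal (V (x - y))"
        using iI by (subst nn_integral_eq_integral) (auto simp: QV)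
      finally show ?thesis .
    qed
    have "(LINT p|Q. \<theta> (fst p) * V (x - Y p)) = (LINT p|Q. (\<phi> (fst p) - \<phi> 0) * indicator {..x} (Y p))"
      by (rule integral_Q_primitive[OF \<phi> _ B(2), of "indicator {..x}" "\<lambda>y. V (x - y)" "V x" x])
         (auto simp: V_nonneg gV intro: V_mono V_nonpos)
    also have "\<dots> = (LINT p|Q. \<phi> (fst p) * indicator {..x} (Y p) - \<phi> 0 * indicator {..x} (Y p))"
      by (simp add: algebra_simps)
    also have "\<dots> = (LINT p|Q. \<phi> (fst p) * indicator {..x} (Y p)) - \<phi> 0 * V x"
    proof (subst Bochner_Integration.integral_diff)
      show "integrable Q (\<lambda>p. \<phi> (fst p) * indicator {..x} (Y p))"
        using B(1) by (intro integrable_Q_le[where B=B and C=1 and t=x]) (auto simp: indicator_def)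
    qed (simp_all add: QV iI)
    finally show ?thesis using u[OF x] by simp
  qed
  define w where "w x = \<phi> 0 * v x + (LINT p|Q. \<theta> (fst p) * v (x - Y p))" for x
  have [measurable]: "w \<in> borel_measurable borel" unfolding w_def by measurable
  have deriv: "(u has_real_derivative w x) (at x)" if x: "x > 0" for x
  proof -
    have "((\<lambda>x. a + \<phi> 0 * V x + (LINT p|Q. \<theta> (fst p) * V (x - Y p))) has_real_derivative w x) (at x)"
      unfolding w_def using x B(2)
      by (auto intro!: derivative_eq_intros V_deriv integral_Q_V_deriv)
    then show ?thesis
      by (rule has_field_derivative_transform_within_open[of _ _ _ "{0<..}"]) (use x u_eq in auto)
  qed
  interpret LQ: pair_sigma_finite lborel Q ..
  \<comment> \<open>The double integrand over \<open>s\<close> and \<open>Q\<close>. Its domination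
    by \<open>k s\<close> and the indicator of \<open>Y p \<le> t\<close>, up to the factor
    \<open>B / b\<close>, is integrable on the product, as Fubini needs.\<close>
  define J where "J s p = indicator {0<..<t} s * (\<theta> (fst p) * v (t - s - Y p)) * k s" for s p
  have [measurable]: "case_prod J \<in> borel_measurable (lborel \<Otimes>\<^sub>M Q)" unfolding J_def[abs_def] by measurable
  have iJ: "integrable (lborel \<Otimes>\<^sub>M Q) (case_prod J)"
  proof (rule Bochner_Integration.integrable_bound)
    have "(\<integral>\<^sup>+q. ennreal (indicator {..t} (fst q) * k (fst q)) * ennreal (indicator {..t} (Y (snd q))) \<partial>(lborel \<Otimes>\<^sub>M Q)) =
        (\<integral>\<^sup>+s. ennreal (indicator {..t} s * k s) \<partial>lborel) * (\<integral>\<^sup>+p. ennreal (indicator {..t} (Y p)) \<partial>Q)"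
      by (subst Q.nn_integral_fst[symmetric]) (auto simp: nn_integral_cmult nn_integral_multc)
    also have "\<dots> < \<infinity>"
      using k_integral_finite[of t] potential_finite[of t] by (simp add: ennreal_mult_less_top ennreal_indicator)
    finally have "integrable (lborel \<Otimes>\<^sub>M Q) (\<lambda>q. (indicator {..t} (fst q) * k (fst q)) * indicator {..t} (Y (snd q)))"
      by (intro integrableI_nonneg) (auto simp: k_nonneg ennreal_mult)
    then show "integrable (lborel \<Otimes>\<^sub>M Q) (\<lambda>q. B * (1 / b) * ((indicator {..t} (fst q) * k (fst q)) * indicator {..t} (Y (snd q))))"
      by simp
    have "AE q in (lborel :: real measure) \<Otimes>\<^sub>M Q. 0 < fst (snd q)"
    proof (rule LQ.AE_pair_measure)
      show "{q \<in> space ((lborel :: real measure) \<Otimes>\<^sub>M Q). 0 < fst (snd q)} \<in> sets (lborel \<Otimes>\<^sub>M Q)" by measurable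
      show "AE s in lborel :: real measure. AE p in Q. 0 < fst (snd (s, p))"
        by (rule AE_I2) (simp only: snd_conv AE_Q_pos)
    qed
    then show "AE q in lborel \<Otimes>\<^sub>M Q. norm (case_prod J q) \<le> norm (B * (1 / b) * ((indicator {..t} (fst q) * k (fst q)) * indicator {..t} (Y (snd q))))"
    proof eventually_elim
      case (elim q)
      obtain s p where q: "q = (s, p)" by (cases q)
      have B0: "0 \<le> B" using B(1)[of 0] by simp
      show ?case
      proof (cases "0 < s \<and> s < t \<and> Y p \<le> t")
        case True
        have "\<bar>\<theta> (fst p)\<bar> * v (t - s - Y p) \<le> B * (1 / b)"
          using B(2)[of "fst p"] elim q v_bounds[of "t - s - Y p"] by (intro mult_mono) auto
        then have "\<bar>\<theta> (fst p)\<bar> * v (t - s - Y p) * k s \<le> B * (1 / b) * k s"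
          by (intro mult_right_mono k_nonneg)
        then show ?thesis using True B0 b_pos v_bounds[of "t - s - Y p"] k_nonneg[of s]
          by (simp add: q J_def abs_mult)
      next
        case False
        then have "J s p = 0" by (auto simp: J_def v_bounds split: split_indicator)
        then show ?thesis by (simp add: q)
      qed
    qed
  qed measurable
  have Js: "(LINT p|Q. J s p) = indicator {0<..<t} s * ((w (t - s) - \<phi> 0 * v (t - s)) * k s)" for s
    by (simp add: J_def w_def)
  have Jp: "(LINT s|lborel. J s p) = \<theta> (fst p) * Ukr (t - Y p)" for p
  proof -
    have "(LINT s|lborel. J s p) = (LINT s|lborel. \<theta> (fst p) * (v (t - Y p - s) * k s))"
      using Y_nonneg[of p]
      by (intro Bochner_Integration.integral_cong refl)
         (auto simp: J_def k_nonpos v_bounds algebra_simps split: split_indicator)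
    then show ?thesis by (simp add: integral_v_conv)
  qed
  have iphi: "integrable lborel (\<lambda>s. indicator {0<..<t} s * (\<phi> 0 * v (t - s) * k s))"
    "(LINT s|lborel. indicator {0<..<t} s * (\<phi> 0 * v (t - s) * k s)) = \<phi> 0 * Ukr t"
  proof -
    have eq: "indicator {0<..<t} s * (\<phi> 0 * v (t - s) * k s) = \<phi> 0 * (v (t - s) * k s)" for s
      by (auto simp: k_nonpos v_bounds split: split_indicator)
    show "integrable lborel (\<lambda>s. indicator {0<..<t} s * (\<phi> 0 * v (t - s) * k s))"
      "(LINT s|lborel. indicator {0<..<t} s * (\<phi> 0 * v (t - s) * k s)) = \<phi> 0 * Ukr t"
      unfolding eq using integral_v_conv[of t] by simp_all
  qed
  have iJs: "integrable lborel (\<lambda>s. indicator {0<..<t} s * ((w (t - s) - \<phi> 0 * v (t - s)) * k s))"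
    using LQ.integrable_fst'[OF iJ] by (simp add: Js)
  have split: "indicator {0<..<t} s * (w (t - s) * k s) =
      indicator {0<..<t} s * ((w (t - s) - \<phi> 0 * v (t - s)) * k s) + indicator {0<..<t} s * (\<phi> 0 * v (t - s) * k s)" for s
    by (simp add: algebra_simps)
  have int: "integrable lborel (\<lambda>s. indicator {0<..<t} s * (w (t - s) * k s))"
    unfolding split by (intro Bochner_Integration.integrable_add iJs iphi)
  have "(LINT s|lborel. indicator {0<..<t} s * (w (t - s) * k s)) =
      (LINT s|lborel. (LINT p|Q. J s p)) + \<phi> 0 * Ukr t"
    unfolding split Bochner_Integration.integral_add[OF iJs iphi(1)] by (simp add: Js iphi)
  also have "(LINT s|lborel. (LINT p|Q. J s p)) = (LINT p|Q. \<theta> (fst p) * Ukr (t - Y p))"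
    using LQ.Fubini_integral[of J] iJ by (simp add: Jp)
  finally have val: "(LINT s|lborel. indicator {0<..<t} s * (w (t - s) * k s)) = (LINT p|Q. \<theta> (fst p) * Ukr (t - Y p)) + \<phi> 0 * Ukr t" .
  have iv: "integrable Q (\<lambda>p. \<theta> (fst p) * v (t - Y p))" "integrable Q (\<lambda>p. \<theta> (fst p) * Ukr (t - Y p))"
  proof -
    show "integrable Q (\<lambda>p. \<theta> (fst p) * v (t - Y p))"
      using B(2) v_bounds by (intro integrable_Q_le[where B=B and C="1 / b" and t=t]) auto
    show "integrable Q (\<lambda>p. \<theta> (fst p) * Ukr (t - Y p))"
      using B(2) Ukr_bounds by (intro integrable_Q_le[where B=B and C=1 and t=t]) auto
  qed
  have "b * (LINT p|Q. \<theta> (fst p) * v (t - Y p)) + (LINT p|Q. \<theta> (fst p) * Ukr (t - Y p)) =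
      (LINT p|Q. b * (\<theta> (fst p) * v (t - Y p)) + \<theta> (fst p) * Ukr (t - Y p))"
    using iv by (subst Bochner_Integration.integral_add) auto
  also have "\<dots> = (LINT p|Q. \<theta> (fst p) * indicator {..t} (Y p))"
  proof (rule integral_cong_AE)
    show "AE p in Q. b * (\<theta> (fst p) * v (t - Y p)) + \<theta> (fst p) * Ukr (t - Y p) = \<theta> (fst p) * indicator {..t} (Y p)"
      using AE_Y_neq[of t]
    proof eventually_elim
      case (elim p)
      have "b * (\<theta> (fst p) * v (t - Y p)) + \<theta> (fst p) * Ukr (t - Y p) = \<theta> (fst p) * (b * v (t - Y p) + Ukr (t - Y p))"
        by (simp add: algebra_simps)
      also have "\<dots> = \<theta> (fst p) * indicator {..t} (Y p)"
        using elim by (simp add: v_Ukr indicator_def)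
      finally show ?case .
    qed
  qed measurable
  finally have A: "b * (LINT p|Q. \<theta> (fst p) * v (t - Y p)) + (LINT p|Q. \<theta> (fst p) * Ukr (t - Y p)) = (LINT p|Q. \<theta> (fst p) * indicator {..t} (Y p))" .
  \<comment> \<open>The relation \<open>b * v + Ukr = 1\<close> is used twice: at \<open>t\<close>
    for the boundary term, and at \<open>t - Y p\<close> under the potential integral, where it
    became \<open>A\<close>.\<close>
  have "b * w t + (LINT s|lborel. indicator {0<..<t} s * (w (t - s) * k s)) =
      \<phi> 0 * (b * v t + Ukr t) + (b * (LINT p|Q. \<theta> (fst p) * v (t - Y p)) + (LINT p|Q. \<theta> (fst p) * Ukr (t - Y p)))"
    unfolding val by (simp add: w_def algebra_simps)
  also have "\<dots> = \<phi> 0 + (LINT p|Q. \<theta> (fst p) * indicator {..t} (Y p))"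
    unfolding A using t by (simp add: v_Ukr)
  finally have total: "b * w t + (LINT s|lborel. indicator {0<..<t} s * (w (t - s) * k s)) = \<phi> 0 + (LINT p|Q. \<theta> (fst p) * indicator {..t} (Y p))" .
  have ae: "AE x in lborel. x \<in> {0<..<t} \<longrightarrow> (u has_real_derivative w x) (at x)"
    using deriv by auto
  show "caputo_djrbashian_exists b \<nu> u t"
    by (rule caputo_eval[OF t _ ae deriv[OF t] int]) measurable
  show "caputo_djrbashian b \<nu> u t = \<phi> 0 + (LINT p|Q. \<theta> (fst p) * indicator {..t} (Y p))"
    using total by (subst caputo_eval[OF t _ ae deriv[OF t] int]) auto
qed

end

end

section \<open>The time-changed process\<close>

text \<open>A power series times an exponential defines the Poisson mean on the whole line, not only
  for nonnegative \<open>x\<close>, so that two-sided derivatives exist also at 0.\<close>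

definition poisson_mix :: "real \<Rightarrow> (nat \<Rightarrow> real) \<Rightarrow> real \<Rightarrow> real" where
  "poisson_mix lam a x = exp (- lam * x) * (\<Sum>k. a k / fact k * (lam * x) ^ k)"

lemma poisson_mix_summable:
  assumes "\<And>k. \<bar>a k\<bar> \<le> C"
  shows "summable (\<lambda>k. a k / fact k * (x :: real) ^ k)"
proof (rule summable_comparison_test)
  show "summable (\<lambda>k. C * (inverse (fact k) * \<bar>x\<bar> ^ k))"
    by (intro summable_mult summable_exp)
  show "\<exists>N. \<forall>n\<ge>N. norm (a n / fact n * x ^ n) \<le> C * (inverse (fact n) * \<bar>x\<bar> ^ n)"
  proof (intro exI allI impI)
    fix n
    have "\<bar>a n\<bar> * (inverse (fact n) * \<bar>x\<bar> ^ n) \<le> C * (inverse (fact n) * \<bar>x\<bar> ^ n)"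
      by (intro mult_right_mono assms) auto
    then show "norm (a n / fact n * x ^ n) \<le> C * (inverse (fact n) * \<bar>x\<bar> ^ n)"
      by (simp add: abs_mult power_abs divide_inverse mult.assoc)
  qed
qed

text \<open>The derivative is again a Poisson mean, of the forward differences: the generator of the
  Poisson process acting on the sequence. Hence differentiation can be repeated, with bounds that
  come from the sequence alone.\<close>

lemma poisson_mix_deriv:
  assumes a: "\<And>k. \<bar>a k\<bar> \<le> C"
  shows "(poisson_mix lam a has_real_derivative lam * poisson_mix lam (\<lambda>k. a (Suc k) - a k) x) (at x)"
proof -
  define g where "g y = (\<Sum>k. a k / fact k * y ^ k)" for y :: real
  have a': "\<And>k. \<bar>a (Suc k)\<bar> \<le> C" using a by blast
  have "(g has_real_derivative (\<Sum>k. diffs (\<lambda>k. a k / fact k) k * y ^ k)) (at y)" for y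
    unfolding g_def[abs_def] by (rule termdiffs_strong_converges_everywhere) (rule poisson_mix_summable[OF a])
  moreover have "diffs (\<lambda>k. a k / fact k) = (\<lambda>k. a (Suc k) / fact k)"
    by (simp add: diffs_def fun_eq_iff del: of_nat_Suc)
  ultimately have "(g has_real_derivative (\<Sum>k. a (Suc k) / fact k * y ^ k)) (at y)" for y by simp
  from DERIV_chain2[OF this, of "\<lambda>x. lam * x" lam x UNIV]
  have g': "((\<lambda>x. g (lam * x)) has_real_derivative (\<Sum>k. a (Suc k) / fact k * (lam * x) ^ k) * lam) (at x)"
    by (auto intro!: derivative_eq_intros)
  have "((\<lambda>x. exp (- lam * x) * g (lam * x)) has_real_derivative
      exp (- lam * x) * (- lam) * g (lam * x) + exp (- lam * x) * ((\<Sum>k. a (Suc k) / fact k * (lam * x) ^ k) * lam)) (at x)"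
    by (rule DERIV_cong, rule DERIV_mult, (rule derivative_eq_intros | rule refl)+, rule g') (simp add: algebra_simps)
  moreover have "(\<Sum>k. a (Suc k) / fact k * (lam * x) ^ k) - g (lam * x) = (\<Sum>k. (a (Suc k) - a k) / fact k * (lam * x) ^ k)"
    unfolding g_def
    by (subst suminf_diff[OF poisson_mix_summable[OF a'] poisson_mix_summable[OF a]])
       (simp add: diff_divide_distrib left_diff_distrib)
  ultimately show ?thesis
    unfolding poisson_mix_def g_def[symmetric] by (auto elim!: DERIV_cong simp flip: poisson_mix_def simp: algebra_simps)
qed

lemma poisson_weights_sum: "(\<Sum>k. (y :: real) ^ k / fact k) = exp y" "summable (\<lambda>k. (y :: real) ^ k / fact k)"
  using exp_converges[of y] by (auto simp: sums_iff divide_inverse mult.commute scaleR_conv_of_real)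

lemma poisson_mix_bound:
  assumes a: "\<And>k. \<bar>a k\<bar> \<le> C" and x: "lam \<ge> 0" "x \<ge> 0"
  shows "\<bar>poisson_mix lam a x\<bar> \<le> C"
proof -
  have bd: "norm (a k / fact k * (lam * x) ^ k) \<le> C * ((lam * x) ^ k / fact k)" for k
  proof -
    have "\<bar>a k\<bar> * ((lam * x) ^ k / fact k) \<le> C * ((lam * x) ^ k / fact k)"
      using x by (intro mult_right_mono a) auto
    then show ?thesis using x by (simp add: abs_mult)
  qed
  have s: "summable (\<lambda>k. C * ((lam * x) ^ k / fact k))"
    by (intro summable_mult poisson_weights_sum)
  have "norm (\<Sum>k. a k / fact k * (lam * x) ^ k) \<le> (\<Sum>k. C * ((lam * x) ^ k / fact k))"
    by (rule norm_suminf_le[OF bd s])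
  also have "\<dots> = C * exp (lam * x)"
    by (subst suminf_mult[OF poisson_weights_sum(2)]) (simp add: poisson_weights_sum)
  finally have "\<bar>poisson_mix lam a x\<bar> \<le> exp (- lam * x) * (C * exp (lam * x))"
    by (simp add: poisson_mix_def abs_mult)
  also have "\<dots> = C" by (simp add: exp_minus field_simps)
  finally show ?thesis .
qed

lemma poisson_mix_nonneg:
  assumes "\<And>k. 0 \<le> a k" "\<And>k. a k \<le> C" "lam \<ge> 0" "x \<ge> 0"
  shows "0 \<le> poisson_mix lam a x"
  unfolding poisson_mix_def using assms
  by (intro mult_nonneg_nonneg suminf_nonneg poisson_mix_summable[of a C]) auto

lemma poisson_mix_measurable:
  assumes "\<And>k. \<bar>a k\<bar> \<le> C"
  shows "poisson_mix lam a \<in> borel_measurable borel"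
  using DERIV_isCont[OF poisson_mix_deriv[OF assms]]
  by (intro borel_measurable_continuous_onI continuous_at_imp_continuous_on) auto

definition poisson_weight :: "real \<Rightarrow> nat \<Rightarrow> real \<Rightarrow> real" where
  "poisson_weight lam k x = (lam * x) ^ k / fact k * exp (- lam * x)"

lemma poisson_weight_measurable[measurable]: "poisson_weight lam k \<in> borel_measurable borel"
  unfolding poisson_weight_def by measurable

lemma poisson_weight_nonneg: "lam \<ge> 0 \<Longrightarrow> x \<ge> 0 \<Longrightarrow> 0 \<le> poisson_weight lam k x"
  by (simp add: poisson_weight_def)

lemma poisson_weight_sum_le:
  assumes "lam \<ge> 0" "x \<ge> 0"
  shows "(\<Sum>i<m. poisson_weight lam i x) \<le> 1"
proof -
  have "(\<Sum>i<m. (lam * x) ^ i / fact i) \<le> (\<Sum>i. (lam * x) ^ i / fact i)"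
    using assms by (intro sum_le_suminf poisson_weights_sum(2)) auto
  then have "(\<Sum>i<m. (lam * x) ^ i / fact i) * exp (- lam * x) \<le> exp (lam * x) * exp (- lam * x)"
    by (intro mult_right_mono) (simp_all add: poisson_weights_sum)
  then show ?thesis by (simp add: poisson_weight_def sum_distrib_right exp_minus)
qed

lemma poisson_weight_le_1:
  assumes "lam \<ge> 0" "x \<ge> 0"
  shows "poisson_weight lam m x \<le> 1"
proof -
  have "poisson_weight lam m x \<le> (\<Sum>i<Suc m. poisson_weight lam i x)"
    using poisson_weight_nonneg[OF assms] by (intro member_le_sum) auto
  also have "\<dots> \<le> 1" by (rule poisson_weight_sum_le[OF assms])
  finally show ?thesis .
qed

lemma poisson_mix_suminf:
  assumes "\<And>k. \<bar>a k\<bar> \<le> C"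
  shows "poisson_mix lam a x = (\<Sum>k. a k * poisson_weight lam k x)"
    "summable (\<lambda>k. a k * poisson_weight lam k x)"
proof -
  have *: "a k * poisson_weight lam k x = exp (- lam * x) * (a k / fact k * (lam * x) ^ k)" for k
    by (simp add: poisson_weight_def)
  show "poisson_mix lam a x = (\<Sum>k. a k * poisson_weight lam k x)"
    unfolding poisson_mix_def * by (rule suminf_mult[symmetric, OF poisson_mix_summable[OF assms]])
  show "summable (\<lambda>k. a k * poisson_weight lam k x)"
    unfolding * by (rule summable_mult[OF poisson_mix_summable[OF assms]])
qed

text \<open>The grid point assigned to \<open>x\<close> lies strictly to the right of \<open>x\<close>, so that right continuity applies.\<close>
definition grid_index :: "nat \<Rightarrow> real \<Rightarrow> nat" where "grid_index j x = nat \<lfloor>real (Suc j) * x\<rfloor>"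

definition grid_time :: "nat \<Rightarrow> nat \<Rightarrow> real" where "grid_time j i = (real i + 1) / real (Suc j)"

lemma grid_time_pos: "0 < grid_time j i" by (simp add: grid_time_def)

lemma grid_time_bounds:
  assumes "x \<ge> 0"
  shows "x < grid_time j (grid_index j x)" "grid_time j (grid_index j x) \<le> x + 1 / Suc j"
proof -
  have e: "real (grid_index j x) = of_int \<lfloor>real (Suc j) * x\<rfloor>"
    using assms by (simp add: grid_index_def del: of_nat_Suc)
  have "real (Suc j) * x < of_int \<lfloor>real (Suc j) * x\<rfloor> + 1" "of_int \<lfloor>real (Suc j) * x\<rfloor> \<le> real (Suc j) * x"
    by linarith+
  then have "x * real (Suc j) < real (grid_index j x) + 1" "real (grid_index j x) + 1 \<le> (x + 1 / Suc j) * real (Suc j)"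
    unfolding e by (auto simp: algebra_simps simp del: of_nat_Suc)
  then show "x < grid_time j (grid_index j x)" "grid_time j (grid_index j x) \<le> x + 1 / Suc j"
    unfolding grid_time_def by (auto simp: pos_less_divide_eq pos_divide_le_eq simp del: of_nat_Suc)
qed

lemma grid_time_at_right:
  assumes "x \<ge> 0"
  shows "filterlim (\<lambda>j. grid_time j (grid_index j x)) (at_right x) sequentially"
proof (rule tendsto_imp_filterlim_at_right)
  show "(\<lambda>j. grid_time j (grid_index j x)) \<longlonglongrightarrow> x"
  proof (rule tendsto_sandwich[where f="\<lambda>_. x" and h="\<lambda>j. x + 1 / real (Suc j)"])
    show "(\<lambda>j. x + 1 / real (Suc j)) \<longlonglongrightarrow> x" by real_asymp
  qed (use grid_time_bounds[OF assms] in \<open>auto intro!: always_eventually simp: less_imp_le\<close>)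
qed (use grid_time_bounds[OF assms] in \<open>auto intro!: always_eventually\<close>)

text \<open>Monotonicity decides both sides of the passage time. At \<open>r = e\<close> itself
  either inequality may hold, depending on how the path crosses the level; a single \<open>r\<close>
  does not affect integrals over \<open>r\<close>.\<close>

lemma first_passage:
  fixes d :: "real \<Rightarrow> real" and t :: real
  assumes mono: "mono_on {0..} d" and unb: "\<exists>r\<ge>0. t < d r"
  defines "e \<equiv> Inf {r. 0 \<le> r \<and> t < d r}"
  shows "0 \<le> e" "\<And>r. 0 \<le> r \<Longrightarrow> r < e \<Longrightarrow> d r \<le> t" "\<And>r. e < r \<Longrightarrow> t < d r"
proof -
  have ne: "{r. 0 \<le> r \<and> t < d r} \<noteq> {}" using unb by auto
  have bdd: "bdd_below {r. 0 \<le> r \<and> t < d r}" by (intro bdd_belowI[of _ 0]) auto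
  show "0 \<le> e" unfolding e_def using ne by (intro cInf_greatest) auto
  show "d r \<le> t" if "0 \<le> r" "r < e" for r
  proof (rule ccontr)
    assume "\<not> d r \<le> t"
    then have "e \<le> r" unfolding e_def using that bdd by (intro cInf_lower) auto
    then show False using that by simp
  qed
  show "t < d r" if "e < r" for r
  proof -
    from that have "\<exists>y\<in>{r. 0 \<le> r \<and> t < d r}. y < r"
      using cInf_less_iff[OF ne bdd] unfolding e_def by blast
    then obtain r' where "0 \<le> r'" "t < d r'" "r' < r" by blast
    then show ?thesis using mono_onD[OF mono, of r' r] by auto
  qed
qed

section \<open>The subordinator, a measurable version and its inverse\<close>

locale subordinator_process = prob_space M + bernstein_function b \<nu> for M :: "'a measure" and b \<nu> +
  fixes D :: "real \<Rightarrow> 'a \<Rightarrow> real"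
  assumes D: "levy_subordinator M (bernstein b \<nu>) D"
begin

lemma D_measurable: "t \<ge> 0 \<Longrightarrow> D t \<in> borel_measurable M"
  using D by (simp add: levy_subordinator_def levy_process_def)

lemma D_laplace: "t \<ge> 0 \<Longrightarrow> s > 0 \<Longrightarrow> (LINT \<omega>|M. exp (- s * D t \<omega>)) = exp (- t * f s)"
  using D by (simp add: levy_subordinator_def f_def)

lemma AE_D_path: "AE \<omega> in M. D 0 \<omega> = 0 \<and> (\<forall>t\<ge>0. ((\<lambda>t. D t \<omega>) \<longlongrightarrow> D t \<omega>) (at_right t)) \<and> mono_on {0..} (\<lambda>t. D t \<omega>)"
proof -
  have "AE \<omega> in M. D 0 \<omega> = 0" "AE \<omega> in M. cadlag_path (\<lambda>t. D t \<omega>)" "AE \<omega> in M. mono_on {0..} (\<lambda>t. D t \<omega>)"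
    using D by (auto simp: levy_subordinator_def levy_process_def)
  then show ?thesis by eventually_elim (simp add: cadlag_path_def)
qed

lemma AE_D_nonneg: "t \<ge> 0 \<Longrightarrow> AE \<omega> in M. 0 \<le> D t \<omega>"
  using AE_D_path
proof eventually_elim
  case (elim \<omega>)
  then have "D 0 \<omega> \<le> D t \<omega>" by (intro mono_onD[of "{0..}" "\<lambda>t. D t \<omega>"]) auto
  then show ?case using elim by simp
qed

text \<open>The paths of \<open>D\<close> are right continuous only almost surely, so \<open>D\<close> itself need not be jointly
  measurable; \<open>Z\<close> is a version of \<open>D\<close> that is.\<close>
definition Z :: "real \<Rightarrow> 'a \<Rightarrow> real" where
  "Z r \<omega> = max 0 (lim (\<lambda>j. D (grid_time j (grid_index j r)) \<omega>))"

lemma AE_Z: "AE \<omega> in M. \<forall>r\<ge>0. Z r \<omega> = D r \<omega>"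
  using AE_D_path
proof eventually_elim
  case (elim \<omega>)
  show ?case
  proof (intro allI impI)
    fix r :: real assume r: "r \<ge> 0"
    have "(\<lambda>j. D (grid_time j (grid_index j r)) \<omega>) \<longlonglongrightarrow> D r \<omega>"
      using elim r grid_time_at_right[OF r] by (auto intro: filterlim_compose[of "\<lambda>t. D t \<omega>"])
    moreover have "D 0 \<omega> \<le> D r \<omega>" using elim r by (intro mono_onD[of "{0..}" "\<lambda>t. D t \<omega>"]) auto
    ultimately show "Z r \<omega> = D r \<omega>" using elim by (simp add: Z_def limI)
  qed
qed

text \<open>For fixed \<open>j\<close> the grid approximation takes, as a function of the time, one
  random variable for each of countably many indices, hence is jointly measurable; the limit
  inherits this.\<close>

lemma Z_joint_measurable: "(\<lambda>p. Z (fst p) (snd p)) \<in> borel_measurable (borel \<Otimes>\<^sub>M M)"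
proof -
  have [measurable]: "D (grid_time j i) \<in> borel_measurable M" for i j
    using grid_time_pos[of j i] by (intro D_measurable) simp
  have "(\<lambda>p :: real \<times> 'a. D (grid_time j (grid_index j (fst p))) (snd p)) \<in> borel_measurable (borel \<Otimes>\<^sub>M M)" for j
  proof (rule measurable_compose_countable)
    show "(\<lambda>p :: real \<times> 'a. grid_index j (fst p)) \<in> borel \<Otimes>\<^sub>M M \<rightarrow>\<^sub>M count_space UNIV"
      unfolding grid_index_def by measurable
  qed measurable
  then show ?thesis unfolding Z_def
    by (intro borel_measurable_max borel_measurable_const borel_measurable_lim_metric)
qed

sublocale subordinator_marginals b \<nu> M Z
proof
  show "(\<lambda>p. Z (fst p) (snd p)) \<in> borel_measurable (borel \<Otimes>\<^sub>M M)" by (rule Z_joint_measurable)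
  show "0 \<le> Z r \<omega>" for r \<omega> by (simp add: Z_def)
  fix r s :: real assume rs: "r > 0" "s > 0"
  have [measurable]: "Z r \<in> borel_measurable M"
    using measurable_compose[OF measurable_Pair1' Z_joint_measurable, of r] by simp
  have [measurable]: "D r \<in> borel_measurable M" using rs by (intro D_measurable) simp
  have "(LINT \<omega>|M. exp (- s * Z r \<omega>)) = (LINT \<omega>|M. exp (- s * D r \<omega>))"
    using rs by (intro integral_cong_AE, measurable, use AE_Z in eventually_elim) auto
  then show "(LINT \<omega>|M. exp (- s * Z r \<omega>)) = exp (- r * f s)" using D_laplace[of r s] rs by simp
qed

text \<open>By the exponential Markov inequality the event that \<open>D\<close> stays below
  \<open>m\<close> at all integer times has probability at most
  \<open>exp m * exp (- j * f 1)\<close> for every \<open>j\<close>. It guarantees that the infimum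
  in \<open>inverse_process\<close> is taken over a nonempty set.\<close>

lemma AE_D_unbounded: "AE \<omega> in M. \<forall>t. \<exists>r\<ge>0. t < D r \<omega>"
proof -
  have [measurable]: "D (real j) \<in> borel_measurable M" for j by (rule D_measurable) simp
  have "AE \<omega> in M. \<not> (\<forall>j. D (real j) \<omega> \<le> real m)" for m
  proof -
    define p where "p = prob {\<omega> \<in> space M. \<forall>j. D (real j) \<omega> \<le> real m}"
    have "p \<le> exp (real m) * exp (- real j * f 1)" for j
    proof -
      have i: "integrable M (\<lambda>\<omega>. exp (- 1 * D (real j) \<omega>))"
        using AE_D_nonneg[of "real j"] by (intro integrable_const_bound[where B=1]) (auto elim!: eventually_mono)
      have "p = (LINT \<omega>|M. indicator {\<omega> \<in> space M. \<forall>j. D (real j) \<omega> \<le> real m} \<omega>)"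
        by (simp add: p_def)
      also have "\<dots> \<le> (LINT \<omega>|M. exp (real m) * exp (- 1 * D (real j) \<omega>))"
      proof (rule integral_mono)
        show "integrable M (\<lambda>\<omega>. exp (real m) * exp (- 1 * D (real j) \<omega>))" using i by simp
        show "indicator {\<omega> \<in> space M. \<forall>j. D (real j) \<omega> \<le> real m} \<omega> \<le> exp (real m) * exp (- 1 * D (real j) \<omega>)" for \<omega>
          by (auto simp: exp_add[symmetric] split: split_indicator)
      qed (auto intro!: integrable_real_indicator simp: emeasure_eq_measure)
      also have "\<dots> = exp (real m) * exp (- real j * f 1)" using D_laplace[of "real j" 1] by simp
      finally show ?thesis .
    qed
    then have "\<exists>N. \<forall>j\<ge>N. p \<le> exp (real m) * exp (- real j * f 1)" by blast
    moreover have "(\<lambda>j. exp (real m) * exp (- real j * f 1)) \<longlonglongrightarrow> 0"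
      using f_pos[of 1] by real_asymp
    ultimately have "p \<le> 0" by (rule LIMSEQ_le_const[rotated])
    then show ?thesis
      unfolding p_def by (intro AE_I[where N="{\<omega> \<in> space M. \<forall>j. D (real j) \<omega> \<le> real m}"])
        (auto simp: emeasure_eq_measure measure_le_0_iff)
  qed
  then have "AE \<omega> in M. \<forall>m. \<not> (\<forall>j. D (real j) \<omega> \<le> real m)" by (simp add: AE_all_countable)
  then show ?thesis
  proof eventually_elim
    case (elim \<omega>)
    show ?case
    proof
      fix t :: real
      obtain m :: nat where "t < m" using reals_Archimedean2 by blast
      moreover obtain j where "real m < D (real j) \<omega>" using elim by (auto simp: not_le)
      ultimately show "\<exists>r\<ge>0. t < D r \<omega>" by (intro exI[of _ "real j"]) auto
    qed
  qed
qed

text \<open>The path properties used do not refer to \<open>t\<close>, so one null set serves all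
  \<open>t\<close> simultaneously.\<close>

lemma AE_inverse_process:
  "AE \<omega> in M. \<forall>t. 0 \<le> inverse_process D t \<omega> \<and>
    (\<forall>r\<ge>0. r \<noteq> inverse_process D t \<omega> \<longrightarrow> (Z r \<omega> \<le> t \<longleftrightarrow> r < inverse_process D t \<omega>))"
  using AE_D_path AE_D_unbounded AE_Z
proof eventually_elim
  case (elim \<omega>)
  then have mono: "mono_on {0..} (\<lambda>t. D t \<omega>)" and unb: "\<exists>r\<ge>0. t < D r \<omega>" for t by auto
  show ?case
  proof (intro allI conjI impI)
    fix t
    note fp = first_passage[OF mono unb[of t], folded inverse_process_def]
    show "0 \<le> inverse_process D t \<omega>" by (rule fp(1))
    fix r :: real assume r: "0 \<le> r" "r \<noteq> inverse_process D t \<omega>"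
    have "Z r \<omega> = D r \<omega>" using elim r by simp
    then show "Z r \<omega> \<le> t \<longleftrightarrow> r < inverse_process D t \<omega>"
      using fp(2)[OF r(1)] fp(3)[of r] r by (cases "r < inverse_process D t \<omega>") (auto simp: not_less)
  qed
qed

text \<open>Pathwise, \<open>\<beta> (E t) = \<beta> 0 + \<integral> \<beta>' (r) 1{D r \<le> t} dr\<close>.\<close>
lemma expectation_inverse_process:
  assumes E[measurable]: "inverse_process D t \<in> borel_measurable M"
    and \<beta>: "\<And>r. (\<beta> has_real_derivative \<beta>' r) (at r)" "\<And>r. isCont \<beta>' r"
    and B: "\<And>r. r \<ge> 0 \<Longrightarrow> \<bar>\<beta>' r\<bar> \<le> B"
    and int: "integrable M (\<lambda>\<omega>. \<beta> (inverse_process D t \<omega>))"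
  shows "(LINT \<omega>|M. \<beta> (inverse_process D t \<omega>)) = \<beta> 0 + (LINT p|Q. \<beta>' (fst p) * indicator {..t} (Y p))"
proof -
  have [measurable]: "\<beta> \<in> borel_measurable borel" "\<beta>' \<in> borel_measurable borel"
    using \<beta>(1)[THEN DERIV_isCont] \<beta>(2)
    by (auto intro!: borel_measurable_continuous_onI continuous_at_imp_continuous_on)
  have i: "integrable (pos \<Otimes>\<^sub>M M) (\<lambda>(r, \<omega>). \<beta>' r * indicator {..t} (Z r \<omega>))"
    using integrable_Q_le[of \<beta>' B "indicator {..t}" 1 t] B
    by (simp add: Q_def Y_def split_beta' indicator_def)
  have "(LINT p|Q. \<beta>' (fst p) * indicator {..t} (Y p)) = (LINT \<omega>|M. (LINT r|pos. \<beta>' r * indicator {..t} (Z r \<omega>)))"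
    using posM.integral_snd[OF i] by (simp add: Q_def Y_def split_beta')
  also have "\<dots> = (LINT \<omega>|M. \<beta> (inverse_process D t \<omega>) - \<beta> 0)"
  proof (rule integral_cong_AE)
    show "AE \<omega> in M. (LINT r|pos. \<beta>' r * indicator {..t} (Z r \<omega>)) = \<beta> (inverse_process D t \<omega>) - \<beta> 0"
      using AE_inverse_process AE_space
    proof eventually_elim
      case (elim \<omega>)
      define e where "e = inverse_process D t \<omega>"
      have [measurable]: "(\<lambda>r. Z r \<omega>) \<in> borel_measurable borel"
        using measurable_compose[OF measurable_Pair2' Z_joint_measurable, of \<omega>] elim(2) by simp
      have e: "0 \<le> e" "\<And>r. r \<ge> 0 \<Longrightarrow> r \<noteq> e \<Longrightarrow> Z r \<omega> \<le> t \<longleftrightarrow> r < e" using elim(1) unfolding e_def by auto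
      have "(LINT r|pos. \<beta>' r * indicator {..t} (Z r \<omega>)) = (LINT r|lborel. indicator {0<..} r * (\<beta>' r * indicator {..t} (Z r \<omega>)))"
        using integral_density[of "\<lambda>r. \<beta>' r * indicator {..t} (Z r \<omega>)" lborel "indicator {0<..}"]
        by (simp add: pos_def ennreal_indicator)
      also have "\<dots> = (LINT r|lborel. \<beta>' r * indicator {0..e} r)"
      proof (rule integral_cong_AE)
        show "AE r in lborel. indicator {0<..} r * (\<beta>' r * indicator {..t} (Z r \<omega>)) = \<beta>' r * indicator {0..e} r"
          using AE_lborel_singleton[of "0::real"] AE_lborel_singleton[of e]
        proof eventually_elim
          case (elim r)
          then show ?case using e(2)[of r] by (cases "r > 0") (auto simp: indicator_def)
        qed
      qed measurable
      also have "\<dots> = \<beta> e - \<beta> 0"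
        using \<beta> e(1) by (intro integral_FTC_Icc_real) auto
      finally show ?case by (simp add: e_def)
    qed
  qed measurable
  also have "\<dots> = (LINT \<omega>|M. \<beta> (inverse_process D t \<omega>)) - \<beta> 0"
    using int by (subst Bochner_Integration.integral_diff) (auto simp: prob_space)
  finally show ?thesis by simp
qed

end

lemma sets_generated_events:
  "sets (sigma (space M) {Z i -` A \<inter> space M | i A. i \<in> I \<and> A \<in> sets borel}) = generated_events M Z I"
  unfolding generated_events_def by (rule sets_measure_of) auto

text \<open>Lets the library's measurability rules work inside the generated sigma-algebra, for
  instance to place an event about a sum of jumps in it.\<close>

lemma measurable_generated:
  fixes Z :: "'i \<Rightarrow> 'a \<Rightarrow> real" and M :: "'a measure"
  assumes "i \<in> I"
  shows "Z i \<in> borel_measurable (sigma (space M) {Z i -` A \<inter> space M | i A. i \<in> I \<and> A \<in> sets borel})"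
    (is "_ \<in> borel_measurable ?S")
proof (rule measurableI)
  have sp: "space ?S = space M" by (rule space_measure_of) auto
  fix A :: "real set" assume "A \<in> sets borel"
  then show "Z i -` A \<inter> space ?S \<in> sets ?S"
    unfolding sp using assms by (subst sets_measure_of) (auto intro!: sigma_sets.Basic)
qed simp

text \<open>The event in \<open>mass_function\<close> need not be measurable; it is evaluated
  through a measurable set from which it differs by a null set.\<close>

lemma measure_completion_AE_eq:
  assumes S': "S' \<in> sets M" and S: "S \<subseteq> space M" and ae: "AE x in M. x \<in> S \<longleftrightarrow> x \<in> S'"
  shows "measure (completion M) S = measure M S'"
proof -
  have ae': "AE x in completion M. x \<in> S' \<longleftrightarrow> x \<in> S"
    unfolding AE_completion_iff using ae by eventually_elim simp
  have m': "S' \<in> sets (completion M)" using S' by (rule sets_completionI_sets)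
  have m: "S \<in> sets (completion M)"
    by (rule completion.in_sets_AE[OF ae' m']) (use S in simp)
  have "measure (completion M) S = measure (completion M) S'"
    using ae' m m' by (intro measure_eq_AE) (auto elim!: eventually_mono)
  also have "\<dots> = measure M S'" using S' by (simp add: measure_completion)
  finally show ?thesis .
qed

section \<open>The mass function of the compound process\<close>

locale fractional_compound_poisson = subordinator_process M b \<nu> D for M :: "'a measure" and b \<nu> D +
  fixes lam :: real and F :: "real measure" and E :: "real \<Rightarrow> 'a \<Rightarrow> real"
    and N :: "real \<Rightarrow> 'a \<Rightarrow> nat" and X :: "nat \<Rightarrow> 'a \<Rightarrow> real"
  assumes E: "E = inverse_process D" and lam: "0 < lam" and N: "poisson_process M lam N"
    and X_law: "\<And>i. 1 \<le> i \<Longrightarrow> X i \<in> borel_measurable M \<and> distr M borel (X i) = F"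
    and X_indep: "indep_vars (\<lambda>_. borel) X {1..}"
    and indep_N_E: "indep_set (generated_events M (\<lambda>t \<omega>. real (N t \<omega>)) {0..}) (generated_events M E {0..})"
    and indep_X_NE: "indep_set (generated_events M X {1..})
      (sigma_sets (space M) (generated_events M (\<lambda>t \<omega>. real (N t \<omega>)) {0..} \<union> generated_events M E {0..}))"
begin

lemma X_measurable[measurable]: "X (Suc i) \<in> borel_measurable M" using X_law[of "Suc i"] by simp

lemma N_measurable: "t \<ge> 0 \<Longrightarrow> (\<lambda>\<omega>. real (N t \<omega>)) \<in> borel_measurable M"
  using N by (simp add: poisson_process_def levy_process_def)

lemma N_measurable_count: "t \<ge> 0 \<Longrightarrow> N t \<in> M \<rightarrow>\<^sub>M count_space UNIV"
proof -
  assume "t \<ge> 0"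
  from N_measurable[OF this] have "(\<lambda>\<omega>. nat \<lfloor>real (N t \<omega>)\<rfloor>) \<in> M \<rightarrow>\<^sub>M count_space UNIV" by measurable
  then show ?thesis by simp
qed

text \<open>Extracted from independence: \<open>indep_set\<close> requires its arguments to consist
  of events.\<close>

lemma E_measurable: "t \<ge> 0 \<Longrightarrow> E t \<in> borel_measurable M"
proof (rule measurableI)
  fix A :: "real set" assume t: "t \<ge> 0" and A: "A \<in> sets borel"
  have "E t -` A \<inter> space M \<in> generated_events M E {0..}"
    unfolding generated_events_def using t A by (intro sigma_sets.Basic) auto
  then show "E t -` A \<inter> space M \<in> sets M" using indep_setD_ev2[OF indep_N_E] by auto
qed simp

lemma prob_N: "t > 0 \<Longrightarrow> prob {\<omega> \<in> space M. N t \<omega> = m} = poisson_weight lam m t"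
proof -
  assume t: "t > 0"
  have [measurable]: "N t \<in> M \<rightarrow>\<^sub>M count_space UNIV" using t by (intro N_measurable_count) simp
  have "prob {\<omega> \<in> space M. N t \<omega> = m} = measure (distr M (count_space UNIV) (N t)) {m}"
    by (subst measure_distr) (auto simp: vimage_def intro!: arg_cong[where f=prob])
  also have "\<dots> = pmf (poisson_pmf (lam * t)) m"
    using N t by (simp add: poisson_process_def pmf.rep_eq)
  finally show ?thesis using t lam by (simp add: poisson_weight_def)
qed

lemma AE_N_right_continuous: "AE \<omega> in M. \<forall>t\<ge>0. ((\<lambda>t. real (N t \<omega>)) \<longlongrightarrow> real (N t \<omega>)) (at_right t)"
proof -
  have "AE \<omega> in M. cadlag_path (\<lambda>t. real (N t \<omega>))"
    using N by (simp add: poisson_process_def levy_process_def)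
  then show ?thesis by eventually_elim (simp add: cadlag_path_def)
qed

definition S :: "nat \<Rightarrow> 'a \<Rightarrow> real" where "S m \<omega> = (\<Sum>i = 1..m. X i \<omega>)"

lemma S_measurable[measurable]: "S m \<in> borel_measurable M"
  unfolding S_def using X_law by (intro borel_measurable_sum) auto

definition a :: "real \<Rightarrow> nat \<Rightarrow> real" where "a n m = prob {\<omega> \<in> space M. S m \<omega> = n}"

lemma a_bounds: "0 \<le> a n m" "a n m \<le> 1" "\<bar>a n m\<bar> \<le> 1" by (auto simp: a_def)

lemma gfcpp_eq: "gfcpp N E X t \<omega> = S (N (E t \<omega>) \<omega>) \<omega>" by (simp add: gfcpp_def S_def)

text \<open>Once the random time is replaced by a grid index, the counting process is evaluated at a
  deterministic time, and the two independence hypotheses factor the event into three.\<close>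

lemma prob_S_N_E:
  assumes t: "t \<ge> 0" and s: "s \<ge> 0"
  shows "prob {\<omega> \<in> space M. S m \<omega> = n \<and> N s \<omega> = m \<and> grid_index j (E t \<omega>) = i} =
    a n m * (prob {\<omega> \<in> space M. N s \<omega> = m} * prob {\<omega> \<in> space M. grid_index j (E t \<omega>) = i})"
proof -
  let ?GN = "generated_events M (\<lambda>t \<omega>. real (N t \<omega>)) {0..}" and ?GE = "generated_events M E {0..}"
  let ?G = "sigma_sets (space M) (?GN \<union> ?GE)"
  define A where "A = {\<omega> \<in> space M. S m \<omega> = n}"
  define B where "B = {\<omega> \<in> space M. N s \<omega> = m}"
  define C where "C = {\<omega> \<in> space M. grid_index j (E t \<omega>) = i}"
  have A: "A \<in> generated_events M X {1..}"
  proof -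
    let ?S = "sigma (space M) {X i -` A \<inter> space M | i A. i \<in> {1..} \<and> A \<in> sets borel}"
    have sp: "space ?S = space M" by (rule space_measure_of) auto
    have "S m \<in> borel_measurable ?S"
      unfolding S_def by (intro borel_measurable_sum measurable_generated) auto
    from measurable_sets[OF this, of "{n}"] have "S m -` {n} \<inter> space M \<in> sets ?S" unfolding sp by simp
    also have "S m -` {n} \<inter> space M = A" by (auto simp: A_def)
    finally show ?thesis by (simp only: sets_generated_events)
  qed
  have B: "B \<in> ?GN"
  proof -
    have "B = (\<lambda>\<omega>. real (N s \<omega>)) -` {real m} \<inter> space M" by (auto simp: B_def)
    then show ?thesis unfolding generated_events_def using s by (auto intro!: sigma_sets.Basic exI[of _ s] exI[of _ "{real m}"])
  qed
  have C: "C \<in> ?GE"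
  proof -
    have "(\<lambda>x. grid_index j x) \<in> borel \<rightarrow>\<^sub>M count_space UNIV" unfolding grid_index_def by measurable
    then have "grid_index j -` {i} \<in> sets borel" by (auto dest!: measurable_sets[of _ _ _ "{i}"])
    moreover have "C = E t -` (grid_index j -` {i}) \<inter> space M" by (auto simp: C_def)
    ultimately show ?thesis unfolding generated_events_def using t
      by (auto intro!: sigma_sets.Basic exI[of _ t] exI[of _ "grid_index j -` {i}"])
  qed
  have BC: "B \<inter> C \<in> ?G"
  proof -
    have sub: "?GN \<union> ?GE \<subseteq> Pow (space M)"
      using indep_setD_ev1[OF indep_N_E] indep_setD_ev2[OF indep_N_E] sets.space_closed by blast
    have "B \<in> sets (sigma (space M) (?GN \<union> ?GE))" "C \<in> sets (sigma (space M) (?GN \<union> ?GE))"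
      using B C by (auto simp: sets_measure_of[OF sub] intro: sigma_sets.Basic)
    then have "B \<inter> C \<in> sets (sigma (space M) (?GN \<union> ?GE))" by (rule sets.Int)
    then show ?thesis by (simp only: sets_measure_of[OF sub])
  qed
  have "prob (A \<inter> (B \<inter> C)) = prob A * (prob B * prob C)"
    using indep_setD[OF indep_X_NE A BC] indep_setD[OF indep_N_E B C] by simp
  moreover have "A \<inter> (B \<inter> C) = {\<omega> \<in> space M. S m \<omega> = n \<and> N s \<omega> = m \<and> grid_index j (E t \<omega>) = i}"
    by (auto simp: A_def B_def C_def)
  ultimately show ?thesis by (simp add: A_def B_def C_def a_def)
qed

text \<open>The discretised time has countably many values, so the event is a countable disjoint
  union over the grid index and the number of jumps. Summing over the latter yields the Poisson
  mean, summing over the former the expectation.\<close>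

lemma prob_grid:
  assumes t: "t \<ge> 0"
  defines "h \<equiv> \<lambda>j \<omega>. grid_time j (grid_index j (E t \<omega>))"
  shows "{\<omega> \<in> space M. S (N (h j \<omega>) \<omega>) \<omega> = n} \<in> events"
    "prob {\<omega> \<in> space M. S (N (h j \<omega>) \<omega>) \<omega> = n} = (LINT \<omega>|M. poisson_mix lam (a n) (h j \<omega>))"
proof -
  have [measurable]: "E t \<in> borel_measurable M" by (rule E_measurable[OF t])
  have [measurable]: "(\<lambda>\<omega>. grid_index j (E t \<omega>)) \<in> M \<rightarrow>\<^sub>M count_space UNIV" unfolding grid_index_def by measurable
  have [measurable]: "N (grid_time j i) \<in> M \<rightarrow>\<^sub>M count_space UNIV" for i
    using grid_time_pos[of j i] by (intro N_measurable_count) simp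
  define B where "B i m = {\<omega> \<in> space M. S m \<omega> = n \<and> N (grid_time j i) \<omega> = m \<and> grid_index j (E t \<omega>) = i}" for i m
  define I where "I i = {\<omega> \<in> space M. grid_index j (E t \<omega>) = i}" for i
  have [measurable]: "B i m \<in> events" "I i \<in> events" for i m unfolding B_def I_def by measurable
  have A_eq: "{\<omega> \<in> space M. S (N (h j \<omega>) \<omega>) \<omega> = n} = (\<Union>i. \<Union>m. B i m)"
    by (auto simp: B_def h_def)
  show A: "{\<omega> \<in> space M. S (N (h j \<omega>) \<omega>) \<omega> = n} \<in> events" unfolding A_eq by measurable
  have pm0: "0 \<le> poisson_mix lam (a n) (grid_time j i)" for i
    using grid_time_pos[of j i] lam by (intro poisson_mix_nonneg[of _ 1] a_bounds) auto
  have mm[measurable]: "poisson_mix lam (a n) \<in> borel_measurable borel"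
    by (rule poisson_mix_measurable[of _ 1]) (rule a_bounds)
  have Bi: "emeasure M (\<Union>m. B i m) = ennreal (poisson_mix lam (a n) (grid_time j i)) * emeasure M (I i)" for i
  proof -
    let ?s = "grid_time j i"
    let ?w = "\<lambda>m. a n m * poisson_weight lam m ?s"
    have Bk: "prob (B i m) = ?w m * prob (I i)" for m
      unfolding B_def I_def using prob_S_N_E[OF t, of ?s m n j i] prob_N[OF grid_time_pos, of j i m] grid_time_pos[of j i]
      by simp
    have "(\<lambda>m. prob (B i m)) sums prob (\<Union>m. B i m)"
      by (rule finite_measure_UNION) (auto simp: disjoint_family_on_def, auto simp: B_def)
    then have "prob (\<Union>m. B i m) = (\<Sum>m. ?w m * prob (I i))" by (simp add: sums_iff Bk)
    also have "\<dots> = (\<Sum>m. ?w m) * prob (I i)"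
      by (rule suminf_mult2[symmetric]) (rule poisson_mix_suminf[of _ 1], rule a_bounds)
    also have "(\<Sum>m. ?w m) = poisson_mix lam (a n) ?s"
      by (rule poisson_mix_suminf(1)[of _ 1, symmetric]) (rule a_bounds)
    finally show ?thesis using pm0 by (simp add: emeasure_eq_measure ennreal_mult)
  qed
  have "emeasure M (\<Union>i. \<Union>m. B i m) = (\<Sum>i. emeasure M (\<Union>m. B i m))"
    by (rule suminf_emeasure[symmetric]) (auto simp: disjoint_family_on_def, auto simp: B_def)
  also have "\<dots> = (\<Sum>i. \<integral>\<^sup>+\<omega>. ennreal (poisson_mix lam (a n) (grid_time j i)) * indicator (I i) \<omega> \<partial>M)"
    by (simp add: Bi nn_integral_cmult)
  also have "\<dots> = (\<integral>\<^sup>+\<omega>. (\<Sum>i. ennreal (poisson_mix lam (a n) (grid_time j i)) * indicator (I i) \<omega>) \<partial>M)"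
    by (rule nn_integral_suminf[symmetric]) measurable
  also have "\<dots> = (\<integral>\<^sup>+\<omega>. ennreal (poisson_mix lam (a n) (h j \<omega>)) \<partial>M)"
  proof (rule nn_integral_cong)
    fix \<omega> assume \<omega>: "\<omega> \<in> space M"
    have "(\<Sum>i. ennreal (poisson_mix lam (a n) (grid_time j i)) * indicator (I i) \<omega>) =
        (\<Sum>i\<in>{grid_index j (E t \<omega>)}. ennreal (poisson_mix lam (a n) (grid_time j i)) * indicator (I i) \<omega>)"
      by (rule suminf_finite) (auto simp: I_def)
    then show "(\<Sum>i. ennreal (poisson_mix lam (a n) (grid_time j i)) * indicator (I i) \<omega>) = ennreal (poisson_mix lam (a n) (h j \<omega>))"
      using \<omega> by (simp add: I_def h_def)
  qed
  finally have em: "emeasure M {\<omega> \<in> space M. S (N (h j \<omega>) \<omega>) \<omega> = n} = (\<integral>\<^sup>+\<omega>. ennreal (poisson_mix lam (a n) (h j \<omega>)) \<partial>M)"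
    unfolding A_eq .
  have [measurable]: "h j \<in> borel_measurable M" unfolding h_def grid_time_def by measurable
  have "(LINT \<omega>|M. poisson_mix lam (a n) (h j \<omega>)) = enn2real (\<integral>\<^sup>+\<omega>. ennreal (poisson_mix lam (a n) (h j \<omega>)) \<partial>M)"
    using pm0 by (intro integral_eq_nn_integral) (auto simp: h_def)
  then show "prob {\<omega> \<in> space M. S (N (h j \<omega>) \<omega>) \<omega> = n} = (LINT \<omega>|M. poisson_mix lam (a n) (h j \<omega>))"
    unfolding em[symmetric] by (simp add: measure_def)
qed

text \<open>The grid times approach \<open>E t\<close> strictly from the right. As the counting path
  is right continuous and integer valued, it eventually equals its value at \<open>E t\<close>, so
  the discretised events stabilise almost surely; the Poisson means converge by continuity.\<close>

lemma mass_function_eq: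
  assumes t: "t \<ge> 0"
  shows "mass_function M (gfcpp N E X) n t = (LINT \<omega>|M. poisson_mix lam (a n) (E t \<omega>))"
proof -
  define h where "h j \<omega> = grid_time j (grid_index j (E t \<omega>))" for j \<omega>
  define A where "A j = {\<omega> \<in> space M. S (N (h j \<omega>) \<omega>) \<omega> = n}" for j
  \<comment> \<open>The lower limit of the discretised events: a measurable set that agrees with the
    event of interest outside a null set.\<close>
  define L where "L = {\<omega> \<in> space M. \<exists>J. \<forall>j\<ge>J. \<omega> \<in> A j}"
  note pg = prob_grid[OF t, folded h_def]
  have [measurable]: "A j \<in> events" for j unfolding A_def by (rule pg)
  have [measurable]: "L \<in> events" unfolding L_def by measurable
  have [measurable]: "E t \<in> borel_measurable M" by (rule E_measurable[OF t])
  have [measurable]: "h j \<in> borel_measurable M" for j unfolding h_def grid_time_def grid_index_def by measurable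
  have mm[measurable]: "poisson_mix lam (a n) \<in> borel_measurable borel"
    by (rule poisson_mix_measurable[of _ 1]) (rule a_bounds)
  have E0: "AE \<omega> in M. 0 \<le> E t \<omega>" unfolding E using AE_inverse_process by eventually_elim simp
  have conv: "AE \<omega> in M. \<exists>J. \<forall>j\<ge>J. N (h j \<omega>) \<omega> = N (E t \<omega>) \<omega>"
    using E0 AE_N_right_continuous
  proof eventually_elim
    case (elim \<omega>)
    have "(\<lambda>j. real (N (h j \<omega>) \<omega>)) \<longlonglongrightarrow> real (N (E t \<omega>) \<omega>)"
      unfolding h_def using elim grid_time_at_right[OF elim(1)] by (auto intro: filterlim_compose[of "\<lambda>t. real (N t \<omega>)"])
    then obtain J where "\<forall>j\<ge>J. \<bar>real (N (h j \<omega>) \<omega>) - real (N (E t \<omega>) \<omega>)\<bar> < 1"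
      by (auto dest!: LIMSEQ_D[of _ _ 1])
    then have "\<forall>j\<ge>J. N (h j \<omega>) \<omega> = N (E t \<omega>) \<omega>" by force
    then show ?case by blast
  qed
  have conv': "AE \<omega> in M. \<exists>J. \<forall>j\<ge>J. \<omega> \<in> A j \<longleftrightarrow> gfcpp N E X t \<omega> = n"
    using conv AE_space
  proof eventually_elim
    case (elim \<omega>)
    then obtain J where "\<forall>j\<ge>J. N (h j \<omega>) \<omega> = N (E t \<omega>) \<omega>" by blast
    then show ?case using elim(2) by (intro exI[of _ J]) (simp add: A_def gfcpp_eq)
  qed
  have L_iff: "AE \<omega> in M. \<omega> \<in> {\<omega> \<in> space M. gfcpp N E X t \<omega> = n} \<longleftrightarrow> \<omega> \<in> L"
    using conv' AE_space
  proof eventually_elim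
    case (elim \<omega>)
    then obtain J where J: "\<forall>j\<ge>J. \<omega> \<in> A j \<longleftrightarrow> gfcpp N E X t \<omega> = n" by blast
    have "(\<exists>J. \<forall>j\<ge>J. \<omega> \<in> A j) \<longleftrightarrow> gfcpp N E X t \<omega> = n"
    proof
      assume "\<exists>J. \<forall>j\<ge>J. \<omega> \<in> A j"
      then obtain J' where "\<forall>j\<ge>J'. \<omega> \<in> A j" by blast
      then have "\<omega> \<in> A (max J J')" by simp
      then show "gfcpp N E X t \<omega> = n" using J by simp
    qed (use J in blast)
    then show ?case using elim(2) by (simp add: L_def)
  qed
  have "(\<lambda>j. LINT \<omega>|M. indicator (A j) \<omega> :: real) \<longlonglongrightarrow> (LINT \<omega>|M. indicator L \<omega>)"
  proof (rule integral_dominated_convergence[where w="\<lambda>_. 1"])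
    show "AE \<omega> in M. (\<lambda>j. indicator (A j) \<omega> :: real) \<longlonglongrightarrow> indicator L \<omega>"
      using conv' L_iff AE_space
    proof eventually_elim
      case (elim \<omega>)
      then obtain J where J: "\<forall>j\<ge>J. \<omega> \<in> A j \<longleftrightarrow> gfcpp N E X t \<omega> = n" by blast
      have "indicator (A j) \<omega> = (indicator L \<omega> :: real)" if "j \<ge> J" for j
        using J elim that by (simp add: indicator_def)
      then have "\<forall>\<^sub>F j in sequentially. indicator (A j) \<omega> = (indicator L \<omega> :: real)"
        by (auto simp: eventually_sequentially)
      then show ?case by (rule tendsto_eventually)
    qed
  qed (auto simp: indicator_def)
  then have lim1: "(\<lambda>j. prob (A j)) \<longlonglongrightarrow> prob L" by simp
  have bd: "\<bar>poisson_mix lam (a n) x\<bar> \<le> 1" if "x \<ge> 0" for x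
    using that lam by (intro poisson_mix_bound a_bounds) auto
  have lim2: "(\<lambda>j. LINT \<omega>|M. poisson_mix lam (a n) (h j \<omega>)) \<longlonglongrightarrow> (LINT \<omega>|M. poisson_mix lam (a n) (E t \<omega>))"
  proof (rule integral_dominated_convergence[where w="\<lambda>_. 1"])
    show "AE \<omega> in M. (\<lambda>j. poisson_mix lam (a n) (h j \<omega>)) \<longlonglongrightarrow> poisson_mix lam (a n) (E t \<omega>)"
      using E0
    proof eventually_elim
      case (elim \<omega>)
      have "(\<lambda>j. h j \<omega>) \<longlonglongrightarrow> E t \<omega>"
        unfolding h_def using grid_time_at_right[OF elim] by (simp add: filterlim_at)
      moreover have "isCont (poisson_mix lam (a n)) (E t \<omega>)"
        by (rule DERIV_isCont[OF poisson_mix_deriv[OF a_bounds(3)]])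
      ultimately show ?case by (rule isCont_tendsto_compose[rotated])
    qed
    show "AE \<omega> in M. norm (poisson_mix lam (a n) (h j \<omega>)) \<le> 1" for j
      by (intro AE_I2) (simp add: h_def bd grid_time_pos less_imp_le)
  qed measurable
  have "prob (A j) = (LINT \<omega>|M. poisson_mix lam (a n) (h j \<omega>))" for j
    unfolding A_def by (rule pg)
  then have "prob L = (LINT \<omega>|M. poisson_mix lam (a n) (E t \<omega>))"
    using LIMSEQ_unique[OF lim1] lim2 by simp
  moreover have "mass_function M (gfcpp N E X) n t = prob L"
    unfolding mass_function_def by (rule measure_completion_AE_eq[OF _ _ L_iff]) auto
  ultimately show ?thesis by simp
qed


text \<open>The state probabilities of the time-changed counting process: the law of the number of
  jumps up to time \<open>t\<close>.\<close>

definition q :: "real \<Rightarrow> nat \<Rightarrow> real" where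
  "q t m = (LINT \<omega>|M. poisson_weight lam m (E t \<omega>))"

lemma AE_E_nonneg: "AE \<omega> in M. 0 \<le> E t \<omega>"
  unfolding E using AE_inverse_process by eventually_elim simp

lemma q_facts:
  assumes t: "t \<ge> 0"
  shows "integrable M (\<lambda>\<omega>. poisson_weight lam m (E t \<omega>))" "0 \<le> q t m" "summable (q t)"
proof -
  have [measurable]: "E t \<in> borel_measurable M" by (rule E_measurable[OF t])
  show i: "integrable M (\<lambda>\<omega>. poisson_weight lam m (E t \<omega>))" for m
  proof (rule integrable_const_bound[where B=1])
    show "AE \<omega> in M. norm (poisson_weight lam m (E t \<omega>)) \<le> 1"
      using AE_E_nonneg[of t]
    proof eventually_elim
      case (elim \<omega>)
      show ?case using lam elim by (simp add: poisson_weight_nonneg poisson_weight_le_1)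
    qed
  qed measurable
  show q0: "0 \<le> q t m" for m
    unfolding q_def
    by (intro integral_nonneg_AE, use AE_E_nonneg[of t] in eventually_elim) (use lam in \<open>simp add: poisson_weight_nonneg\<close>)
  have "(\<Sum>i<m. q t i) \<le> 1" for m
  proof -
    have "(\<Sum>i<m. q t i) = (LINT \<omega>|M. (\<Sum>i<m. poisson_weight lam i (E t \<omega>)))"
      unfolding q_def by (rule Bochner_Integration.integral_sum[symmetric]) (rule i)
    also have "\<dots> \<le> (LINT \<omega>|M. 1)"
    proof (rule integral_mono_AE)
      show "AE \<omega> in M. (\<Sum>i<m. poisson_weight lam i (E t \<omega>)) \<le> 1"
        using AE_E_nonneg[of t] by eventually_elim (use lam in \<open>simp add: poisson_weight_sum_le\<close>)
    qed (auto intro!: Bochner_Integration.integrable_sum i)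
    finally show ?thesis by (simp add: prob_space)
  qed
  then show "summable (q t)" using q0 by (intro summableI_nonneg_bounded[of _ 1])
qed

text \<open>Separates the dependence on \<open>t\<close>, carried by \<open>q\<close>, from the
  coefficient sequence. All terms of the final equation become series with the same weights
  \<open>q t m\<close>.\<close>

lemma expectation_poisson_mix:
  assumes t: "t \<ge> 0" and c: "\<And>m. \<bar>c m\<bar> \<le> C"
  shows "(LINT \<omega>|M. poisson_mix lam c (E t \<omega>)) = (\<Sum>m. c m * q t m)" "summable (\<lambda>m. c m * q t m)"
proof -
  let ?w = "\<lambda>m \<omega>. poisson_weight lam m (E t \<omega>)"
  have C: "0 \<le> C" using c[of 0] by simp
  have sq: "summable (\<lambda>m. C * q t m)" using q_facts[OF t] by (intro summable_mult)
  have bq: "\<bar>c m\<bar> * q t m \<le> C * q t m" for m by (intro mult_right_mono c q_facts[OF t])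
  have wabs: "(LINT \<omega>|M. norm (c m * ?w m \<omega>)) = \<bar>c m\<bar> * q t m" for m
  proof -
    have "(LINT \<omega>|M. norm (c m * ?w m \<omega>)) = (LINT \<omega>|M. \<bar>c m\<bar> * ?w m \<omega>)"
    proof (rule integral_cong_AE)
      show "AE \<omega> in M. norm (c m * ?w m \<omega>) = \<bar>c m\<bar> * ?w m \<omega>"
        using AE_E_nonneg[of t]
      proof eventually_elim
        case (elim \<omega>)
        show ?case using lam elim by (simp add: abs_mult poisson_weight_nonneg)
      qed
    qed (use E_measurable[OF t] in measurable)
    then show ?thesis by (simp add: q_def)
  qed
  have "(LINT \<omega>|M. poisson_mix lam c (E t \<omega>)) = (LINT \<omega>|M. (\<Sum>m. c m * ?w m \<omega>))"
    by (simp only: poisson_mix_suminf(1)[OF c])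
  also have "\<dots> = (\<Sum>m. LINT \<omega>|M. c m * ?w m \<omega>)"
  proof (rule integral_suminf)
    show "integrable M (\<lambda>\<omega>. c m * ?w m \<omega>)" for m by (intro integrable_mult_right q_facts[OF t])
    show "AE \<omega> in M. summable (\<lambda>m. norm (c m * ?w m \<omega>))"
      using AE_E_nonneg[of t]
    proof eventually_elim
      case (elim \<omega>)
      have "summable (\<lambda>m. \<bar>c m\<bar> * ?w m \<omega>)"
        by (rule poisson_mix_suminf(2)[where C=C]) (use c in simp)
      moreover have "norm (c m * ?w m \<omega>) = \<bar>c m\<bar> * ?w m \<omega>" for m
        using lam elim by (simp add: abs_mult poisson_weight_nonneg)
      ultimately show ?case by simp
    qed
    show "summable (\<lambda>m. LINT \<omega>|M. norm (c m * ?w m \<omega>))"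
      unfolding wabs using bq q_facts(2)[OF t]
      by (intro summable_comparison_test[OF _ sq]) (auto simp: abs_mult)
  qed
  also have "\<dots> = (\<Sum>m. c m * q t m)" by (simp add: q_def)
  finally show "(LINT \<omega>|M. poisson_mix lam c (E t \<omega>)) = (\<Sum>m. c m * q t m)" .
  show "summable (\<lambda>m. c m * q t m)"
    using bq q_facts(2)[OF t] by (intro summable_comparison_test[OF _ sq]) (auto simp: abs_mult)
qed

lemma a_reflected_measurable[measurable]: "(\<lambda>x. a (n - x) m) \<in> borel_measurable borel"
proof -
  have "a (n - x) m = (LINT \<omega>|M. indicator {S m \<omega>} (n - x))" for x
  proof -
    have "a (n - x) m = (LINT \<omega>|M. indicator {\<omega> \<in> space M. S m \<omega> = n - x} \<omega>)" by (simp add: a_def)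
    also have "\<dots> = (LINT \<omega>|M. indicator {S m \<omega>} (n - x))"
      by (intro Bochner_Integration.integral_cong) (auto split: split_indicator)
    finally show ?thesis .
  qed
  moreover have "(\<lambda>x. LINT \<omega>|M. (if S m \<omega> = n - x then 1 else 0) :: real) \<in> borel_measurable borel" by measurable
  moreover have "indicator {S m \<omega>} (n - x) = (if S m \<omega> = n - x then 1 else (0 :: real))" for x \<omega> by auto
  ultimately show ?thesis by simp
qed

lemma F_eq: "F = distr M borel (X (Suc m))" using X_law[of "Suc m"] by simp

lemma prob_space_F: "prob_space F" unfolding F_eq[of 0] by (rule prob_space_distr) measurable

lemma sets_F[measurable_cong, simp]: "sets F = sets borel" by (simp add: F_eq[of 0])

text \<open>The last jump is independent of the sum of the preceding ones; conditioning on it shows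
  that integration against the jump law raises the number of jumps by one.\<close>

lemma a_Suc: "a n (Suc m) = (LINT x|F. a (n - x) m)"
proof -
  have "indep_vars (\<lambda>_. borel) X (insert (Suc m) {1..m})"
    using X_indep by (rule indep_vars_subset) auto
  then have "indep_var borel (X (Suc m)) borel (\<lambda>\<omega>. \<Sum>i\<in>{1..m}. X i \<omega>)"
    by (intro indep_vars_sum) auto
  then have "indep_var borel (X (Suc m)) borel (S m)" by (simp add: S_def[abs_def])
  then have D: "distr M (borel \<Otimes>\<^sub>M borel) (\<lambda>\<omega>. (X (Suc m) \<omega>, S m \<omega>)) = F \<Otimes>\<^sub>M distr M borel (S m)"
    unfolding indep_var_distribution_eq F_eq[of m] by simp
  interpret F: prob_space F by (rule prob_space_F)
  interpret DS: prob_space "distr M borel (S m)" by (rule prob_space_distr) measurable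
  interpret FS: pair_prob_space F "distr M borel (S m)" ..
  let ?g = "\<lambda>z :: real \<times> real. if fst z + snd z = n then 1 else 0 :: real"
  have i: "integrable (F \<Otimes>\<^sub>M distr M borel (S m)) ?g"
    by (intro FS.P.integrable_const_bound[where B=1]) auto
  have "a n (Suc m) = (LINT \<omega>|M. indicator {\<omega> \<in> space M. S (Suc m) \<omega> = n} \<omega>)" by (simp add: a_def)
  also have "\<dots> = (LINT \<omega>|M. ?g (X (Suc m) \<omega>, S m \<omega>))"
    by (intro Bochner_Integration.integral_cong) (auto simp: S_def add.commute)
  also have "\<dots> = (LINT z|distr M (borel \<Otimes>\<^sub>M borel) (\<lambda>\<omega>. (X (Suc m) \<omega>, S m \<omega>)). ?g z)"
    by (rule integral_distr[symmetric]) measurable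
  also have "\<dots> = (LINT x|F. LINT s|distr M borel (S m). ?g (x, s))"
    unfolding D by (rule FS.integral_fst'[OF i, symmetric])
  also have "\<dots> = (LINT x|F. a (n - x) m)"
  proof (intro Bochner_Integration.integral_cong refl)
    fix x
    have "(LINT s|distr M borel (S m). ?g (x, s)) = (LINT \<omega>|M. ?g (x, S m \<omega>))"
      by (rule integral_distr) measurable
    also have "\<dots> = (LINT \<omega>|M. indicator {\<omega> \<in> space M. S m \<omega> = n - x} \<omega>)"
      by (intro Bochner_Integration.integral_cong) auto
    also have "\<dots> = a (n - x) m" by (simp add: a_def)
    finally show "(LINT s|distr M borel (S m). ?g (x, s)) = a (n - x) m" .
  qed
  finally show ?thesis .
qed

lemma mass_function_suminf:
  assumes "t \<ge> 0"
  shows "mass_function M (gfcpp N E X) n t = (\<Sum>m. a n m * q t m)"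
  using mass_function_eq[OF assms] expectation_poisson_mix(1)[OF assms a_bounds(3)] by simp

text \<open>Sum and integral are exchanged under the summable bound \<open>q t m\<close>;
  \<open>a_Suc\<close> then turns the integral of each coefficient into an index shift.\<close>

lemma integral_mass_function:
  assumes t: "t \<ge> 0"
  shows "(LINT x|F. mass_function M (gfcpp N E X) (n - x) t) = (\<Sum>m. a n (Suc m) * q t m)"
proof -
  interpret F: prob_space F by (rule prob_space_F)
  have i: "integrable F (\<lambda>x. a (n - x) m)" for m
    using a_bounds by (intro F.integrable_const_bound[where B=1]) auto
  have "(LINT x|F. mass_function M (gfcpp N E X) (n - x) t) = (LINT x|F. (\<Sum>m. a (n - x) m * q t m))"
    by (simp add: mass_function_suminf[OF t])
  also have "\<dots> = (\<Sum>m. LINT x|F. a (n - x) m * q t m)"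
  proof (rule integral_suminf)
    show "integrable F (\<lambda>x. a (n - x) m * q t m)" for m using i by simp
    have bound: "norm (a (n - x) m * q t m) \<le> q t m" for x m
      using a_bounds(1,2)[of "n - x" m] q_facts(2)[OF t, of m] by (simp add: abs_mult mult_left_le_one_le)
    show "AE x in F. summable (\<lambda>m. norm (a (n - x) m * q t m))"
      using bound by (intro AE_I2 summable_comparison_test[OF _ q_facts(3)[OF t]]) auto
    have "(LINT x|F. norm (a (n - x) m * q t m)) \<le> (LINT x|F. q t m)" for m
      using i by (intro integral_mono integrable_norm bound) auto
    then have "(LINT x|F. norm (a (n - x) m * q t m)) \<le> q t m" for m by (simp add: F.prob_space)
    then show "summable (\<lambda>m. LINT x|F. norm (a (n - x) m * q t m))"
      by (intro summable_comparison_test[OF _ q_facts(3)[OF t]]) (auto intro!: exI[of _ 0])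
  qed
  also have "\<dots> = (\<Sum>m. a n (Suc m) * q t m)" by (simp add: a_Suc)
  finally show ?thesis .
qed

text \<open>With and without drift the Caputo derivative equals the same potential expression in
  \<open>\<phi>\<close> and its derivative, which is the expectation of \<open>\<phi>\<close> at
  \<open>E t\<close>. Since \<open>\<phi>\<close> is \<open>lam\<close> times the Poisson mean of
  \<open>a n (Suc m) - a n m\<close>, the two parts of the difference are the two terms of the
  equation.\<close>

theorem caputo_mass_function:
  assumes ac: "abs_continuous_on_halfline (mass_function M (gfcpp N E X) n)" and t: "t > 0"
  shows "caputo_djrbashian_exists b \<nu> (mass_function M (gfcpp N E X) n) t"
    and "caputo_djrbashian b \<nu> (mass_function M (gfcpp N E X) n) t =
      - lam * mass_function M (gfcpp N E X) n t + lam * (LINT x|F. mass_function M (gfcpp N E X) (n - x) t)"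
proof -
  define u where "u = mass_function M (gfcpp N E X) n"
  define d where "d m = a n (Suc m) - a n m" for m
  define dd where "dd m = d (Suc m) - d m" for m
  define \<psi> where "\<psi> = poisson_mix lam (a n)"
  define \<phi> where "\<phi> r = lam * poisson_mix lam d r" for r
  define \<theta> where "\<theta> r = lam * (lam * poisson_mix lam dd r)" for r
  \<comment> \<open>The sum of the bounds for \<open>\<psi>\<close>, \<open>\<phi>\<close> and
    \<open>\<theta>\<close>: each derivative brings a factor \<open>lam\<close>, and the sequences
    \<open>a n\<close>, \<open>d\<close>, \<open>dd\<close> are bounded by 1, 1 and 2. A single
    constant bounds all three functions.\<close>
  define B where "B = 1 + lam + lam * (lam * 2)"
  have d1: "\<bar>d m\<bar> \<le> 1" for m using a_bounds[of n m] a_bounds[of n "Suc m"] by (simp add: d_def abs_le_iff)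
  have dd2: "\<bar>dd m\<bar> \<le> 2" for m using d1[of m] d1[of "Suc m"] by (simp add: dd_def abs_le_iff)
  have \<psi>: "(\<psi> has_real_derivative \<phi> r) (at r)" for r
    unfolding \<psi>_def \<phi>_def d_def by (rule poisson_mix_deriv[OF a_bounds(3)])
  have \<phi>: "(\<phi> has_real_derivative \<theta> r) (at r)" for r
    unfolding \<phi>_def[abs_def] \<theta>_def dd_def by (rule DERIV_cmult[OF poisson_mix_deriv[OF d1]])
  have \<theta>c: "isCont \<theta> r" for r
    unfolding \<theta>_def[abs_def] by (intro continuous_intros DERIV_isCont[OF poisson_mix_deriv[OF dd2]])
  then have \<theta>[measurable]: "\<theta> \<in> borel_measurable borel"
    by (intro borel_measurable_continuous_onI continuous_at_imp_continuous_on) auto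
  have bd: "\<bar>\<psi> r\<bar> \<le> 1" "\<bar>\<phi> r\<bar> \<le> lam" "\<bar>\<theta> r\<bar> \<le> lam * (lam * 2)" if "r \<ge> 0" for r
  proof -
    show "\<bar>\<psi> r\<bar> \<le> 1" unfolding \<psi>_def using lam that by (intro poisson_mix_bound a_bounds) auto
    have "\<bar>poisson_mix lam d r\<bar> \<le> 1" using lam that by (intro poisson_mix_bound d1) auto
    then show "\<bar>\<phi> r\<bar> \<le> lam" using lam by (simp add: \<phi>_def abs_mult)
    have "\<bar>poisson_mix lam dd r\<bar> \<le> 2" using lam that by (intro poisson_mix_bound dd2) auto
    then show "\<bar>\<theta> r\<bar> \<le> lam * (lam * 2)" using lam by (simp add: \<theta>_def abs_mult)
  qed
  have "0 \<le> lam * (lam * 2)" using lam by simp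
  then have B: "\<bar>\<psi> r\<bar> \<le> B" "\<bar>\<phi> r\<bar> \<le> B" "\<bar>\<theta> r\<bar> \<le> B" if "r \<ge> 0" for r
    using bd[OF that] lam by (auto simp: B_def)
  have iE: "integrable M (\<lambda>\<omega>. g (E x \<omega>))"
    if "x \<ge> 0" "\<And>r. isCont g r" "\<And>r. r \<ge> 0 \<Longrightarrow> \<bar>g r\<bar> \<le> B" for g :: "real \<Rightarrow> real" and x
  proof (rule integrable_const_bound[where B=B])
    show "AE \<omega> in M. norm (g (E x \<omega>)) \<le> B" using AE_E_nonneg[of x] by eventually_elim (simp add: that(3))
    have "g \<in> borel_measurable borel"
      using that(2) by (intro borel_measurable_continuous_onI continuous_at_imp_continuous_on) auto
    then show "(\<lambda>\<omega>. g (E x \<omega>)) \<in> borel_measurable M"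
      by (rule measurable_compose[OF E_measurable[OF that(1)]])
  qed
  have u: "u x = \<psi> 0 + (LINT p|Q. \<phi> (fst p) * indicator {..x} (Y p))" if x: "x \<ge> 0" for x
  proof -
    have "(LINT \<omega>|M. \<psi> (E x \<omega>)) = \<psi> 0 + (LINT p|Q. \<phi> (fst p) * indicator {..x} (Y p))"
      using E_measurable[OF x] iE[OF x, of \<psi>] DERIV_isCont[OF \<psi>] B unfolding E
      by (intro expectation_inverse_process[OF _ \<psi> DERIV_isCont[OF \<phi>] B(2)]) auto
    then show ?thesis unfolding u_def \<psi>_def[symmetric] mass_function_eq[OF x] by simp
  qed
  have v: "caputo_djrbashian_exists b \<nu> u t \<and>
    caputo_djrbashian b \<nu> u t = \<phi> 0 + (LINT p|Q. \<theta> (fst p) * indicator {..t} (Y p))"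
  proof (cases "b = 0")
    case True
    show ?thesis
      by (intro conjI caputo_driftless[OF True \<psi> \<phi> \<theta> B u _ t]) (use ac in \<open>auto simp: u_def\<close>)
  next
    case False
    then have "b > 0" using b by simp
    then show ?thesis
      by (intro conjI caputo_drift[OF _ \<phi> \<theta> B(2,3) u t]) auto
  qed
  have t0: "t \<ge> 0" using t by simp
  \<comment> \<open>The pathwise formula used for \<open>u\<close> is applied a second time, now to
    \<open>\<phi>\<close> with derivative \<open>\<theta>\<close>, and read from right to
    left.\<close>
  have "\<phi> 0 + (LINT p|Q. \<theta> (fst p) * indicator {..t} (Y p)) = (LINT \<omega>|M. \<phi> (E t \<omega>))"
    using E_measurable[OF t0] iE[OF t0, of \<phi>] DERIV_isCont[OF \<phi>] B unfolding E
    by (intro expectation_inverse_process[OF _ \<phi> \<theta>c B(3), symmetric]) auto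
  also have "\<dots> = lam * (\<Sum>m. d m * q t m)"
    unfolding \<phi>_def using expectation_poisson_mix(1)[OF t0 d1] by simp
  also have "(\<Sum>m. d m * q t m) = (\<Sum>m. a n (Suc m) * q t m) - (\<Sum>m. a n m * q t m)"
    unfolding d_def left_diff_distrib
    by (rule suminf_diff[symmetric]) (rule expectation_poisson_mix(2)[OF t0], rule a_bounds)+
  finally have val: "\<phi> 0 + (LINT p|Q. \<theta> (fst p) * indicator {..t} (Y p)) =
      - lam * mass_function M (gfcpp N E X) n t + lam * (LINT x|F. mass_function M (gfcpp N E X) (n - x) t)"
    unfolding mass_function_suminf[OF t0, of n] integral_mass_function[OF t0] by (simp add: algebra_simps)
  show "caputo_djrbashian_exists b \<nu> (mass_function M (gfcpp N E X) n) t"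
    using v by (simp add: u_def)
  show "caputo_djrbashian b \<nu> (mass_function M (gfcpp N E X) n) t =
      - lam * mass_function M (gfcpp N E X) n t + lam * (LINT x|F. mass_function M (gfcpp N E X) (n - x) t)"
    using v val by (simp add: u_def)
qed

end

theorem theorem3p1:
  fixes M :: "'a measure"
    and b lam n :: real
    and \<nu> F\<^sub>X :: "real measure"
    and D E :: "real \<Rightarrow> 'a \<Rightarrow> real"
    and N :: "real \<Rightarrow> 'a \<Rightarrow> nat"
    and X :: "nat \<Rightarrow> 'a \<Rightarrow> real"
    and P :: "real \<Rightarrow> real \<Rightarrow> real"
  assumes "prob_space M"
    and "0 \<le> b" and "levy_measure \<nu>"
    and "levy_subordinator M (bernstein b \<nu>) D"
    and E_def: "E = inverse_process D"
    and "0 < lam" and "poisson_process M lam N"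
    and X_law: "\<And>i. 1 \<le> i \<Longrightarrow> X i \<in> borel_measurable M \<and> distr M borel (X i) = F\<^sub>X"
    and X_indep: "prob_space.indep_vars M (\<lambda>_. borel) X {1..}"
    and indep_N_E: "prob_space.indep_set M
          (generated_events M (\<lambda>t \<omega>. real (N t \<omega>)) {0..}) (generated_events M E {0..})"
    and indep_X_NE: "prob_space.indep_set M
          (generated_events M X {1..})
          (sigma_sets (space M)
             (generated_events M (\<lambda>t \<omega>. real (N t \<omega>)) {0..} \<union> generated_events M E {0..}))"
    and P_def: "P = mass_function M (gfcpp N E X)"
    and "abs_continuous_on_halfline (P n)"
  shows "\<forall>t>0. caputo_djrbashian_exists b \<nu> (P n) t \<and>
           caputo_djrbashian b \<nu> (P n) t = - lam * P n t + lam * (LINT x|F\<^sub>X. P (n - x) t)"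
proof -
  interpret prob_space M by fact
  interpret fractional_compound_poisson M b \<nu> D lam F\<^sub>X E N X
    by unfold_locales (use assms in auto)
  show ?thesis
    using caputo_mass_function[of n] assms(13) unfolding P_def by blast
qed

end
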